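(* For each $n\ge1$ let $\theta\in\mathbb{R}^n$, $\hat\theta_0\in\mathbb{R}^n$ with $\|\hat\theta_0\|=\sqrt n$, and binary vectors $\delta_t\in\{0,1\}^n$ ($t\in\mathbb{N}_0$) with $\delta_0=\mathsf{1}$ be deterministic, and let $M=\frac{\lambda}{n}\theta\theta^\top+Z$ with fixed $\lambda\ge0$ and $Z\sim\mathsf{GOE}(n)$. Assume that for each $t\in\mathbb{N}_0$ the joint empirical measure of $\{(\theta_i,\hat\theta_{0i},\delta_{0i},\dots,\delta_{ti}):i\in[n]\}$ converges in quadratic Wasserstein distance, as $n\to\infty$, to a product measure $\mu\otimes\nu_t$, where $\mu$ is a probability measure on $\mathbb{R}^2$ (fixed, independent of $t$) whose two marginals have unit second moments, and $\nu_t$ is the law of the corresponding initial entries of a random binary string drawn from a probability measure $\nu$ on $\{0,1\}^{\mathbb{N}_0}$. Let $\tau(t,i)=\max\{s\in\{0,\dots,t-1\}:\delta_{si}=1\}$, $w_{ts}=\sum_{i=1}^n\mathbf{1}\{\tau(t,i)=s\}$, and for $0\le s<t$ let $p_t(s)=\nu(\{\omega:\omega_s=1,\omega_{s+1}=\dots=\omega_{t-1}=0\})$. Generate, starting from $\hat\theta_0$, $$x_t=\delta_t\circ\Big(M\hat\theta_t-\frac{1}{\sqrt n\,\|x_{t-1}\|}\sum_{s<t}w_{ts}\hat\theta_s\Big)+(\mathsf{1}-\delta_t)\circ x_{t-1},\qquad\hat\theta_{t+1}=\frac{\sqrt n}{\|x_t\|}x_t,$$ for $t=0,1,2,\dots$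 (for $t=0$ this reads $x_0=M\hat\theta_0$). Define $\rho_0=\int u\hat u\,d\mu(u,\hat u)$ and, for $t\ge1$, $$\rho_t=\frac{\lambda\sum_{s<t}\rho_sp_t(s)}{\sqrt{\sum_{s<t}(\lambda^2\rho_s^2+1)p_t(s)}}.$$ Then for each $t\in\mathbb{N}$, $\big|\frac1n\langle\theta,\hat\theta_t\rangle-\rho_t\big|\xrightarrow[n\to\infty]{\mathrm{p}}0$.
   Context: $\mathsf{GOE}(n)$: symmetric $n\times n$ random matrix with independent $\mathsf{N}(0,1/n)$ entries above the diagonal and independent $\mathsf{N}(0,2/n)$ diagonal entries. $\circ$ is the entrywise (Hadamard) product and $\mathsf{1}$ the all-ones vector. *)

theory Defs
  imports "HOL-Probability.Probability"
begin

section \<open>Finite-dimensional vectors as functions nat => real (only indices < n matter)\<close>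

definition vnorm :: "nat \<Rightarrow> (nat \<Rightarrow> real) \<Rightarrow> real" where
  "vnorm n x = sqrt (\<Sum>i<n. (x i)\<^sup>2)"

definition vinner :: "nat \<Rightarrow> (nat \<Rightarrow> real) \<Rightarrow> (nat \<Rightarrow> real) \<Rightarrow> real" where
  "vinner n x y = (\<Sum>i<n. x i * y i)"

definition matvec :: "nat \<Rightarrow> (nat \<Rightarrow> nat \<Rightarrow> real) \<Rightarrow> (nat \<Rightarrow> real) \<Rightarrow> (nat \<Rightarrow> real)" where
  "matvec n A x = (\<lambda>i. \<Sum>j<n. A i j * x j)"

definition renorm :: "nat \<Rightarrow> (nat \<Rightarrow> real) \<Rightarrow> (nat \<Rightarrow> real)" where
  "renorm n x = (\<lambda>i. sqrt (real n) / vnorm n x * x i)"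

definition tau :: "(nat \<Rightarrow> nat \<Rightarrow> bool) \<Rightarrow> nat \<Rightarrow> nat \<Rightarrow> nat" where
  "tau \<delta> t i = Max {s. s < t \<and> \<delta> s i}"

definition wts :: "nat \<Rightarrow> (nat \<Rightarrow> nat \<Rightarrow> bool) \<Rightarrow> nat \<Rightarrow> nat \<Rightarrow> nat" where
  "wts n \<delta> t s = card {i. i < n \<and> tau \<delta> t i = s}"

text \<open>AMP n M delta h0 t = (x_t, [theta_hat_0, ..., theta_hat_(t+1)]).\<close>
fun AMP :: "nat \<Rightarrow> (nat \<Rightarrow> nat \<Rightarrow> real) \<Rightarrow> (nat \<Rightarrow> nat \<Rightarrow> bool) \<Rightarrow> (nat \<Rightarrow> real) \<Rightarrow> nat
            \<Rightarrow> (nat \<Rightarrow> real) \<times> (nat \<Rightarrow> real) list" where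
  "AMP n M \<delta> h0 0 = (let x = matvec n M h0 in (x, [h0, renorm n x]))"
| "AMP n M \<delta> h0 (Suc t) =
     (case AMP n M \<delta> h0 t of (xprev, hs) \<Rightarrow>
       (let x = (\<lambda>i. if \<delta> (Suc t) i
                      then matvec n M (hs ! Suc t) i
                           - (\<Sum>s<Suc t. real (wts n \<delta> (Suc t) s) * (hs ! s) i)
                             / (sqrt (real n) * vnorm n xprev)
                      else xprev i)
        in (x, hs @ [renorm n x])))"

definition theta_hat :: "nat \<Rightarrow> (nat \<Rightarrow> nat \<Rightarrow> real) \<Rightarrow> (nat \<Rightarrow> nat \<Rightarrow> bool) \<Rightarrow> (nat \<Rightarrow> real) \<Rightarrow> nat \<Rightarrow> (nat \<Rightarrow> real)" where
  "theta_hat n M \<delta> h0 t = snd (AMP n M \<delta> h0 t) ! t"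

definition pt :: "(nat \<Rightarrow> bool) measure \<Rightarrow> nat \<Rightarrow> nat \<Rightarrow> real" where
  "pt \<nu> t s = measure \<nu> {\<omega> \<in> space \<nu>. \<omega> s \<and> (\<forall>r. s < r \<and> r < t \<longrightarrow> \<not> \<omega> r)}"

fun rhos :: "real \<Rightarrow> real \<Rightarrow> (nat \<Rightarrow> nat \<Rightarrow> real) \<Rightarrow> nat \<Rightarrow> real list" where
  "rhos lam r0 p 0 = [r0]"
| "rhos lam r0 p (Suc t) =
     (let rs = rhos lam r0 p t in
      rs @ [lam * (\<Sum>s<Suc t. rs ! s * p (Suc t) s)
            / sqrt (\<Sum>s<Suc t. (lam\<^sup>2 * (rs ! s)\<^sup>2 + 1) * p (Suc t) s)])"

definition rho :: "real \<Rightarrow> real \<Rightarrow> (nat \<Rightarrow> nat \<Rightarrow> real) \<Rightarrow> nat \<Rightarrow> real" where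
  "rho lam r0 p t = rhos lam r0 p t ! t"

definition couplings :: "'a measure \<Rightarrow> 'b measure \<Rightarrow> ('a \<times> 'b) measure set" where
  "couplings P Q = {\<pi>. sets \<pi> = sets (P \<Otimes>\<^sub>M Q) \<and> prob_space \<pi>
                       \<and> distr \<pi> P fst = P \<and> distr \<pi> Q snd = Q}"

text \<open>Squared Wasserstein-2 distance for a squared-distance cost c.\<close>
definition W2sq :: "('a \<Rightarrow> 'a \<Rightarrow> real) \<Rightarrow> 'a measure \<Rightarrow> 'a measure \<Rightarrow> ennreal" where
  "W2sq c P Q = (INF \<pi> \<in> couplings P Q. \<integral>\<^sup>+ z. ennreal (c (fst z) (snd z)) \<partial>\<pi>)"

text \<open>Points (theta_i, theta_hat0_i, (delta_0i..delta_ti)) of R^2 x {0,1}^(t+1);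
  binary coordinates stored as booleans on index set {..t}.\<close>
definition Xsp :: "nat \<Rightarrow> ((real \<times> real) \<times> (nat \<Rightarrow> bool)) measure" where
  "Xsp t = (borel :: (real \<times> real) measure) \<Otimes>\<^sub>M PiM {..t} (\<lambda>_. count_space UNIV)"

definition cost :: "nat \<Rightarrow> (real \<times> real) \<times> (nat \<Rightarrow> bool) \<Rightarrow> (real \<times> real) \<times> (nat \<Rightarrow> bool) \<Rightarrow> real" where
  "cost t z z' = (fst (fst z) - fst (fst z'))\<^sup>2 + (snd (fst z) - snd (fst z'))\<^sup>2
                 + (\<Sum>s\<le>t. (of_bool (snd z s) - of_bool (snd z' s) :: real)\<^sup>2)"

definition emp :: "nat \<Rightarrow> nat \<Rightarrow> (nat \<Rightarrow> real) \<Rightarrow> (nat \<Rightarrow> real) \<Rightarrow> (nat \<Rightarrow> nat \<Rightarrow> bool)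
                   \<Rightarrow> ((real \<times> real) \<times> (nat \<Rightarrow> bool)) measure" where
  "emp n t \<theta> h0 \<delta> = distr (measure_pmf (pmf_of_set {..<n})) (Xsp t)
      (\<lambda>i. ((\<theta> i, h0 i), restrict (\<lambda>s. \<delta> s i) {..t}))"

definition lim_meas :: "nat \<Rightarrow> (real \<times> real) measure \<Rightarrow> (nat \<Rightarrow> bool) measure
                        \<Rightarrow> ((real \<times> real) \<times> (nat \<Rightarrow> bool)) measure" where
  "lim_meas t \<mu> \<nu> = \<mu> \<Otimes>\<^sub>M distr \<nu> (PiM {..t} (\<lambda>_. count_space UNIV)) (\<lambda>\<omega>. restrict \<omega> {..t})"

end

theory Submission
  imports Defs
begin

text \<open>
  Write \<open>M\<close> as a rank-one part plus \<open>Z\<close>. All steps of the algorithm are linear except for the scalar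
  normalisations, so the iterates are combinations, with scalar coefficients that converge in
  probability, of words \<open>Z D\<^sub>1 Z D\<^sub>2 \<dots> Z D\<^sub>k v\<close> with deterministic diagonal matrices \<open>D\<^sub>i\<close>. Asymptotically
  \<open>Z\<close> acts as \<open>\<ell> + \<ell>\<^sup>*\<close> on a full Fock space, where \<open>\<ell>\<^sup>* D \<ell>\<close> is the normalised trace of \<open>D\<close>, and the
  Onsager term is exactly the \<open>\<ell>\<^sup>*\<close> part of \<open>Z\<close> applied to the current estimate. What remains is
  \<open>u\<^sub>t = \<ell> \<theta>\<^sub>t\<close>, hence \<open>\<langle>v, u\<^sub>t\<rangle> / n \<rightarrow> 0\<close> for deterministic \<open>v\<close> and
  \<open>\<langle>u\<^sub>t, A u\<^sub>t\<rangle> / n \<approx> (tr A / n) \<parallel>\<theta>\<^sub>t\<parallel>\<^sup>2 / n\<close>, and these two facts give the recursion for \<open>\<rho>\<^sub>t\<close>.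

  The second fact follows from the first by moving one \<open>Z\<close> across the inner product. For the first,
  \<open>\<ell> D\<^sub>1 \<dots> \<ell> D\<^sub>k v\<close> is compared with the sum over self-avoiding paths: products of distinct entries are
  orthogonal, and each walk that revisits a vertex loses a factor \<open>1 / n\<close>. The errors are propagated
  with the bound \<open>\<parallel>Z\<parallel>\<^sup>2 \<le> n\<^sup>\<beta>\<close> for every \<open>\<beta> > 0\<close>, which follows from moments of traces.
\<close>

section \<open>Walks and edge counts\<close>

text \<open>The coefficients of the words depend on the whole matrix, but they converge, so it
  suffices to understand the words themselves, whose letters are deterministic. The letters come
  from the update pattern: a coordinate that skips updates keeps the value computed at its last
  update, so the current iterate is a sum over s of the update made at time s, masked to the
  coordinates last updated then. The normalised trace of that mask is w/n, the weight in the Onsager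
  term. The errors in the words have squared norm of order one, up to small powers of n, against
  order n for the vectors; so an operator bound that loses an arbitrarily small power of n is
  enough. The signal part and the created part of a masked iterate are asymptotically orthogonal, so
  their squared norms add: this is the denominator of the recursion, and its summand 1 is the
  normalised squared norm of an earlier estimate. The product form of the limit law makes the masked
  share of the energy of theta equal to the share of masked coordinates, hence the same p_t(s) for
  both parts.\<close>

definition walks :: "nat \<Rightarrow> nat \<Rightarrow> nat list set" where
  "walks n k = {xs. set xs \<subseteq> {..<n} \<and> length xs = k}"

lemma finite_walks [simp]: "finite (walks n k)"
  unfolding walks_def by (rule finite_lists_length_eq) simp

lemma walks_0 [simp]: "walks n 0 = {[]}"
  by (auto simp: walks_def)

lemma sum_walks_Suc: "(\<Sum>xs\<in>walks n (Suc k). f xs) = (\<Sum>i<n. \<Sum>xs\<in>walks n k. f (i # xs))"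
proof -
  have "walks n (Suc k) = (\<lambda>(i, xs). i # xs) ` ({..<n} \<times> walks n k)"
    by (auto simp: walks_def image_iff length_Suc_conv)
  moreover have "inj_on (\<lambda>(i, xs). i # xs) ({..<n} \<times> walks n k)"
    by (auto simp: inj_on_def)
  ultimately have "(\<Sum>xs\<in>walks n (Suc k). f xs) = (\<Sum>p\<in>{..<n} \<times> walks n k. f (fst p # snd p))"
    by (simp add: sum.reindex case_prod_unfold)
  then show ?thesis
    by (simp add: sum.cartesian_product case_prod_unfold)
qed

lemma sum_walks_last:
  fixes g :: "nat \<Rightarrow> real"
  shows "(\<Sum>xs\<in>walks n (Suc k). g (last xs)) = real n ^ k * (\<Sum>i<n. g i)"
proof (induction k)
  case 0
  show ?case by (simp add: sum_walks_Suc[of _ n 0, simplified])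
next
  case (Suc k)
  have "(\<Sum>xs\<in>walks n (Suc k). g (last (i # xs))) = (\<Sum>xs\<in>walks n (Suc k). g (last xs))" for i
    by (rule sum.cong) (auto simp: walks_def)
  then show ?case
    by (subst sum_walks_Suc) (simp add: Suc)
qed

text \<open>The ends are different positions once there is at least one step, so the sum factorises
  and only the \<open>k\<close> inner vertices are free. Having both ends weighted leaves one power
  of n fewer than \<open>sum_walks_last\<close>; this is the source of the factor 1/n in the second
  moment of inner products.\<close>

lemma sum_walks_hd_last:
  fixes f g :: "nat \<Rightarrow> real"
  shows "(\<Sum>xs\<in>walks n (Suc (Suc k)). f (hd xs) * g (last xs)) = real n ^ k * (\<Sum>i<n. f i) * (\<Sum>i<n. g i)"
proof -
  have "(\<Sum>xs\<in>walks n (Suc k). g (last (i # xs))) = (\<Sum>xs\<in>walks n (Suc k). g (last xs))" for i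
    by (rule sum.cong) (auto simp: walks_def)
  then show ?thesis
    unfolding sum_walks_Suc[of _ n "Suc k"] list.sel sum_distrib_left[symmetric] sum_walks_last
    by (simp add: sum_distrib_right[symmetric] mult.assoc mult.left_commute)
qed

section \<open>Unordered edges and their multiplicities along a walk\<close>

definition edge :: "nat \<Rightarrow> nat \<Rightarrow> nat \<times> nat" where
  "edge i j = (min i j, max i j)"

lemma edge_commute: "edge i j = edge j i"
  by (simp add: edge_def min.commute max.commute)

lemma edge_eq_iff: "edge i j = edge k l \<longleftrightarrow> (i = k \<and> j = l) \<or> (i = l \<and> j = k)"
  by (auto simp: edge_def min_def max_def)

fun edge_count :: "nat list \<Rightarrow> nat \<times> nat \<Rightarrow> nat" where
  "edge_count (a # b # xs) e = of_bool (e = edge a b) + edge_count (b # xs) e"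
| "edge_count _ e = 0"

fun walk_prod :: "(nat \<Rightarrow> nat \<Rightarrow> real) \<Rightarrow> nat list \<Rightarrow> real" where
  "walk_prod Y (a # b # xs) = Y a b * walk_prod Y (b # xs)"
| "walk_prod Y _ = 1"

lemma walk_prod_Cons: "xs \<noteq> [] \<Longrightarrow> walk_prod Y (a # xs) = Y a (hd xs) * walk_prod Y xs"
  by (cases xs) auto

definition edges :: "nat \<Rightarrow> (nat \<times> nat) set" where
  "edges n = {(i, j). i \<le> j \<and> j < n}"

lemma finite_edges [simp]: "finite (edges n)"
  by (rule finite_subset[of _ "{..<n} \<times> {..<n}"]) (auto simp: edges_def)

lemma edge_in_edges: "i < n \<Longrightarrow> j < n \<Longrightarrow> edge i j \<in> edges n"
  by (auto simp: edges_def edge_def)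

lemma sum_edge_count: "set xs \<subseteq> {..<n} \<Longrightarrow> (\<Sum>e\<in>edges n. edge_count xs e) = length xs - 1"
proof (induction xs rule: induct_list012)
  case (3 a b xs)
  have "edge a b \<in> edges n"
    using 3(3) edge_in_edges by auto
  then show ?case
    using 3 by (simp add: sum.distrib sum.If_cases of_bool_def)
qed auto

lemma walk_prod_eq_prod_edges:
  assumes "set xs \<subseteq> {..<n}" and "\<And>i j. i < n \<Longrightarrow> j < n \<Longrightarrow> Y i j = Y j i"
  shows "walk_prod Y xs = (\<Prod>e\<in>edges n. Y (fst e) (snd e) ^ edge_count xs e)"
  using assms(1)
proof (induction xs rule: induct_list012)
  case (3 a b xs)
  have eq: "edge a b \<in> edges n"
    using 3(3) edge_in_edges by auto
  have "Y a b = Y (fst (edge a b)) (snd (edge a b))"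
    using 3(3) assms(2)[of a b] by (auto simp: edge_def min_def max_def)
  moreover have "(\<Prod>e\<in>edges n. Y (fst e) (snd e) ^ of_bool (e = edge a b)) = (\<Prod>e\<in>edges n. if e = edge a b then Y (fst e) (snd e) else 1)"
    by (rule prod.cong) auto
  ultimately show ?case
    using 3 eq by (simp add: power_add prod.distrib prod.If_cases)
qed auto

lemma edge_count_pos_imp:
  assumes "edge_count xs e > 0"
  shows "\<exists>i j. e = edge i j \<and> i \<in> set xs \<and> j \<in> set xs"
  using assms
proof (induction xs rule: induct_list012)
  case (3 a b xs)
  show ?case
  proof (cases "e = edge a b")
    case True
    then show ?thesis by auto
  next
    case False
    then have "edge_count (b # xs) e > 0" using 3(3) by simp
    then obtain i j where "e = edge i j" "i \<in> set (b # xs)" "j \<in> set (b # xs)" using 3(2) by blast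
    then show ?thesis by (metis list.set_intros(2))
  qed
qed auto

lemma edge_count_eq_0: "a \<notin> set xs \<or> b \<notin> set xs \<Longrightarrow> edge_count xs (edge a b) = 0"
proof (rule ccontr)
  assume *: "a \<notin> set xs \<or> b \<notin> set xs" and "edge_count xs (edge a b) \<noteq> 0"
  then obtain i j where "edge a b = edge i j" "i \<in> set xs" "j \<in> set xs"
    using edge_count_pos_imp[of xs "edge a b"] by blast
  then show False using * unfolding edge_eq_iff by blast
qed

text \<open>Recovers the vertices of a walk from its exponents. A single vertex has no edge, hence
  the length bound.\<close>

lemma set_eq_edge_ends:
  assumes "length xs \<ge> 2"
  shows "set xs = {i. \<exists>j. edge_count xs (edge i j) > 0}"
proof
  show "{i. \<exists>j. edge_count xs (edge i j) > 0} \<subseteq> set xs"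
  proof clarify
    fix i j assume "edge_count xs (edge i j) > 0"
    then show "i \<in> set xs" using edge_count_eq_0[of i xs j] by (cases "i \<in> set xs") auto
  qed
  have "\<exists>j. edge_count xs (edge i j) > 0" if "i \<in> set xs" for i
    using assms that
  proof (induction xs rule: induct_list012)
    case (3 a b xs)
    show ?case
    proof (cases "i = a \<or> i = b")
      case True
      then have "edge_count (a # b # xs) (edge i (if i = a then b else a)) > 0"
        by (auto simp: edge_eq_iff)
      then show ?thesis by blast
    next
      case False
      then have "length (b # xs) \<ge> 2" "i \<in> set (b # xs)"
        using 3 by (cases xs; auto)+
      then obtain j where "edge_count (b # xs) (edge i j) > 0" using 3 by blast
      then have "edge_count (a # b # xs) (edge i j) > 0" by simp
      then show ?thesis by blast
    qed
  qed auto
  then show "set xs \<subseteq> {i. \<exists>j. edge_count xs (edge i j) > 0}" by blast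
qed

lemma edge_count_distinct_le_1: "distinct xs \<Longrightarrow> edge_count xs e \<le> 1"
proof (induction xs rule: induct_list012)
  case (3 a b xs)
  then have "edge_count (b # xs) (edge a b) = 0"
    by (intro edge_count_eq_0) auto
  with 3 show ?case by auto
qed auto

lemma edge_count_loop: "distinct xs \<Longrightarrow> edge_count xs (edge a a) = 0"
  by (induction xs rule: induct_list012) (auto simp: edge_eq_iff)

text \<open>A repeated edge would have to be the new first one, from \<open>i\<close> to the head
  \<open>j\<close> of \<open>xs\<close>. On a self-avoiding walk the head has only the second vertex
  as neighbour, so a repetition forces the walk to return to \<open>i\<close> at once.\<close>

lemma edge_count_Cons_distinct:
  assumes "distinct xs" and "\<not> (\<exists>j ys. xs = j # i # ys)"
  shows "edge_count (i # xs) e \<le> 1"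
proof (cases xs)
  case (Cons j ys)
  have "edge_count xs (edge i j) = 0"
  proof (cases "i = j")
    case True
    then show ?thesis using edge_count_loop[OF assms(1)] by simp
  next
    case False
    show ?thesis
    proof (cases ys)
      case Nil
      then show ?thesis using Cons by simp
    next
      case (Cons b zs)
      have "b \<noteq> i" using assms(2) \<open>xs = j # ys\<close> Cons by auto
      moreover have "edge_count (b # zs) (edge i j) = 0"
        using assms(1) \<open>xs = j # ys\<close> Cons by (intro edge_count_eq_0) auto
      ultimately show ?thesis
        using False \<open>xs = j # ys\<close> Cons by (auto simp: edge_eq_iff)
    qed
  qed
  then show ?thesis
    using edge_count_distinct_le_1[OF assms(1), of e] Cons by auto
qed auto

lemma edge_count_backtrack:
  assumes "distinct (j # i # ys)"
  shows "edge_count (i # j # i # ys) e = (if e = edge i j then 2 else edge_count (i # ys) e)"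
    and "edge_count (i # ys) (edge i j) = 0"
proof -
  show "edge_count (i # ys) (edge i j) = 0"
    using assms by (intro edge_count_eq_0) auto
  then show "edge_count (i # j # i # ys) e = (if e = edge i j then 2 else edge_count (i # ys) e)"
    by (auto simp: edge_commute[of j i])
qed

section \<open>Weighted self-avoiding walk sums and the defect in their recursion\<close>

fun weight :: "(nat \<Rightarrow> real) list \<Rightarrow> (nat \<Rightarrow> real) \<Rightarrow> nat list \<Rightarrow> real" where
  "weight [] v xs = v (hd xs)"
| "weight (D # Ds) v xs = D (hd (tl xs)) * weight Ds v (tl xs)"

definition contraction :: "nat \<Rightarrow> (nat \<Rightarrow> real) \<Rightarrow> bool" where
  "contraction n D \<longleftrightarrow> (\<forall>i<n. \<bar>D i\<bar> \<le> 1)"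

lemma abs_weight_le:
  assumes "\<forall>D\<in>set Ds. contraction n D" and "length xs = Suc (length Ds)" and "set xs \<subseteq> {..<n}"
  shows "\<bar>weight Ds v xs\<bar> \<le> \<bar>v (last xs)\<bar>"
  using assms
proof (induction Ds arbitrary: xs)
  case Nil
  then show ?case by (cases xs) auto
next
  case (Cons D Ds)
  obtain a ys where xs: "xs = a # ys" "length ys = Suc (length Ds)"
    using Cons.prems by (cases xs) auto
  then have ne: "ys \<noteq> []" by auto
  then have "hd ys < n" using Cons.prems xs hd_in_set by fastforce
  then have "\<bar>D (hd ys)\<bar> \<le> 1" using Cons.prems by (auto simp: contraction_def)
  moreover have "\<bar>weight Ds v ys\<bar> \<le> \<bar>v (last ys)\<bar>"
    using Cons xs by auto
  ultimately have "\<bar>D (hd ys)\<bar> * \<bar>weight Ds v ys\<bar> \<le> 1 * \<bar>v (last ys)\<bar>"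
    by (intro mult_mono) auto
  then show ?case using xs ne by (simp add: abs_mult)
qed

text \<open>Entry \<open>i\<close> of Y D1 Y D2 ... Y Dk v, expanded over walks from
  \<open>i\<close>, with all walks that revisit a vertex dropped. The row index \<open>i\<close>
  carries no weight; the last vertex carries both Dk and v.\<close>

definition path_vec :: "nat \<Rightarrow> (nat \<Rightarrow> nat \<Rightarrow> real) \<Rightarrow> (nat \<Rightarrow> real) list \<Rightarrow> (nat \<Rightarrow> real) \<Rightarrow> nat \<Rightarrow> real" where
  "path_vec n Y Ds v i =
     (\<Sum>xs | xs \<in> walks n (length Ds) \<and> distinct (i # xs). weight Ds v (i # xs) * walk_prod Y (i # xs))"

lemma path_vec_if:
  "path_vec n Y Ds v i = (\<Sum>xs\<in>walks n (length Ds).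
     if distinct (i # xs) then weight Ds v (i # xs) * walk_prod Y (i # xs) else 0)"
  unfolding path_vec_def by (rule sum.inter_filter) simp

definition mean :: "nat \<Rightarrow> (nat \<Rightarrow> real) \<Rightarrow> real" where
  "mean n D = (\<Sum>i<n. D i) / real n"

text \<open>The defect of the self-avoiding sums in the three-term recursion that
  \<open>free_vec\<close> obeys exactly. For \<open>w = []\<close> there is nothing yet to
  annihilate, hence the default 0.\<close>

definition step_err :: "nat \<Rightarrow> (nat \<Rightarrow> nat \<Rightarrow> real) \<Rightarrow> (nat \<Rightarrow> real) \<Rightarrow> (nat \<Rightarrow> real) list \<Rightarrow> (nat \<Rightarrow> real) \<Rightarrow> nat \<Rightarrow> real" where
  "step_err n A D w v i = matvec n A (\<lambda>j. D j * path_vec n A w v j) i - path_vec n A (D # w) v i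
     - (case w of [] \<Rightarrow> 0 | D1 # w1 \<Rightarrow> mean n D * (D1 i * path_vec n A w1 v i))"

text \<open>Twice the constants of \<open>loop_part_moment\<close> and
  \<open>missed_part_moment\<close>; the factors 2 come from (a - b)^2 <= 2 a^2 + 2 b^2.\<close>

definition step_const :: "nat \<Rightarrow> real" where
  "step_const k = 2 * (real ((k + 2) ^ (k + 2)) * 3 ^ (k + 1) * real (k + 1)) + 2 * (real (k ^ k) * 3 ^ k * real (k\<^sup>2))"

section \<open>Orthogonal polynomials of the matrix entries\<close>

locale goe = prob_space P for P :: "'w measure" +
  fixes n :: nat and Y :: "'w \<Rightarrow> nat \<Rightarrow> nat \<Rightarrow> real"
  assumes n_pos: "n \<ge> 1"
    and sym: "\<And>\<omega> i j. i < n \<Longrightarrow> j < n \<Longrightarrow> Y \<omega> i j = Y \<omega> j i"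
    and indep: "indep_vars (\<lambda>_. borel) (\<lambda>(i, j) \<omega>. Y \<omega> i j) {(i, j). i \<le> j \<and> j < n}"
    and off: "\<And>i j. i < j \<Longrightarrow> j < n \<Longrightarrow>
          distributed P lborel (\<lambda>\<omega>. Y \<omega> i j) (normal_density 0 (sqrt (1 / real n)))"
    and diag: "\<And>i. i < n \<Longrightarrow>
          distributed P lborel (\<lambda>\<omega>. Y \<omega> i i) (normal_density 0 (sqrt (2 / real n)))"

text \<open>The monic Hermite polynomials of variance \<open>s\<close>; only the degrees \<open>k \<le> 2\<close> are meant.\<close>

definition hpoly :: "real \<Rightarrow> nat \<Rightarrow> real \<Rightarrow> real" where
  "hpoly s k z = (if k = 2 then z\<^sup>2 - s else z ^ k)"

lemma hpoly_simps [simp]: "hpoly s 0 z = 1" "hpoly s (Suc 0) z = z" "hpoly s 2 z = z\<^sup>2 - s"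
  by (auto simp: hpoly_def)

lemma hpoly_measurable [measurable]: "hpoly s k \<in> borel_measurable borel"
  unfolding hpoly_def by simp

context goe
begin

section \<open>Gaussian moments of the independent entries\<close>

definition evar :: "nat \<times> nat \<Rightarrow> real" where
  "evar e = (if fst e = snd e then 2 else 1) / real n"

definition entry :: "nat \<times> nat \<Rightarrow> 'w \<Rightarrow> real" where
  "entry e \<omega> = Y \<omega> (fst e) (snd e)"

lemma evar_pos: "evar e > 0"
  using n_pos by (auto simp: evar_def)

lemma evar_le: "evar e \<le> 2 / real n"
  by (auto simp: evar_def divide_right_mono)

lemma entry_distributed:
  assumes "e \<in> edges n"
  shows "distributed P lborel (entry e) (normal_density 0 (sqrt (evar e)))"
proof (cases e)
  case (Pair i j)
  then have "entry e = (\<lambda>\<omega>. Y \<omega> i j)" by (auto simp: entry_def)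
  then show ?thesis
    using assms off[of i j] diag[of i] Pair by (cases "i = j") (auto simp: edges_def evar_def)
qed

lemma entry_measurable [measurable]: "e \<in> edges n \<Longrightarrow> entry e \<in> borel_measurable P"
  using distributed_measurable[OF entry_distributed] by (simp cong: measurable_cong_sets)

lemma entry_power:
  assumes e: "e \<in> edges n"
  shows integrable_entry_power: "integrable P (\<lambda>\<omega>. entry e \<omega> ^ k)"
    and expectation_entry_even: "expectation (\<lambda>\<omega>. entry e \<omega> ^ (2 * k)) = evar e ^ k * (fact (2 * k) / (2 ^ k * fact k))"
    and expectation_entry_odd: "expectation (\<lambda>\<omega>. entry e \<omega> ^ (2 * k + 1)) = 0"
proof -
  have s: "sqrt (evar e) > 0" using evar_pos by simp
  have 1: "integrable P (\<lambda>\<omega>. entry e \<omega> ^ k) \<longleftrightarrow> integrable lborel (\<lambda>x. normal_density 0 (sqrt (evar e)) x * x ^ k)" for k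
    by (subst distributed_integrable[OF entry_distributed[OF e], of "\<lambda>x. x ^ k"]) auto
  have 2: "expectation (\<lambda>\<omega>. entry e \<omega> ^ k) = (\<integral>x. normal_density 0 (sqrt (evar e)) x * x ^ k \<partial>lborel)" for k
    by (subst distributed_integral[OF entry_distributed[OF e], of "\<lambda>x. x ^ k"]) auto
  show "integrable P (\<lambda>\<omega>. entry e \<omega> ^ k)"
    unfolding 1 using integrable_normal_moment[OF s, of 0 k] by simp
  show "expectation (\<lambda>\<omega>. entry e \<omega> ^ (2 * k)) = evar e ^ k * (fact (2 * k) / (2 ^ k * fact k))"
    unfolding 2 using integral_normal_moment_even[OF s, of 0 k] evar_pos[of e]
    by (simp add: power_divide)
  show "expectation (\<lambda>\<omega>. entry e \<omega> ^ (2 * k + 1)) = 0"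
    unfolding 2 using integral_normal_moment_odd[OF s, of 0 k] by simp
qed

lemma entry_low_moments:
  assumes e: "e \<in> edges n"
  shows "expectation (entry e) = 0" "expectation (\<lambda>\<omega>. (entry e \<omega>)\<^sup>2) = evar e"
    "expectation (\<lambda>\<omega>. entry e \<omega> ^ 3) = 0" "expectation (\<lambda>\<omega>. entry e \<omega> ^ 4) = 3 * (evar e)\<^sup>2"
  using expectation_entry_odd[OF e, of 0] expectation_entry_even[OF e, of 1]
    expectation_entry_odd[OF e, of 1] expectation_entry_even[OF e, of 2]
  by (auto simp: fact_numeral power2_eq_square)

lemma expectation_prod_entries:
  fixes f :: "nat \<times> nat \<Rightarrow> real \<Rightarrow> real"
  assumes "\<And>e. e \<in> edges n \<Longrightarrow> f e \<in> borel_measurable borel"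
    and "\<And>e. e \<in> edges n \<Longrightarrow> integrable P (\<lambda>\<omega>. f e (entry e \<omega>))"
  shows "integrable P (\<lambda>\<omega>. \<Prod>e\<in>edges n. f e (entry e \<omega>))"
    and "expectation (\<lambda>\<omega>. \<Prod>e\<in>edges n. f e (entry e \<omega>)) = (\<Prod>e\<in>edges n. expectation (\<lambda>\<omega>. f e (entry e \<omega>)))"
proof -
  have "indep_vars (\<lambda>_. borel) entry (edges n)"
    using indep by (simp add: entry_def[abs_def] edges_def case_prod_unfold)
  from indep_vars_compose2[OF this assms(1)]
  have "indep_vars (\<lambda>_. borel) (\<lambda>e \<omega>. f e (entry e \<omega>)) (edges n)" by simp
  note ind = this
  show "integrable P (\<lambda>\<omega>. \<Prod>e\<in>edges n. f e (entry e \<omega>))"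
    by (rule indep_vars_integrable[OF finite_edges ind]) (rule assms(2))
  show "expectation (\<lambda>\<omega>. \<Prod>e\<in>edges n. f e (entry e \<omega>)) = (\<Prod>e\<in>edges n. expectation (\<lambda>\<omega>. f e (entry e \<omega>)))"
    by (rule indep_vars_lebesgue_integral[OF finite_edges ind]) (rule assms(2))
qed

text \<open>For z of variance s the square of z^2 - s has mean 3 s^2 - 2 s^2 + s^2 = 2 s^2. With s
  <= 2/n this is at most 8/n^2, so the single rate 3/n per degree covers degree 1 and degree 2, on
  and off the diagonal.\<close>

lemma hpoly_moments:
  assumes e: "e \<in> edges n" and kl: "k \<le> 2" "l \<le> 2"
  shows integrable_hpoly_mult: "integrable P (\<lambda>\<omega>. hpoly (evar e) k (entry e \<omega>) * hpoly (evar e) l (entry e \<omega>))"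
    and expectation_hpoly_orthogonal: "k \<noteq> l \<Longrightarrow>
      expectation (\<lambda>\<omega>. hpoly (evar e) k (entry e \<omega>) * hpoly (evar e) l (entry e \<omega>)) = 0"
    and expectation_hpoly_square: "expectation (\<lambda>\<omega>. hpoly (evar e) k (entry e \<omega>) * hpoly (evar e) k (entry e \<omega>)) \<le> (3 / real n) ^ k"
proof -
  note int [simp] = integrable_entry_power[OF e] integrable_entry_power[OF e, of 1, simplified]
  note mom = entry_low_moments[OF e]
  have k: "k = 0 \<or> k = Suc 0 \<or> k = 2" and l: "l = 0 \<or> l = Suc 0 \<or> l = 2" using kl by auto
  have eqs: "z * (z\<^sup>2 - s) = z ^ 3 - s * z" "(z\<^sup>2 - s) * z = z ^ 3 - s * z"
    "(z\<^sup>2 - s) * (z\<^sup>2 - s) = z ^ 4 - 2 * s * z\<^sup>2 + s\<^sup>2" "(z\<^sup>2 - s)\<^sup>2 = z ^ 4 - 2 * s * z\<^sup>2 + s\<^sup>2" "z * z = z\<^sup>2" for z s :: real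
    by (simp_all add: algebra_simps power2_eq_square power3_eq_cube power4_eq_xxxx)
  show "integrable P (\<lambda>\<omega>. hpoly (evar e) k (entry e \<omega>) * hpoly (evar e) l (entry e \<omega>))"
    using k l by (auto simp: eqs)
  show "k \<noteq> l \<Longrightarrow> expectation (\<lambda>\<omega>. hpoly (evar e) k (entry e \<omega>) * hpoly (evar e) l (entry e \<omega>)) = 0"
    using k l mom by (auto simp: eqs prob_space)
  have n: "real n > 0" using n_pos by simp
  have "(evar e)\<^sup>2 \<le> (2 / real n)\<^sup>2"
    using evar_le[of e] evar_pos[of e] by (intro power_mono) auto
  then have 2: "2 * (evar e)\<^sup>2 \<le> (3 / real n)\<^sup>2" using n by (simp add: power_divide field_simps)
  have 1: "evar e \<le> 3 / real n" using evar_le[of e] n by (auto simp: field_simps)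
  show "expectation (\<lambda>\<omega>. hpoly (evar e) k (entry e \<omega>) * hpoly (evar e) k (entry e \<omega>)) \<le> (3 / real n) ^ k"
    using k
  proof (elim disjE)
    assume "k = 2"
    moreover have "expectation (\<lambda>\<omega>. entry e \<omega> ^ 4 - 2 * evar e * (entry e \<omega>)\<^sup>2 + (evar e)\<^sup>2) = 2 * (evar e)\<^sup>2"
      using mom by (simp add: prob_space) (simp add: power2_eq_square)
    ultimately show ?thesis using 2 by (simp add: eqs)
  qed (use mom 1 in \<open>simp_all add: eqs prob_space\<close>)
qed

text \<open>An orthogonal family indexed by exponent vectors. Centring the squares matters: a plain
  monomial with an edge of exponent 2 would correlate with the one in which that edge is
  absent.\<close>

definition psi :: "(nat \<times> nat \<Rightarrow> nat) \<Rightarrow> 'w \<Rightarrow> real" where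
  "psi k \<omega> = (\<Prod>e\<in>edges n. hpoly (evar e) (k e) (entry e \<omega>))"

text \<open>Independence factorises the expectation over edges, so one edge with differing exponents
  makes it vanish, and each unit of degree contributes at most 3/n.\<close>

lemma psi_moments:
  assumes k: "\<forall>e. k e \<le> 2" "\<forall>e. l e \<le> 2"
  shows integrable_psi_mult: "integrable P (\<lambda>\<omega>. psi k \<omega> * psi l \<omega>)"
    and expectation_psi_orthogonal: "(\<exists>e\<in>edges n. k e \<noteq> l e) \<Longrightarrow> expectation (\<lambda>\<omega>. psi k \<omega> * psi l \<omega>) = 0"
    and expectation_psi_square: "expectation (\<lambda>\<omega>. psi k \<omega> * psi k \<omega>) \<le> (3 / real n) ^ (\<Sum>e\<in>edges n. k e)"
proof -
  have eq: "psi k \<omega> * psi l \<omega> = (\<Prod>e\<in>edges n. hpoly (evar e) (k e) (entry e \<omega>) * hpoly (evar e) (l e) (entry e \<omega>))" for k l \<omega>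
    by (simp add: psi_def prod.distrib)
  have int: "integrable P (\<lambda>\<omega>. psi k \<omega> * psi l \<omega>)"
    and exp: "expectation (\<lambda>\<omega>. psi k \<omega> * psi l \<omega>) =
      (\<Prod>e\<in>edges n. expectation (\<lambda>\<omega>. hpoly (evar e) (k e) (entry e \<omega>) * hpoly (evar e) (l e) (entry e \<omega>)))"
    if "\<forall>e. k e \<le> 2" "\<forall>e. l e \<le> 2" for k l
    unfolding eq using that
    by (auto intro!: expectation_prod_entries[of "\<lambda>e z. hpoly (evar e) (k e) z * hpoly (evar e) (l e) z"] integrable_hpoly_mult)
  show "integrable P (\<lambda>\<omega>. psi k \<omega> * psi l \<omega>)" using int k by blast
  show "expectation (\<lambda>\<omega>. psi k \<omega> * psi l \<omega>) = 0" if "\<exists>e\<in>edges n. k e \<noteq> l e"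
    unfolding exp[OF k] using that k by (auto intro!: prod_zero bexI expectation_hpoly_orthogonal)
  show "expectation (\<lambda>\<omega>. psi k \<omega> * psi k \<omega>) \<le> (3 / real n) ^ (\<Sum>e\<in>edges n. k e)"
    unfolding exp[OF k(1) k(1)] power_sum
    using k by (intro prod_mono) (auto intro!: expectation_hpoly_square)
qed

lemma measurable_psi [measurable]: "psi k \<in> borel_measurable P"
  unfolding psi_def[abs_def] by measurable

text \<open>Distinct edge counts give orthogonal monomials, and the edge count of a walk determines its
  vertex set, hence the walk up to finitely many choices.\<close>

lemma second_moment_walk_sum:
  assumes sub: "\<Gamma> \<subseteq> walks n (Suc k)"
    and le2: "\<And>xs e. xs \<in> \<Gamma> \<Longrightarrow> edge_count xs e \<le> 2"
    and vert: "\<And>xs ys. xs \<in> \<Gamma> \<Longrightarrow> ys \<in> \<Gamma> \<Longrightarrow> edge_count xs = edge_count ys \<Longrightarrow> set xs = set ys"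
  shows "integrable P (\<lambda>\<omega>. (\<Sum>xs\<in>\<Gamma>. c xs * psi (edge_count xs) \<omega>)\<^sup>2)"
    and "expectation (\<lambda>\<omega>. (\<Sum>xs\<in>\<Gamma>. c xs * psi (edge_count xs) \<omega>)\<^sup>2)
      \<le> real (Suc k ^ Suc k) * (3 / real n) ^ k * (\<Sum>xs\<in>\<Gamma>. (c xs)\<^sup>2)"
proof -
  have fin: "finite \<Gamma>" using sub finite_walks finite_subset by blast
  let ?E = "\<lambda>xs ys. expectation (\<lambda>\<omega>. psi (edge_count xs) \<omega> * psi (edge_count ys) \<omega>)"
  have eq: "(\<Sum>xs\<in>\<Gamma>. c xs * psi (edge_count xs) \<omega>)\<^sup>2
     = (\<Sum>xs\<in>\<Gamma>. \<Sum>ys\<in>\<Gamma>. c xs * c ys * (psi (edge_count xs) \<omega> * psi (edge_count ys) \<omega>))" for \<omega>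
    by (simp add: power2_eq_square sum_product algebra_simps)
  have int: "integrable P (\<lambda>\<omega>. psi (edge_count xs) \<omega> * psi (edge_count ys) \<omega>)" if "xs \<in> \<Gamma>" "ys \<in> \<Gamma>" for xs ys
    using that le2 by (intro integrable_psi_mult) auto
  show "integrable P (\<lambda>\<omega>. (\<Sum>xs\<in>\<Gamma>. c xs * psi (edge_count xs) \<omega>)\<^sup>2)"
    unfolding eq using int by (intro Bochner_Integration.integrable_sum integrable_mult_right) auto
  have zero: "?E xs ys = 0" if "xs \<in> \<Gamma>" "ys \<in> \<Gamma>" "edge_count xs \<noteq> edge_count ys" for xs ys
  proof -
    obtain e where e: "edge_count xs e \<noteq> edge_count ys e" using \<open>edge_count xs \<noteq> edge_count ys\<close> by blast
    \<comment> \<open>Exponents outside \<open>edges n\<close> are zero for every walk in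
      \<open>\<Gamma>\<close>, so the two exponent vectors differ at an edge that \<open>psi\<close>
      sees.\<close>
    have "e \<in> edges n"
    proof (rule ccontr)
      assume "e \<notin> edges n"
      have "edge_count zs e = 0" if "zs \<in> \<Gamma>" for zs
      proof (rule ccontr)
        assume "edge_count zs e \<noteq> 0"
        then obtain i j where "e = edge i j" "i \<in> set zs" "j \<in> set zs" using edge_count_pos_imp[of zs e] by blast
        moreover have "set zs \<subseteq> {..<n}" using that sub by (auto simp: walks_def)
        ultimately have "e \<in> edges n" using edge_in_edges[of i n j] by blast
        with \<open>e \<notin> edges n\<close> show False by simp
      qed
      then show False using that e by simp
    qed
    then show ?thesis using e that le2 by (intro expectation_psi_orthogonal) auto
  qed
  let ?B = "(3 / real n) ^ k"
  have sq: "0 \<le> ?E xs xs" "?E xs xs \<le> ?B" if "xs \<in> \<Gamma>" for xs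
  proof -
    show "0 \<le> ?E xs xs" by (intro integral_nonneg_AE) simp
    have "(\<Sum>e\<in>edges n. edge_count xs e) = k"
      using sum_edge_count[of xs n] that sub by (auto simp: walks_def)
    then show "?E xs xs \<le> ?B" using expectation_psi_square[of "edge_count xs"] le2 that by auto
  qed
  let ?F = "\<lambda>xs. {ys\<in>\<Gamma>. edge_count ys = edge_count xs}"
  have card: "card (?F xs) \<le> Suc k ^ Suc k" if "xs \<in> \<Gamma>" for xs
  proof -
    have l: "length xs = Suc k" using that sub by (auto simp: walks_def)
    have "?F xs \<subseteq> {ys. set ys \<subseteq> set xs \<and> length ys = Suc k}"
      using vert[OF _ that] sub by (auto simp: walks_def)
    then have "card (?F xs) \<le> card {ys. set ys \<subseteq> set xs \<and> length ys = Suc k}"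
      by (intro card_mono finite_lists_length_eq) auto
    also have "\<dots> = card (set xs) ^ Suc k" by (rule card_lists_length_eq) simp
    also have "\<dots> \<le> Suc k ^ Suc k" using card_length[of xs] l by (intro power_mono) auto
    finally show ?thesis .
  qed
  \<comment> \<open>Only pairs with equal exponents survive. The arithmetic-geometric mean
    inequality charges such a pair to its two squared coefficients; by symmetry each square is then
    charged once per member of its fibre \<open>?F\<close>.\<close>
  have bnd: "c xs * c ys * ?E xs ys \<le> (if edge_count ys = edge_count xs then ((c xs)\<^sup>2 + (c ys)\<^sup>2) / 2 * ?B else 0)"
    if "xs \<in> \<Gamma>" "ys \<in> \<Gamma>" for xs ys
  proof (cases "edge_count ys = edge_count xs")
    case True
    have "c xs * c ys \<le> ((c xs)\<^sup>2 + (c ys)\<^sup>2) / 2"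
      using sum_squares_bound[of "c xs" "c ys"] by simp
    then have "c xs * c ys * ?E xs xs \<le> ((c xs)\<^sup>2 + (c ys)\<^sup>2) / 2 * ?B"
      using sq[OF that(1)] by (intro mult_mono) auto
    then show ?thesis using True by simp
  next
    case False
    then show ?thesis using zero[OF that] by auto
  qed
  have "expectation (\<lambda>\<omega>. (\<Sum>xs\<in>\<Gamma>. c xs * psi (edge_count xs) \<omega>)\<^sup>2) = (\<Sum>xs\<in>\<Gamma>. \<Sum>ys\<in>\<Gamma>. c xs * c ys * ?E xs ys)"
    unfolding eq using int by (subst Bochner_Integration.integral_sum) (auto intro!: sum.cong Bochner_Integration.integrable_sum)
  also have "\<dots> \<le> (\<Sum>xs\<in>\<Gamma>. \<Sum>ys\<in>\<Gamma>. if edge_count ys = edge_count xs then ((c xs)\<^sup>2 + (c ys)\<^sup>2) / 2 * ?B else 0)"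
    using bnd by (intro sum_mono) auto
  also have "\<dots> = (\<Sum>xs\<in>\<Gamma>. \<Sum>ys\<in>\<Gamma>. if edge_count ys = edge_count xs then (c xs)\<^sup>2 / 2 * ?B else 0)
      + (\<Sum>xs\<in>\<Gamma>. \<Sum>ys\<in>\<Gamma>. if edge_count ys = edge_count xs then (c ys)\<^sup>2 / 2 * ?B else 0)"
    unfolding sum.distrib[symmetric] by (intro sum.cong refl) (auto simp: algebra_simps add_divide_distrib)
  also have "(\<Sum>xs\<in>\<Gamma>. \<Sum>ys\<in>\<Gamma>. if edge_count ys = edge_count xs then (c ys)\<^sup>2 / 2 * ?B else 0)
      = (\<Sum>ys\<in>\<Gamma>. \<Sum>xs\<in>\<Gamma>. if edge_count xs = edge_count ys then (c ys)\<^sup>2 / 2 * ?B else 0)"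
    by (subst sum.swap) (auto intro!: sum.cong)
  also have "(\<Sum>xs\<in>\<Gamma>. \<Sum>ys\<in>\<Gamma>. if edge_count ys = edge_count xs then (c xs)\<^sup>2 / 2 * ?B else 0) + \<dots> =
      (\<Sum>xs\<in>\<Gamma>. real (card (?F xs)) * ((c xs)\<^sup>2 * ?B))"
    using fin by (simp add: sum.inter_filter[symmetric] sum.distrib[symmetric] field_simps)
  also have "\<dots> \<le> (\<Sum>xs\<in>\<Gamma>. real (Suc k ^ Suc k) * ((c xs)\<^sup>2 * ?B))"
    using card by (intro sum_mono mult_right_mono of_nat_mono) auto
  also have "\<dots> = real (Suc k ^ Suc k) * ?B * (\<Sum>xs\<in>\<Gamma>. (c xs)\<^sup>2)"
    unfolding sum_distrib_left by (intro sum.cong refl) (simp only: mult_ac)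
  finally show "expectation (\<lambda>\<omega>. (\<Sum>xs\<in>\<Gamma>. c xs * psi (edge_count xs) \<omega>)\<^sup>2)
      \<le> real (Suc k ^ Suc k) * ?B * (\<Sum>xs\<in>\<Gamma>. (c xs)\<^sup>2)" .
qed

end

section \<open>Self-avoiding path expansions\<close>

context goe
begin

text \<open>With the first vertex fixed, the coefficients are summed over the remaining vertices
  only. Zero steps are covered as well: there the exponents carry no information, but
  \<open>[i]\<close> is the only walk.\<close>

lemma second_moment_walk_sum_from:
  assumes S: "S \<subseteq> walks n k" and i: "i < n"
    and le2: "\<And>xs e. xs \<in> S \<Longrightarrow> edge_count (i # xs) e \<le> 2"
  shows "integrable P (\<lambda>\<omega>. (\<Sum>xs\<in>S. c xs * psi (edge_count (i # xs)) \<omega>)\<^sup>2)"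
    and "expectation (\<lambda>\<omega>. (\<Sum>xs\<in>S. c xs * psi (edge_count (i # xs)) \<omega>)\<^sup>2)
      \<le> real (Suc k ^ Suc k) * (3 / real n) ^ k * (\<Sum>xs\<in>S. (c xs)\<^sup>2)"
proof -
  have inj: "inj_on ((#) i) S" by auto
  have sub: "(#) i ` S \<subseteq> walks n (Suc k)"
    using S i by (force simp: walks_def)
  have vert: "set xs = set ys"
    if "xs \<in> (#) i ` S" "ys \<in> (#) i ` S" "edge_count xs = edge_count ys" for xs ys
  proof (cases k)
    case 0
    then show ?thesis using that S by (auto simp: walks_def)
  next
    case (Suc l)
    then have "length xs \<ge> 2" "length ys \<ge> 2" using that(1,2) sub by (auto simp: walks_def)
    then show ?thesis using that(3) by (simp add: set_eq_edge_ends)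
  qed
  have le2': "edge_count xs e \<le> 2" if "xs \<in> (#) i ` S" for xs e
    using that le2 by blast
  have eq: "(\<Sum>xs\<in>(#) i ` S. f (tl xs) xs) = (\<Sum>xs\<in>S. f xs (i # xs))" for f :: "nat list \<Rightarrow> nat list \<Rightarrow> real"
    unfolding sum.reindex[OF inj] by simp
  note * = second_moment_walk_sum[OF sub le2' vert, of "\<lambda>xs. c (tl xs)"]
  show "integrable P (\<lambda>\<omega>. (\<Sum>xs\<in>S. c xs * psi (edge_count (i # xs)) \<omega>)\<^sup>2)"
    using *(1) unfolding eq[of "\<lambda>x xs. c x * psi (edge_count xs) _"] .
  show "expectation (\<lambda>\<omega>. (\<Sum>xs\<in>S. c xs * psi (edge_count (i # xs)) \<omega>)\<^sup>2)
      \<le> real (Suc k ^ Suc k) * (3 / real n) ^ k * (\<Sum>xs\<in>S. (c xs)\<^sup>2)"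
    using *(2) unfolding eq[of "\<lambda>x xs. c x * psi (edge_count xs) _"] eq[of "\<lambda>x xs. (c x)\<^sup>2"] .
qed

text \<open>In degrees 0 and 1 the Hermite polynomial is the monomial itself.\<close>

lemma walk_prod_eq_psi:
  assumes "xs \<in> walks n k" and "\<And>e. edge_count xs e \<le> 1"
  shows "walk_prod (Y \<omega>) xs = psi (edge_count xs) \<omega>"
proof -
  have "walk_prod (Y \<omega>) xs = (\<Prod>e\<in>edges n. Y \<omega> (fst e) (snd e) ^ edge_count xs e)"
    using assms(1) by (intro walk_prod_eq_prod_edges sym) (auto simp: walks_def)
  also have "\<dots> = psi (edge_count xs) \<omega>"
    unfolding psi_def
  proof (rule prod.cong)
    fix e
    show "Y \<omega> (fst e) (snd e) ^ edge_count xs e = hpoly (evar e) (edge_count xs e) (entry e \<omega>)"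
      using assms(2)[of e] by (auto simp: hpoly_def entry_def)
  qed simp
  finally show ?thesis .
qed

text \<open>The square of the entry at \<open>i\<close>, \<open>j\<close> splits into its centred
  part and its variance. The variance is 1/n, not 2/n, because \<open>i\<close> and \<open>j\<close>
  differ; it is the seed of the annihilation term.\<close>

lemma walk_prod_backtrack:
  assumes d: "distinct (j # i # ys)" and w: "i # ys \<in> walks n k" and j: "j < n"
  shows "walk_prod (Y \<omega>) (i # j # i # ys) = psi (edge_count (i # j # i # ys)) \<omega> + 1 / real n * walk_prod (Y \<omega>) (i # ys)"
proof -
  have i: "i < n" using w by (auto simp: walks_def)
  let ?e = "edge i j"
  have e: "?e \<in> edges n" using i j by (rule edge_in_edges)
  have ent: "entry ?e \<omega> = Y \<omega> i j" "entry ?e \<omega> = Y \<omega> j i"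
    using sym[OF i j, of \<omega>] by (auto simp: entry_def edge_def min_def max_def)
  have ev: "evar ?e = 1 / real n" using d by (auto simp: evar_def edge_def min_def max_def)
  have "psi (edge_count (i # j # i # ys)) \<omega> = ((Y \<omega> i j)\<^sup>2 - 1 / real n) *
      (\<Prod>e\<in>edges n - {?e}. hpoly (evar e) (edge_count (i # ys) e) (entry e \<omega>))"
    unfolding psi_def
    by (subst prod.remove[OF finite_edges e])
      (auto simp: edge_count_backtrack[OF d] ent(1) ev simp del: edge_count.simps intro!: prod.cong)
  also have "(\<Prod>e\<in>edges n - {?e}. hpoly (evar e) (edge_count (i # ys) e) (entry e \<omega>)) = psi (edge_count (i # ys)) \<omega>"
    using prod.remove[OF finite_edges e, of "\<lambda>e. hpoly (evar e) (edge_count (i # ys) e) (entry e \<omega>)"]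
    by (simp add: psi_def edge_count_backtrack(2)[OF d])
  also have "\<dots> = walk_prod (Y \<omega>) (i # ys)"
    using d by (intro walk_prod_eq_psi[OF w, symmetric] edge_count_distinct_le_1) auto
  finally show ?thesis
    using ent by (simp add: algebra_simps power2_eq_square del: edge_count.simps)
qed

text \<open>Every walk contributes at most (3/n)^k, and only n^(k-1) inner vertices are free, which
  leaves 1/n. Without a matrix factor both ends coincide and the inner product is deterministic,
  hence \<open>Ds\<close> is nonempty.\<close>

lemma second_moment_vinner_path_vec:
  assumes D: "\<forall>D\<in>set Ds. contraction n D" and ne: "Ds \<noteq> []"
  shows "integrable P (\<lambda>\<omega>. (vinner n u (path_vec n (Y \<omega>) Ds v))\<^sup>2)"
    and "expectation (\<lambda>\<omega>. (vinner n u (path_vec n (Y \<omega>) Ds v))\<^sup>2)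
      \<le> real (Suc (length Ds) ^ Suc (length Ds)) * 3 ^ length Ds * (\<Sum>i<n. (u i)\<^sup>2) * (\<Sum>i<n. (v i)\<^sup>2) / real n"
proof -
  obtain l where l: "length Ds = Suc l" using ne by (cases Ds) auto
  let ?k = "length Ds"
  let ?G = "{xs \<in> walks n (Suc ?k). distinct xs}"
  let ?c = "\<lambda>xs. u (hd xs) * weight Ds v xs"
  have le1: "edge_count xs e \<le> 1" if "xs \<in> ?G" for xs e
    using that edge_count_distinct_le_1 by auto
  have eq: "vinner n u (path_vec n (Y \<omega>) Ds v) = (\<Sum>xs\<in>?G. ?c xs * psi (edge_count xs) \<omega>)" for \<omega>
  proof -
    have "vinner n u (path_vec n (Y \<omega>) Ds v) =
      (\<Sum>i<n. \<Sum>xs\<in>walks n ?k. if distinct (i # xs) then ?c (i # xs) * walk_prod (Y \<omega>) (i # xs) else 0)"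
      unfolding vinner_def path_vec_if sum_distrib_left
      by (intro sum.cong refl) auto
    also have "\<dots> = (\<Sum>xs\<in>?G. ?c xs * walk_prod (Y \<omega>) xs)"
      by (simp only: sum_walks_Suc sum.inter_filter[OF finite_walks])
    also have "\<dots> = (\<Sum>xs\<in>?G. ?c xs * psi (edge_count xs) \<omega>)"
      using le1 by (intro sum.cong refl arg_cong2[where f="(*)"] walk_prod_eq_psi) auto
    finally show ?thesis .
  qed
  have vert: "set xs = set ys" if "xs \<in> ?G" "ys \<in> ?G" "edge_count xs = edge_count ys" for xs ys
  proof -
    have "length xs \<ge> 2" "length ys \<ge> 2" using that(1,2) l by (auto simp: walks_def)
    then show ?thesis using that(3) by (simp add: set_eq_edge_ends)
  qed
  have le2: "edge_count xs e \<le> 2" if "xs \<in> ?G" for xs e using le1[OF that, of e] by simp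
  have sub: "?G \<subseteq> walks n (Suc ?k)" by blast
  note * = second_moment_walk_sum[where c = ?c, OF sub le2 vert]
  show "integrable P (\<lambda>\<omega>. (vinner n u (path_vec n (Y \<omega>) Ds v))\<^sup>2)"
    unfolding eq by (rule *(1))
  have "(\<Sum>xs\<in>?G. (?c xs)\<^sup>2) \<le> (\<Sum>xs\<in>?G. (u (hd xs))\<^sup>2 * (v (last xs))\<^sup>2)"
  proof (rule sum_mono)
    fix xs assume "xs \<in> ?G"
    then have "\<bar>weight Ds v xs\<bar> \<le> \<bar>v (last xs)\<bar>" by (intro abs_weight_le[OF D]) (auto simp: walks_def)
    then show "(?c xs)\<^sup>2 \<le> (u (hd xs))\<^sup>2 * (v (last xs))\<^sup>2"
      unfolding power_mult_distrib by (intro mult_left_mono) (auto simp: abs_le_square_iff)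
  qed
  also have "\<dots> \<le> (\<Sum>xs\<in>walks n (Suc ?k). (u (hd xs))\<^sup>2 * (v (last xs))\<^sup>2)"
    by (intro sum_mono2) auto
  also have "\<dots> = real n ^ l * (\<Sum>i<n. (u i)\<^sup>2) * (\<Sum>i<n. (v i)\<^sup>2)"
    unfolding l by (rule sum_walks_hd_last)
  finally have c: "(\<Sum>xs\<in>?G. (?c xs)\<^sup>2) \<le> real n ^ l * (\<Sum>i<n. (u i)\<^sup>2) * (\<Sum>i<n. (v i)\<^sup>2)" .
  have "expectation (\<lambda>\<omega>. (vinner n u (path_vec n (Y \<omega>) Ds v))\<^sup>2)
      \<le> real (Suc ?k ^ Suc ?k) * (3 / real n) ^ ?k * (\<Sum>xs\<in>?G. (?c xs)\<^sup>2)"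
    unfolding eq by (rule *(2))
  also have "\<dots> \<le> real (Suc ?k ^ Suc ?k) * (3 / real n) ^ ?k * (real n ^ l * (\<Sum>i<n. (u i)\<^sup>2) * (\<Sum>i<n. (v i)\<^sup>2))"
    by (intro mult_left_mono c) auto
  also have "\<dots> = real (Suc ?k ^ Suc ?k) * 3 ^ ?k * (\<Sum>i<n. (u i)\<^sup>2) * (\<Sum>i<n. (v i)\<^sup>2) / real n"
    using n_pos unfolding l by (simp add: power_divide field_simps)
  finally show "expectation (\<lambda>\<omega>. (vinner n u (path_vec n (Y \<omega>) Ds v))\<^sup>2)
      \<le> real (Suc ?k ^ Suc ?k) * 3 ^ ?k * (\<Sum>i<n. (u i)\<^sup>2) * (\<Sum>i<n. (v i)\<^sup>2) / real n" .
qed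


text \<open>The walks from \<open>i\<close> that come back to \<open>i\<close>. An immediate return
  \<open>i\<close>, j, \<open>i\<close> enters only with its centred product; its mean belongs to
  the annihilation term.\<close>

definition loop_part :: "(nat \<Rightarrow> real) \<Rightarrow> (nat \<Rightarrow> real) list \<Rightarrow> (nat \<Rightarrow> real) \<Rightarrow> nat \<Rightarrow> 'w \<Rightarrow> real" where
  "loop_part D w v i \<omega> = (\<Sum>xs | xs \<in> walks n (Suc (length w)) \<and> distinct xs \<and> i \<in> set xs.
     weight (D # w) v (i # xs) * psi (edge_count (i # xs)) \<omega>)"

text \<open>The mean of the immediate returns \<open>i\<close>, j, \<open>i\<close> runs over j off
  the remaining path, whereas \<open>mean n D\<close> runs over all j. The difference, from j on the
  path, is collected here.\<close>

definition missed_part :: "(nat \<Rightarrow> real) \<Rightarrow> (nat \<Rightarrow> real) list \<Rightarrow> (nat \<Rightarrow> real) \<Rightarrow> nat \<Rightarrow> 'w \<Rightarrow> real" where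
  "missed_part D w v i \<omega> = (case w of [] \<Rightarrow> 0 | D1 # w1 \<Rightarrow>
     (\<Sum>ys | ys \<in> walks n (length w1) \<and> distinct (i # ys).
       (\<Sum>j\<in>set (i # ys). D j) / real n * (D1 i * weight w1 v (i # ys)) * psi (edge_count (i # ys)) \<omega>))"

text \<open>Multiplication prepends \<open>i\<close>: the tail stays self-avoiding, but
  \<open>i\<close> may occur in it.\<close>

lemma matvec_path_vec:
  "matvec n A (\<lambda>j. D j * path_vec n A w v j) i =
    (\<Sum>xs\<in>walks n (Suc (length w)). if distinct xs then weight (D # w) v (i # xs) * walk_prod A (i # xs) else 0)"
  unfolding matvec_def path_vec_if sum_walks_Suc sum_distrib_left
  by (intro sum.cong refl) (auto simp: walk_prod_Cons)

text \<open>If \<open>i\<close> is not revisited, the walk belongs to \<open>path_vec\<close> of the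
  longer word. A walk that revisits \<open>i\<close> gives a term of \<open>loop_part\<close>, and,
  for an immediate return, also 1/n times a self-avoiding walk shorter by two steps. Summing the
  latter gives the annihilation term minus \<open>missed_part\<close>.\<close>

lemma step_err_eq:
  assumes i: "i < n"
  shows "step_err n (Y \<omega>) D w v i = loop_part D w v i \<omega> - missed_part D w v i \<omega>"
proof -
  let ?W = "walks n (Suc (length w))"
  let ?b = "\<lambda>xs. \<exists>j ys. xs = j # i # ys"
  let ?t = "\<lambda>xs. weight (D # w) v (i # xs)"
  have split: "walk_prod (Y \<omega>) (i # xs) = psi (edge_count (i # xs)) \<omega> + (if ?b xs then 1 / real n * walk_prod (Y \<omega>) (tl xs) else 0)"
    if "xs \<in> ?W" "distinct xs" "i \<in> set xs" for xs
  proof (cases "?b xs")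
    case True
    then obtain j ys where "xs = j # i # ys" by blast
    then show ?thesis using walk_prod_backtrack[of j i ys "length w" \<omega>] that True by (auto simp: walks_def)
  next
    case False
    then have "edge_count (i # xs) e \<le> 1" for e using edge_count_Cons_distinct that by blast
    then show ?thesis using False that i walk_prod_eq_psi[of "i # xs" "Suc (Suc (length w))" \<omega>]
      by (auto simp: walks_def)
  qed
  have "matvec n (Y \<omega>) (\<lambda>j. D j * path_vec n (Y \<omega>) w v j) i =
     (\<Sum>xs\<in>?W. (if distinct (i # xs) then ?t xs * walk_prod (Y \<omega>) (i # xs) else 0)
       + (if distinct xs \<and> i \<in> set xs then ?t xs * psi (edge_count (i # xs)) \<omega> else 0)
       + (if distinct xs \<and> ?b xs then ?t xs * (1 / real n * walk_prod (Y \<omega>) (tl xs)) else 0))"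
    unfolding matvec_path_vec
  proof (intro sum.cong refl)
    fix xs assume xs: "xs \<in> ?W"
    have "?b xs \<Longrightarrow> i \<in> set xs" by auto
    then show "(if distinct xs then ?t xs * walk_prod (Y \<omega>) (i # xs) else 0) =
      (if distinct (i # xs) then ?t xs * walk_prod (Y \<omega>) (i # xs) else 0)
       + (if distinct xs \<and> i \<in> set xs then ?t xs * psi (edge_count (i # xs)) \<omega> else 0)
       + (if distinct xs \<and> ?b xs then ?t xs * (1 / real n * walk_prod (Y \<omega>) (tl xs)) else 0)"
      using split[OF xs] by (cases "distinct xs"; cases "i \<in> set xs"; cases "?b xs") (simp_all add: distrib_left)
  qed
  also have "\<dots> = path_vec n (Y \<omega>) (D # w) v i + loop_part D w v i \<omega>
      + (\<Sum>xs\<in>?W. if distinct xs \<and> ?b xs then ?t xs * (1 / real n * walk_prod (Y \<omega>) (tl xs)) else 0)"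
    unfolding sum.distrib path_vec_if loop_part_def
    by (simp add: sum.inter_filter[symmetric])
  also have "(\<Sum>xs\<in>?W. if distinct xs \<and> ?b xs then ?t xs * (1 / real n * walk_prod (Y \<omega>) (tl xs)) else 0)
     = (case w of [] \<Rightarrow> 0 | D1 # w1 \<Rightarrow> (\<Sum>j<n. D j) / real n * (D1 i * path_vec n (Y \<omega>) w1 v i)) - missed_part D w v i \<omega>"
  proof (cases w)
    case Nil
    then show ?thesis by (simp add: missed_part_def sum_walks_Suc)
  next
    case (Cons D1 w1)
    let ?V = "walks n (length w1)"
    let ?s = "\<lambda>ys. D1 i * weight w1 v (i # ys) * walk_prod (Y \<omega>) (i # ys) / real n"
    have V: "walk_prod (Y \<omega>) (i # ys) = psi (edge_count (i # ys)) \<omega>" if "ys \<in> ?V" "distinct (i # ys)" for ys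
      using that i by (intro walk_prod_eq_psi[of _ "Suc (length w1)"] edge_count_distinct_le_1) (auto simp: walks_def)
    have one: "(\<Sum>l<n. \<Sum>ys\<in>?V. if l = i then f ys else 0) = (\<Sum>ys\<in>?V. f ys)" for f :: "nat list \<Rightarrow> real"
      using i by (subst sum.swap) simp
    have "(\<Sum>xs\<in>?W. if distinct xs \<and> ?b xs then ?t xs * (1 / real n * walk_prod (Y \<omega>) (tl xs)) else 0)
      = (\<Sum>j<n. \<Sum>l<n. \<Sum>ys\<in>?V. if l = i then (if distinct (j # i # ys) then D j * ?s ys else 0) else 0)"
      unfolding Cons length_Cons sum_walks_Suc by (intro sum.cong refl) auto
    also have "\<dots> = (\<Sum>j<n. \<Sum>ys\<in>?V. if distinct (j # i # ys) then D j * ?s ys else 0)"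
      by (simp only: one)
    also have "\<dots> = (\<Sum>ys\<in>?V. \<Sum>j<n. if distinct (j # i # ys) then D j * ?s ys else 0)"
      by (rule sum.swap)
    \<comment> \<open>For fixed \<open>ys\<close> the admissible turning points \<open>j\<close> are
      the vertices off the path, hence the full sum of \<open>D\<close> minus its sum over the
      path.\<close>
    also have "\<dots> = (\<Sum>ys\<in>?V. if distinct (i # ys) then ((\<Sum>j<n. D j) - (\<Sum>j\<in>set (i # ys). D j)) * ?s ys else 0)"
    proof (intro sum.cong refl)
      fix ys assume ys: "ys \<in> ?V"
      have sub: "set (i # ys) \<subseteq> {..<n}" using ys i by (auto simp: walks_def)
      have "(\<Sum>j<n. if distinct (j # i # ys) then D j * ?s ys else 0) = (\<Sum>j\<in>{..<n} - set (i # ys). D j * ?s ys)"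
        if "distinct (i # ys)"
        using that by (intro sum.mono_neutral_cong_right) auto
      also have "\<dots> = ((\<Sum>j<n. D j) - (\<Sum>j\<in>set (i # ys). D j)) * ?s ys"
        using sub by (simp only: sum_distrib_right[symmetric] sum_diff[OF finite_lessThan sub])
      finally show "(\<Sum>j<n. if distinct (j # i # ys) then D j * ?s ys else 0)
         = (if distinct (i # ys) then ((\<Sum>j<n. D j) - (\<Sum>j\<in>set (i # ys). D j)) * ?s ys else 0)"
        by auto
    qed
    also have "\<dots> = (\<Sum>ys\<in>?V. (if distinct (i # ys) then (\<Sum>j<n. D j) * ?s ys else 0) -
        (if distinct (i # ys) then (\<Sum>j\<in>set (i # ys). D j) / real n * (D1 i * weight w1 v (i # ys)) * psi (edge_count (i # ys)) \<omega> else 0))"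
      using V by (intro sum.cong refl) (auto simp: left_diff_distrib diff_divide_distrib mult.assoc)
    also have "\<dots> = (\<Sum>ys\<in>?V. if distinct (i # ys) then (\<Sum>j<n. D j) * ?s ys else 0) - missed_part D w v i \<omega>"
      unfolding sum_subtractf missed_part_def Cons list.case sum.inter_filter[OF finite_walks] by simp
    also have "(\<Sum>ys\<in>?V. if distinct (i # ys) then (\<Sum>j<n. D j) * ?s ys else 0)
        = (\<Sum>j<n. D j) / real n * (D1 i * path_vec n (Y \<omega>) w1 v i)"
      unfolding path_vec_if sum_distrib_left by (intro sum.cong refl) auto
    finally show ?thesis using Cons by simp
  qed
  finally show ?thesis unfolding step_err_def mean_def by simp
qed

text \<open>Summed over \<open>i\<close>, each \<open>xs\<close> is counted for at most its own k +
  1 vertices instead of all n. Against (3/n)^(k+1) there are n^k free vertices left, which gives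
  1/n.\<close>

lemma loop_part_moment:
  assumes D: "contraction n D" "\<forall>D\<in>set w. contraction n D"
  shows "i < n \<Longrightarrow> integrable P (\<lambda>\<omega>. (loop_part D w v i \<omega>)\<^sup>2)"
    and "(\<Sum>i<n. expectation (\<lambda>\<omega>. (loop_part D w v i \<omega>)\<^sup>2)) \<le>
      real ((length w + 2) ^ (length w + 2)) * 3 ^ (length w + 1) * real (length w + 1) * (\<Sum>i<n. (v i)\<^sup>2) / real n"
proof -
  let ?k = "length w"
  let ?S = "\<lambda>i. {xs. xs \<in> walks n (Suc ?k) \<and> distinct xs \<and> i \<in> set xs}"
  let ?C = "real (Suc (Suc ?k) ^ Suc (Suc ?k)) * (3 / real n) ^ Suc ?k"
  have le2: "edge_count (i # xs) e \<le> 2" if "xs \<in> ?S i" for i xs e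
  proof (cases "\<exists>j ys. xs = j # i # ys")
    case True
    then obtain j ys where xs: "xs = j # i # ys" by blast
    have "edge_count (i # ys) e \<le> 1" using that xs by (intro edge_count_distinct_le_1) auto
    then show ?thesis using that edge_count_backtrack(1)[of j i ys e] unfolding xs by auto
  next
    case False
    then show ?thesis using edge_count_Cons_distinct[of xs i e] that by auto
  qed
  have sub: "?S i \<subseteq> walks n (Suc ?k)" for i by auto
  note * = second_moment_walk_sum_from[OF sub _ le2, where c = "\<lambda>xs. weight (D # w) v (i # xs)" for i]
  show "integrable P (\<lambda>\<omega>. (loop_part D w v i \<omega>)\<^sup>2)" if "i < n"
    unfolding loop_part_def using *(1)[OF that] by simp
  have w: "(weight (D # w) v (i # xs))\<^sup>2 \<le> (v (last xs))\<^sup>2" if "i < n" "xs \<in> walks n (Suc ?k)" for i xs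
  proof -
    have "\<bar>weight (D # w) v (i # xs)\<bar> \<le> \<bar>v (last (i # xs))\<bar>"
      using that D by (intro abs_weight_le[of _ n]) (auto simp: walks_def)
    then show ?thesis using that by (auto simp: abs_le_square_iff walks_def split: if_splits)
  qed
  have "(\<Sum>i<n. expectation (\<lambda>\<omega>. (loop_part D w v i \<omega>)\<^sup>2)) \<le> (\<Sum>i<n. ?C * (\<Sum>xs\<in>?S i. (v (last xs))\<^sup>2))"
  proof (rule sum_mono)
    fix i assume "i \<in> {..<n}"
    then have i: "i < n" by simp
    have "expectation (\<lambda>\<omega>. (loop_part D w v i \<omega>)\<^sup>2) \<le> ?C * (\<Sum>xs\<in>?S i. (weight (D # w) v (i # xs))\<^sup>2)"
      unfolding loop_part_def by (rule *(2)[OF i])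
    also have "\<dots> \<le> ?C * (\<Sum>xs\<in>?S i. (v (last xs))\<^sup>2)"
      using w[OF i] by (intro mult_left_mono sum_mono) auto
    finally show "expectation (\<lambda>\<omega>. (loop_part D w v i \<omega>)\<^sup>2) \<le> ?C * (\<Sum>xs\<in>?S i. (v (last xs))\<^sup>2)" .
  qed
  also have "\<dots> = ?C * (\<Sum>i<n. \<Sum>xs\<in>walks n (Suc ?k). if distinct xs \<and> i \<in> set xs then (v (last xs))\<^sup>2 else 0)"
    unfolding sum_distrib_left[symmetric] sum.inter_filter[OF finite_walks] ..
  also have "\<dots> = ?C * (\<Sum>xs\<in>walks n (Suc ?k). \<Sum>i<n. if distinct xs \<and> i \<in> set xs then (v (last xs))\<^sup>2 else 0)"
    by (subst sum.swap) simp
  also have "\<dots> \<le> ?C * (\<Sum>xs\<in>walks n (Suc ?k). real (Suc ?k) * (v (last xs))\<^sup>2)"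
  proof (intro mult_left_mono sum_mono)
    fix xs assume xs: "xs \<in> walks n (Suc ?k)"
    have "(\<Sum>i<n. if distinct xs \<and> i \<in> set xs then (v (last xs))\<^sup>2 else 0) \<le> (\<Sum>i<n. if i \<in> set xs then (v (last xs))\<^sup>2 else 0)"
      by (intro sum_mono) auto
    also have "\<dots> = (\<Sum>i\<in>set xs. (v (last xs))\<^sup>2)"
      using xs by (intro sum.mono_neutral_cong_right) (auto simp: walks_def)
    also have "\<dots> \<le> real (Suc ?k) * (v (last xs))\<^sup>2"
      using card_length[of xs] xs by (auto simp: walks_def intro!: mult_right_mono)
    finally show "(\<Sum>i<n. if distinct xs \<and> i \<in> set xs then (v (last xs))\<^sup>2 else 0) \<le> real (Suc ?k) * (v (last xs))\<^sup>2" .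
  qed simp
  also have "\<dots> = ?C * (real (Suc ?k) * (real n ^ ?k * (\<Sum>i<n. (v i)\<^sup>2)))"
    unfolding sum_distrib_left[symmetric] sum_walks_last[of "\<lambda>i. (v i)\<^sup>2"] ..
  also have "\<dots> = real ((length w + 2) ^ (length w + 2)) * 3 ^ (length w + 1) * real (length w + 1) * (\<Sum>i<n. (v i)\<^sup>2) / real n"
    using n_pos by (simp add: power_divide field_simps)
  finally show "(\<Sum>i<n. expectation (\<lambda>\<omega>. (loop_part D w v i \<omega>)\<^sup>2)) \<le>
      real ((length w + 2) ^ (length w + 2)) * 3 ^ (length w + 1) * real (length w + 1) * (\<Sum>i<n. (v i)\<^sup>2) / real n" .
qed


text \<open>The coefficient contains a sum of boundedly many entries of \<open>D\<close> divided by
  n, so its square supplies n^(-2), while the count of walks and (3/n) per step balance.\<close>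

lemma missed_part_moment:
  assumes D: "contraction n D" "\<forall>D\<in>set w. contraction n D"
  shows "i < n \<Longrightarrow> integrable P (\<lambda>\<omega>. (missed_part D w v i \<omega>)\<^sup>2)"
    and "(\<Sum>i<n. expectation (\<lambda>\<omega>. (missed_part D w v i \<omega>)\<^sup>2)) \<le>
      real (length w ^ length w) * 3 ^ length w * real ((length w)\<^sup>2) * (\<Sum>i<n. (v i)\<^sup>2) / real n"
proof -
  have "(i < n \<longrightarrow> integrable P (\<lambda>\<omega>. (missed_part D w v i \<omega>)\<^sup>2)) \<and>
    (\<Sum>i<n. expectation (\<lambda>\<omega>. (missed_part D w v i \<omega>)\<^sup>2)) \<le>
      real (length w ^ length w) * 3 ^ length w * real ((length w)\<^sup>2) * (\<Sum>i<n. (v i)\<^sup>2) / real n"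
  proof (cases w)
    case Nil
    then show ?thesis by (simp add: missed_part_def)
  next
    case (Cons D1 w1)
    let ?k = "length w1"
    let ?S = "\<lambda>i. {ys. ys \<in> walks n ?k \<and> distinct (i # ys)}"
    let ?c = "\<lambda>i ys. (\<Sum>j\<in>set (i # ys). D j) / real n * (D1 i * weight w1 v (i # ys))"
    let ?C = "real (Suc ?k ^ Suc ?k) * (3 / real n) ^ ?k"
    have mp: "missed_part D w v i \<omega> = (\<Sum>ys\<in>?S i. ?c i ys * psi (edge_count (i # ys)) \<omega>)" for i \<omega>
      unfolding missed_part_def Cons by simp
    have le2: "edge_count (i # xs) e \<le> 2" if "xs \<in> ?S i" for i xs e
      using that edge_count_distinct_le_1[of "i # xs" e] by auto
    have sub: "?S i \<subseteq> walks n ?k" for i by auto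
    note * = second_moment_walk_sum_from[OF sub _ le2]
    have w: "(?c i ys)\<^sup>2 \<le> (real (Suc ?k) / real n)\<^sup>2 * (v (last (i # ys)))\<^sup>2" if i: "i < n" and ys: "ys \<in> walks n ?k" for i ys
    proof -
      have wt: "\<bar>weight w1 v (i # ys)\<bar> \<le> \<bar>v (last (i # ys))\<bar>"
        using ys i D Cons by (intro abs_weight_le[of _ n]) (auto simp: walks_def)
      have sn: "set (i # ys) \<subseteq> {..<n}" using i ys by (auto simp: walks_def)
      have "\<bar>\<Sum>j\<in>set (i # ys). D j\<bar> \<le> (\<Sum>j\<in>set (i # ys). \<bar>D j\<bar>)" by (rule sum_abs)
      also have "\<dots> \<le> (\<Sum>j\<in>set (i # ys). 1)" using D(1) sn by (intro sum_mono) (auto simp: contraction_def)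
      also have "\<dots> \<le> real (Suc ?k)" using card_length[of "i # ys"] ys by (simp add: walks_def)
      finally have sD: "\<bar>\<Sum>j\<in>set (i # ys). D j\<bar> \<le> real (Suc ?k)" .
      have D1: "\<bar>D1 i\<bar> \<le> 1" using D(2) Cons i by (auto simp: contraction_def)
      have "\<bar>?c i ys\<bar> = \<bar>\<Sum>j\<in>set (i # ys). D j\<bar> / real n * (\<bar>D1 i\<bar> * \<bar>weight w1 v (i # ys)\<bar>)"
        by (simp add: abs_mult)
      also have "\<dots> \<le> real (Suc ?k) / real n * (1 * \<bar>v (last (i # ys))\<bar>)"
        by (intro mult_mono divide_right_mono sD D1 wt) auto
      finally have "\<bar>?c i ys\<bar> \<le> \<bar>real (Suc ?k) / real n * v (last (i # ys))\<bar>" by (simp add: abs_mult)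
      then show ?thesis unfolding power_mult_distrib[symmetric] abs_le_square_iff .
    qed
    have "(\<Sum>i<n. expectation (\<lambda>\<omega>. (missed_part D w v i \<omega>)\<^sup>2)) \<le>
      (\<Sum>i<n. ?C * (\<Sum>ys\<in>walks n ?k. (real (Suc ?k) / real n)\<^sup>2 * (v (last (i # ys)))\<^sup>2))"
    proof (rule sum_mono)
      fix i assume "i \<in> {..<n}"
      then have i: "i < n" by simp
      have "expectation (\<lambda>\<omega>. (missed_part D w v i \<omega>)\<^sup>2) \<le> ?C * (\<Sum>ys\<in>?S i. (?c i ys)\<^sup>2)"
        unfolding mp by (rule *(2)[OF i])
      also have "\<dots> \<le> ?C * (\<Sum>ys\<in>?S i. (real (Suc ?k) / real n)\<^sup>2 * (v (last (i # ys)))\<^sup>2)"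
        by (intro mult_left_mono sum_mono w[OF i]) simp_all
      also have "\<dots> \<le> ?C * (\<Sum>ys\<in>walks n ?k. (real (Suc ?k) / real n)\<^sup>2 * (v (last (i # ys)))\<^sup>2)"
        by (intro mult_left_mono sum_mono2) auto
      finally show "expectation (\<lambda>\<omega>. (missed_part D w v i \<omega>)\<^sup>2) \<le>
        ?C * (\<Sum>ys\<in>walks n ?k. (real (Suc ?k) / real n)\<^sup>2 * (v (last (i # ys)))\<^sup>2)" .
    qed
    also have "\<dots> = ?C * ((real (Suc ?k) / real n)\<^sup>2 * (real n ^ ?k * (\<Sum>i<n. (v i)\<^sup>2)))"
      unfolding sum_distrib_left[symmetric] sum_walks_Suc[of "\<lambda>xs. (v (last xs))\<^sup>2", symmetric] sum_walks_last[of "\<lambda>i. (v i)\<^sup>2"] ..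
    also have "\<dots> = real (Suc ?k ^ Suc ?k) * real ((Suc ?k)\<^sup>2) * (\<Sum>i<n. (v i)\<^sup>2) / real n * (3 ^ ?k / real n)"
      using n_pos by (simp add: power_divide power2_eq_square field_simps)
    \<comment> \<open>One of the two factors 1/n is given up, and a factor 3 added, so that the
      bound takes the same shape as that of \<open>loop_part\<close> in terms of
      \<open>length w\<close>.\<close>
    also have "\<dots> \<le> real (Suc ?k ^ Suc ?k) * real ((Suc ?k)\<^sup>2) * (\<Sum>i<n. (v i)\<^sup>2) / real n * 3 ^ Suc ?k"
    proof (intro mult_left_mono)
      have "3 ^ ?k / real n \<le> 3 ^ ?k / 1" using n_pos by (intro divide_left_mono) auto
      also have "\<dots> \<le> 3 ^ Suc ?k" by simp
      finally show "3 ^ ?k / real n \<le> 3 ^ Suc ?k" .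
    qed (auto intro!: divide_nonneg_nonneg mult_nonneg_nonneg sum_nonneg)
    also have "\<dots> = real (length w ^ length w) * 3 ^ length w * real ((length w)\<^sup>2) * (\<Sum>i<n. (v i)\<^sup>2) / real n"
      unfolding Cons length_Cons by (simp only: mult_ac times_divide_eq_right times_divide_eq_left)
    finally have b: "(\<Sum>i<n. expectation (\<lambda>\<omega>. (missed_part D w v i \<omega>)\<^sup>2)) \<le>
      real (length w ^ length w) * 3 ^ length w * real ((length w)\<^sup>2) * (\<Sum>i<n. (v i)\<^sup>2) / real n" .
    have "integrable P (\<lambda>\<omega>. (missed_part D w v i \<omega>)\<^sup>2)" if "i < n"
      unfolding mp by (rule *(1)[OF that])
    with b show ?thesis by (intro conjI impI)
  qed
  then show "i < n \<Longrightarrow> integrable P (\<lambda>\<omega>. (missed_part D w v i \<omega>)\<^sup>2)"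
    and "(\<Sum>i<n. expectation (\<lambda>\<omega>. (missed_part D w v i \<omega>)\<^sup>2)) \<le>
      real (length w ^ length w) * 3 ^ length w * real ((length w)\<^sup>2) * (\<Sum>i<n. (v i)\<^sup>2) / real n" by auto
qed

text \<open>For \<open>v\<close> of squared norm of order n the error has squared norm of order one
  in mean.\<close>

lemma step_err_moment:
  assumes D: "contraction n D" "\<forall>D\<in>set w. contraction n D"
  shows "integrable P (\<lambda>\<omega>. \<Sum>i<n. (step_err n (Y \<omega>) D w v i)\<^sup>2)"
    and "expectation (\<lambda>\<omega>. \<Sum>i<n. (step_err n (Y \<omega>) D w v i)\<^sup>2) \<le> step_const (length w) * (\<Sum>i<n. (v i)\<^sup>2) / real n"
proof -
  let ?a = "\<lambda>i \<omega>. (loop_part D w v i \<omega>)\<^sup>2" and ?b = "\<lambda>i \<omega>. (missed_part D w v i \<omega>)\<^sup>2"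
  note int = loop_part_moment(1)[OF D] missed_part_moment(1)[OF D]
  have sq: "(x - y)\<^sup>2 \<le> 2 * x\<^sup>2 + 2 * y\<^sup>2" for x y :: real
    using zero_le_power2[of "x + y"] by (simp add: power2_eq_square algebra_simps)
  have le: "(\<Sum>i<n. (step_err n (Y \<omega>) D w v i)\<^sup>2) \<le> 2 * (\<Sum>i<n. ?a i \<omega>) + 2 * (\<Sum>i<n. ?b i \<omega>)" for \<omega>
    unfolding sum_distrib_left sum.distrib[symmetric] using sq by (intro sum_mono) (auto simp: step_err_eq)
  have int2: "integrable P (\<lambda>\<omega>. 2 * (\<Sum>i<n. ?a i \<omega>) + 2 * (\<Sum>i<n. ?b i \<omega>))"
    using int by (intro Bochner_Integration.integrable_add integrable_mult_right Bochner_Integration.integrable_sum) auto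
  have meas: "(\<lambda>\<omega>. \<Sum>i<n. (step_err n (Y \<omega>) D w v i)\<^sup>2) \<in> borel_measurable P"
  proof -
    have "loop_part D w v i \<in> borel_measurable P" "missed_part D w v i \<in> borel_measurable P" for i
      unfolding loop_part_def[abs_def] missed_part_def[abs_def] by (cases w; simp)+
    then have "(\<lambda>\<omega>. (loop_part D w v i \<omega> - missed_part D w v i \<omega>)\<^sup>2) \<in> borel_measurable P" for i by simp
    then have "(\<lambda>\<omega>. \<Sum>i<n. (loop_part D w v i \<omega> - missed_part D w v i \<omega>)\<^sup>2) \<in> borel_measurable P" by simp
    then show ?thesis by (simp add: step_err_eq)
  qed
  show int3: "integrable P (\<lambda>\<omega>. \<Sum>i<n. (step_err n (Y \<omega>) D w v i)\<^sup>2)"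
    by (rule Bochner_Integration.integrable_bound[OF int2 meas]) (use le in \<open>auto intro!: AE_I2 order_trans[OF _ abs_ge_self] simp: sum_nonneg\<close>)
  have "expectation (\<lambda>\<omega>. \<Sum>i<n. (step_err n (Y \<omega>) D w v i)\<^sup>2) \<le> expectation (\<lambda>\<omega>. 2 * (\<Sum>i<n. ?a i \<omega>) + 2 * (\<Sum>i<n. ?b i \<omega>))"
    by (rule integral_mono[OF int3 int2]) (rule le)
  also have "\<dots> = 2 * (\<Sum>i<n. expectation (?a i)) + 2 * (\<Sum>i<n. expectation (?b i))"
  proof -
    have "integrable P (\<lambda>\<omega>. \<Sum>i<n. ?a i \<omega>)" "integrable P (\<lambda>\<omega>. \<Sum>i<n. ?b i \<omega>)"
      using int by (auto intro!: Bochner_Integration.integrable_sum)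
    moreover have "expectation (\<lambda>\<omega>. \<Sum>i<n. ?a i \<omega>) = (\<Sum>i<n. expectation (?a i))"
      "expectation (\<lambda>\<omega>. \<Sum>i<n. ?b i \<omega>) = (\<Sum>i<n. expectation (?b i))"
      using int by (auto intro!: Bochner_Integration.integral_sum)
    ultimately show ?thesis by simp
  qed
  also have "\<dots> \<le> 2 * (real ((length w + 2) ^ (length w + 2)) * 3 ^ (length w + 1) * real (length w + 1) * (\<Sum>i<n. (v i)\<^sup>2) / real n)
     + 2 * (real (length w ^ length w) * 3 ^ length w * real ((length w)\<^sup>2) * (\<Sum>i<n. (v i)\<^sup>2) / real n)"
    by (intro add_mono mult_left_mono loop_part_moment(2) missed_part_moment(2) D) auto
  also have "\<dots> = step_const (length w) * (\<Sum>i<n. (v i)\<^sup>2) / real n"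
    unfolding step_const_def by (simp only: distrib_right add_divide_distrib times_divide_eq_right times_divide_eq_left mult.assoc)
  finally show "expectation (\<lambda>\<omega>. \<Sum>i<n. (step_err n (Y \<omega>) D w v i)\<^sup>2) \<le> step_const (length w) * (\<Sum>i<n. (v i)\<^sup>2) / real n" .
qed

end

section \<open>Trace moments\<close>

definition sqnorm :: "nat \<Rightarrow> (nat \<Rightarrow> real) \<Rightarrow> real" where
  "sqnorm n x = (\<Sum>i<n. (x i)\<^sup>2)"

lemma sqnorm_nonneg [simp]: "0 \<le> sqnorm n x"
  by (simp add: sqnorm_def sum_nonneg)

lemma sqnorm_eq_vinner: "sqnorm n x = vinner n x x"
  by (simp add: sqnorm_def vinner_def power2_eq_square)

lemma vinner_Cauchy_Schwarz: "(vinner n x y)\<^sup>2 \<le> sqnorm n x * sqnorm n y"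
  unfolding vinner_def sqnorm_def by (rule Cauchy_Schwarz_ineq_sum)

lemma vinner_matvec:
  assumes "\<And>i j. i < n \<Longrightarrow> j < n \<Longrightarrow> A i j = A j i"
  shows "vinner n x (matvec n A y) = vinner n (matvec n A x) y"
proof -
  have "vinner n x (matvec n A y) = (\<Sum>i<n. \<Sum>j<n. x i * (A i j * y j))"
    by (simp add: vinner_def matvec_def sum_distrib_left)
  also have "\<dots> = (\<Sum>j<n. \<Sum>i<n. x i * (A i j * y j))" by (rule sum.swap)
  also have "\<dots> = (\<Sum>j<n. \<Sum>i<n. A j i * x i * y j)"
    using assms by (intro sum.cong refl) auto
  also have "\<dots> = vinner n (matvec n A x) y"
    by (simp add: vinner_def matvec_def sum_distrib_right)
  finally show ?thesis .
qed

lemma vinner_matvec_pow: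
  assumes "\<And>i j. i < n \<Longrightarrow> j < n \<Longrightarrow> A i j = A j i"
  shows "vinner n ((matvec n A ^^ k) x) ((matvec n A ^^ l) y) = vinner n x ((matvec n A ^^ (k + l)) y)"
proof (induction k arbitrary: l)
  case (Suc k)
  have "vinner n ((matvec n A ^^ Suc k) x) ((matvec n A ^^ l) y) = vinner n ((matvec n A ^^ k) x) ((matvec n A ^^ Suc l) y)"
    by (simp add: vinner_matvec[OF assms])
  also have "\<dots> = vinner n x ((matvec n A ^^ (k + Suc l)) y)" by (rule Suc)
  finally show ?case by simp
qed simp

lemma matvec_pow_walks:
  "(matvec n A ^^ m) x i = (\<Sum>xs\<in>walks n m. walk_prod A (i # xs) * x (last (i # xs)))"
proof (induction m arbitrary: i)
  case (Suc m)
  have "(matvec n A ^^ Suc m) x i = (\<Sum>j<n. A i j * (\<Sum>xs\<in>walks n m. walk_prod A (j # xs) * x (last (j # xs))))"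
    by (simp add: matvec_def Suc[abs_def] del: last.simps)
  also have "\<dots> = (\<Sum>j<n. \<Sum>xs\<in>walks n m. walk_prod A (i # j # xs) * x (last (i # j # xs)))"
    by (simp add: sum_distrib_left mult.assoc)
  finally show ?case by (simp only: sum_walks_Suc)
qed simp

definition trace_pow :: "nat \<Rightarrow> (nat \<Rightarrow> nat \<Rightarrow> real) \<Rightarrow> nat \<Rightarrow> real" where
  "trace_pow n A k = (\<Sum>xs\<in>walks n (Suc k). of_bool (last xs = hd xs) * walk_prod A xs)"

text \<open>Cauchy-Schwarz in each row bounds the operator norm of the power by its Hilbert-Schmidt
  norm, whose square is the trace of the power \<open>2 * m\<close> by symmetry. The vectors
  \<open>u j\<close> are the standard basis.\<close>

lemma sqnorm_matvec_pow_le: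
  assumes sym: "\<And>i j. i < n \<Longrightarrow> j < n \<Longrightarrow> A i j = A j i"
  shows "sqnorm n ((matvec n A ^^ m) x) \<le> sqnorm n x * trace_pow n A (2 * m)"
proof -
  define u :: "nat \<Rightarrow> nat \<Rightarrow> real" where "u j i = of_bool (i = j)" for i j
  let ?G = "\<lambda>i j. (matvec n A ^^ m) (u j) i"
  have lin: "(matvec n A ^^ m) x i = (\<Sum>j<n. ?G i j * x j)" if "i < n" for i
  proof -
    have "(\<Sum>j<n. ?G i j * x j) = (\<Sum>xs\<in>walks n m. \<Sum>j<n. walk_prod A (i # xs) * u j (last (i # xs)) * x j)"
      unfolding matvec_pow_walks sum_distrib_right by (rule sum.swap)
    also have "\<dots> = (\<Sum>xs\<in>walks n m. walk_prod A (i # xs) * x (last (i # xs)))"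
    proof (intro sum.cong refl)
      fix xs assume "xs \<in> walks n m"
      then have "last (i # xs) < n" using that by (auto simp: walks_def dest: last_in_set)
      then show "(\<Sum>j<n. walk_prod A (i # xs) * u j (last (i # xs)) * x j) = walk_prod A (i # xs) * x (last (i # xs))"
        using sum.delta[of "{..<n}" "last (i # xs)" "\<lambda>j. walk_prod A (i # xs) * x j"]
        by (subst sum.cong[OF refl, of _ _ "\<lambda>j. if j = last (i # xs) then walk_prod A (i # xs) * x j else 0"])
          (auto simp: u_def simp del: last.simps)
    qed
    finally show ?thesis unfolding matvec_pow_walks ..
  qed
  have "sqnorm n ((matvec n A ^^ m) x) = (\<Sum>i<n. (\<Sum>j<n. ?G i j * x j)\<^sup>2)"
    unfolding sqnorm_def using lin by (intro sum.cong refl) auto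
  also have "\<dots> \<le> (\<Sum>i<n. (\<Sum>j<n. (?G i j)\<^sup>2) * sqnorm n x)"
    unfolding sqnorm_def by (intro sum_mono Cauchy_Schwarz_ineq_sum)
  also have "\<dots> = sqnorm n x * (\<Sum>j<n. sqnorm n ((matvec n A ^^ m) (u j)))"
    unfolding sum_distrib_right[symmetric] sqnorm_def[of n "(matvec n A ^^ m) (u _)"]
    by (subst sum.swap) simp
  also have "(\<Sum>j<n. sqnorm n ((matvec n A ^^ m) (u j))) = (\<Sum>j<n. (matvec n A ^^ (2 * m)) (u j) j)"
  proof (intro sum.cong refl)
    fix j assume j: "j \<in> {..<n}"
    have "sqnorm n ((matvec n A ^^ m) (u j)) = vinner n (u j) ((matvec n A ^^ (2 * m)) (u j))"
      unfolding sqnorm_eq_vinner mult_2 by (rule vinner_matvec_pow[OF sym])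
    also have "\<dots> = (\<Sum>i<n. if i = j then (matvec n A ^^ (2 * m)) (u j) i else 0)"
      unfolding vinner_def by (intro sum.cong refl) (auto simp: u_def[of j])
    also have "\<dots> = (matvec n A ^^ (2 * m)) (u j) j"
      using j by simp
    finally show "sqnorm n ((matvec n A ^^ m) (u j)) = (matvec n A ^^ (2 * m)) (u j) j" .
  qed
  also have "\<dots> = trace_pow n A (2 * m)"
    unfolding trace_pow_def sum_walks_Suc matvec_pow_walks u_def by (simp add: mult.commute)
  finally show ?thesis .
qed

text \<open>A form of the bound of the operator norm by the trace of a high power that does not
  mention eigenvalues. By symmetry and Cauchy-Schwarz N(k)^2 <= N(0) N(2k), where N(k) is the
  squared norm after k multiplications. Doubling r times relates one multiplication to 2^r of them,
  hence the restriction to powers of two.\<close>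

lemma sqnorm_matvec_power_le:
  assumes sym: "\<And>i j. i < n \<Longrightarrow> j < n \<Longrightarrow> A i j = A j i"
  shows "sqnorm n (matvec n A x) ^ (2 ^ r) \<le> sqnorm n x ^ (2 ^ r) * trace_pow n A (2 * 2 ^ r)"
proof -
  let ?N = "\<lambda>k. sqnorm n ((matvec n A ^^ k) x)"
  have step: "(?N k)\<^sup>2 \<le> ?N 0 * ?N (2 * k)" for k
  proof -
    have "?N k = vinner n x ((matvec n A ^^ (2 * k)) x)"
      unfolding sqnorm_eq_vinner mult_2 by (rule vinner_matvec_pow[OF sym])
    then show ?thesis using vinner_Cauchy_Schwarz[of n x "(matvec n A ^^ (2 * k)) x"] by simp
  qed
  have "?N 1 ^ (2 ^ r) \<le> ?N 0 ^ (2 ^ r - 1) * ?N (2 ^ r)"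
  proof (induction r)
    case (Suc r)
    have "?N 1 ^ (2 ^ Suc r) = (?N 1 ^ (2 ^ r))\<^sup>2" by (simp add: power_mult[symmetric] mult.commute)
    also have "\<dots> \<le> (?N 0 ^ (2 ^ r - 1) * ?N (2 ^ r))\<^sup>2"
      by (intro power_mono Suc) auto
    also have "\<dots> = ?N 0 ^ (2 * (2 ^ r - 1)) * (?N (2 ^ r))\<^sup>2"
      by (simp add: power_mult_distrib power_mult[symmetric] mult.commute)
    also have "\<dots> \<le> ?N 0 ^ (2 * (2 ^ r - 1)) * (?N 0 * ?N (2 * 2 ^ r))"
      by (intro mult_left_mono step) auto
    also have "\<dots> = ?N 0 ^ Suc (2 * (2 ^ r - 1)) * ?N (2 ^ Suc r)" by (simp add: mult_ac)
    also have "Suc (2 * (2 ^ r - 1)) = 2 ^ Suc r - (1::nat)"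
    proof -
      have "(2::nat) ^ r \<ge> 1" by simp
      then show ?thesis unfolding power_Suc by linarith
    qed
    finally show ?case .
  qed simp
  also have "\<dots> \<le> ?N 0 ^ (2 ^ r - 1) * (sqnorm n x * trace_pow n A (2 * 2 ^ r))"
    by (intro mult_left_mono sqnorm_matvec_pow_le sym) auto
  also have "\<dots> = (sqnorm n x ^ (2 ^ r - 1) * sqnorm n x) * trace_pow n A (2 * 2 ^ r)" by simp
  also have "sqnorm n x ^ (2 ^ r - 1) * sqnorm n x = sqnorm n x ^ (2 ^ r)"
    by (rule power_minus_mult) simp
  finally show ?thesis by simp
qed

lemma card_vertices_le: "xs \<noteq> [] \<Longrightarrow> card (set xs) \<le> Suc (card {e. edge_count xs e > 0})"
proof (induction xs rule: induct_list012)
  case (3 a b xs)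
  have fin: "finite {e. edge_count ys e > 0}" for ys
  proof (rule finite_subset)
    show "{e. edge_count ys e > 0} \<subseteq> (\<lambda>(i, j). edge i j) ` (set ys \<times> set ys)"
      using edge_count_pos_imp[of ys] by force
  qed simp
  show ?case
  proof (cases "a \<in> set (b # xs)")
    case True
    then have "set (a # b # xs) = set (b # xs)" by auto
    moreover have "card {e. edge_count (b # xs) e > 0} \<le> card {e. edge_count (a # b # xs) e > 0}"
      by (intro card_mono fin) auto
    ultimately show ?thesis using 3 by simp
  next
    case False
    have "edge_count (b # xs) (edge a b) = 0" using False by (intro edge_count_eq_0) auto
    moreover have "{e. edge_count (a # b # xs) e > 0} = insert (edge a b) {e. edge_count (b # xs) e > 0}" by auto
    ultimately have "card {e. edge_count (a # b # xs) e > 0} = Suc (card {e. edge_count (b # xs) e > 0})"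
      using fin by (simp del: edge_count.simps)
    moreover have "card (set (a # b # xs)) = Suc (card (set (b # xs)))" using False by simp
    ultimately show ?thesis using 3(2) by simp
  qed
qed auto

text \<open>There are n^r lists of \<open>r\<close> vertices, and r^k walks inside each. A walk with
  fewer vertices has its vertex list padded with 0, a legal vertex since n >= 1.\<close>

lemma card_walks_few_vertices:
  assumes "n \<ge> 1"
  shows "card {xs \<in> walks n k. card (set xs) \<le> r} \<le> n ^ r * r ^ k"
proof -
  have "{xs \<in> walks n k. card (set xs) \<le> r} \<subseteq> (\<Union>ys\<in>walks n r. {xs. set xs \<subseteq> set ys \<and> length xs = k})"
  proof
    fix xs assume xs: "xs \<in> {xs \<in> walks n k. card (set xs) \<le> r}"
    let ?ys = "sorted_list_of_set (set xs) @ replicate (r - card (set xs)) 0"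
    have "?ys \<in> walks n r" using xs assms by (auto simp: walks_def)
    moreover have "set xs \<subseteq> set ?ys" by auto
    ultimately show "xs \<in> (\<Union>ys\<in>walks n r. {xs. set xs \<subseteq> set ys \<and> length xs = k})"
      unfolding UN_iff using xs by (intro bexI[of _ ?ys]) (auto simp: walks_def)
  qed
  then have "card {xs \<in> walks n k. card (set xs) \<le> r} \<le> card (\<Union>ys\<in>walks n r. {xs. set xs \<subseteq> set ys \<and> length xs = k})"
    by (intro card_mono finite_UN_I) (auto intro: finite_lists_length_eq)
  also have "\<dots> \<le> (\<Sum>ys\<in>walks n r. card {xs. set xs \<subseteq> set ys \<and> length xs = k})"
    by (rule card_UN_le) simp
  also have "\<dots> \<le> (\<Sum>ys\<in>walks n r. r ^ k)"
  proof (rule sum_mono)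
    fix ys assume "ys \<in> walks n r"
    then have "card (set ys) \<le> r" using card_length[of ys] by (auto simp: walks_def)
    then show "card {xs. set xs \<subseteq> set ys \<and> length xs = k} \<le> r ^ k"
      by (subst card_lists_length_eq) (auto intro: power_mono)
  qed
  also have "\<dots> = n ^ r * r ^ k"
    using card_lists_length_eq[of "{..<n}" r] by (simp add: walks_def)
  finally show ?thesis .
qed

text \<open>The first factor counts the walks on m + 1 chosen vertices, the second bounds the mean
  of one such walk apart from its power of n.\<close>

definition trace_const :: "nat \<Rightarrow> real" where
  "trace_const m = real (Suc m ^ Suc (2 * m)) * (2 * fact (2 * m)) ^ m"

context goe
begin

text \<open>The expectation vanishes unless every edge is traversed an even number of times, and then a walk
  with \<open>2 * m\<close> steps has at most \<open>m + 1\<close> vertices.\<close>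

lemma expectation_walk_prod:
  assumes xs: "xs \<in> walks n (Suc (2 * m))"
  shows "integrable P (\<lambda>\<omega>. walk_prod (Y \<omega>) xs)"
    and "expectation (\<lambda>\<omega>. walk_prod (Y \<omega>) xs) \<le> (if card (set xs) \<le> Suc m then (2 * fact (2 * m) / real n) ^ m else 0)"
proof -
  have sub: "set xs \<subseteq> {..<n}" and len: "length xs = Suc (2 * m)" using xs by (auto simp: walks_def)
  have eq: "walk_prod (Y \<omega>) xs = (\<Prod>e\<in>edges n. entry e \<omega> ^ edge_count xs e)" for \<omega>
    unfolding entry_def using sub by (intro walk_prod_eq_prod_edges sym) auto
  note * = expectation_prod_entries[of "\<lambda>e z. z ^ edge_count xs e", OF _ integrable_entry_power]
  show "integrable P (\<lambda>\<omega>. walk_prod (Y \<omega>) xs)" unfolding eq by (rule *(1)) auto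
  have E: "expectation (\<lambda>\<omega>. walk_prod (Y \<omega>) xs) = (\<Prod>e\<in>edges n. expectation (\<lambda>\<omega>. entry e \<omega> ^ edge_count xs e))"
    unfolding eq by (rule *(2)) auto
  have s2: "(\<Sum>e\<in>edges n. edge_count xs e) = 2 * m" using sum_edge_count[OF sub] len by simp
  show "expectation (\<lambda>\<omega>. walk_prod (Y \<omega>) xs) \<le> (if card (set xs) \<le> Suc m then (2 * fact (2 * m) / real n) ^ m else 0)"
  proof (cases "\<exists>e\<in>edges n. odd (edge_count xs e)")
    case True
    then obtain e where e: "e \<in> edges n" "odd (edge_count xs e)" by blast
    then obtain a where "edge_count xs e = 2 * a + 1" by (elim oddE)
    then have "expectation (\<lambda>\<omega>. entry e \<omega> ^ edge_count xs e) = 0" using expectation_entry_odd[OF e(1)] by simp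
    then have "expectation (\<lambda>\<omega>. walk_prod (Y \<omega>) xs) = 0" unfolding E using e(1) by (intro prod_zero) auto
    then show ?thesis by simp
  next
    case False
    define a where "a e = edge_count xs e div 2" for e
    have a: "edge_count xs e = 2 * a e" if "e \<in> edges n" for e using False that by (auto simp: a_def)
    have sa: "(\<Sum>e\<in>edges n. a e) = m" using s2 a by (simp add: sum_distrib_left[symmetric])
    have am: "a e \<le> m" if "e \<in> edges n" for e
      using member_le_sum[of e "edges n" a] that sa by simp
    have supp: "{e. edge_count xs e > 0} \<subseteq> edges n"
    proof
      fix e assume "e \<in> {e. edge_count xs e > 0}"
      then obtain i j where "e = edge i j" "i \<in> set xs" "j \<in> set xs" using edge_count_pos_imp[of xs e] by blast
      then show "e \<in> edges n" using edge_in_edges[of i n j] sub by blast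
    qed
    \<comment> \<open>An edge in use is traversed at least twice, so its halved count
      \<open>a e\<close> is at least 1, and the halved counts add up to \<open>m\<close>.\<close>
    have "card {e. edge_count xs e > 0} = (\<Sum>e\<in>{e. edge_count xs e > 0}. 1)" by simp
    also have "\<dots> \<le> (\<Sum>e\<in>{e. edge_count xs e > 0}. a e)"
      using supp a by (intro sum_mono) (fastforce simp: a_def)
    also have "\<dots> \<le> (\<Sum>e\<in>edges n. a e)" using supp by (intro sum_mono2) auto
    finally have "card (set xs) \<le> Suc m" using card_vertices_le[of xs] len sa by (cases xs) auto
    moreover have "expectation (\<lambda>\<omega>. walk_prod (Y \<omega>) xs) \<le> (\<Prod>e\<in>edges n. (2 * fact (2 * m) / real n) ^ a e)"
      unfolding E
    proof (intro prod_mono conjI)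
      fix e assume e: "e \<in> edges n"
      have eq: "expectation (\<lambda>\<omega>. entry e \<omega> ^ edge_count xs e) = evar e ^ a e * (fact (2 * a e) / (2 ^ a e * fact (a e)))"
        unfolding a[OF e] by (rule expectation_entry_even[OF e])
      show "0 \<le> expectation (\<lambda>\<omega>. entry e \<omega> ^ edge_count xs e)"
        unfolding eq using evar_pos[of e] by simp
      \<comment> \<open>The crude bound has the form of a constant to the power \<open>a e\<close>,
        so that the product over all edges depends only on the sum \<open>m\<close> of the
        exponents.\<close>
      have f: "fact (2 * a e) / (2 ^ a e * fact (a e)) \<le> (fact (2 * m) ^ a e :: real)"
      proof (cases "a e = 0")
        case False
        have "(1::real) \<le> 2 ^ a e * fact (a e)"
          using mult_mono[of 1 "2 ^ a e" 1 "fact (a e) :: real"] by (simp add: fact_ge_1)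
        then have "fact (2 * a e) / (2 ^ a e * fact (a e)) \<le> (fact (2 * a e) / 1 :: real)"
          by (intro divide_left_mono) auto
        also have "\<dots> \<le> fact (2 * m)" using am[OF e] by (simp add: fact_mono)
        also have "\<dots> \<le> fact (2 * m) ^ a e" using False by (intro self_le_power) (auto simp: fact_ge_1)
        finally show ?thesis .
      qed simp
      have "evar e ^ a e * (fact (2 * a e) / (2 ^ a e * fact (a e))) \<le> (2 / real n) ^ a e * fact (2 * m) ^ a e"
        using evar_pos[of e] evar_le[of e] f by (intro mult_mono power_mono) (auto simp: less_imp_le)
      then show "expectation (\<lambda>\<omega>. entry e \<omega> ^ edge_count xs e) \<le> (2 * fact (2 * m) / real n) ^ a e"
        unfolding eq by (simp add: power_mult_distrib[symmetric])
    qed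
    ultimately show ?thesis using sa by (simp add: power_sum[symmetric])
  qed
qed

text \<open>Of order n^(m+1) walks have nonzero mean, each of order n^(-m), which leaves one factor
  n.\<close>

lemma expectation_trace_pow:
  shows "integrable P (\<lambda>\<omega>. trace_pow n (Y \<omega>) (2 * m))"
    and "expectation (\<lambda>\<omega>. trace_pow n (Y \<omega>) (2 * m)) \<le> trace_const m * real n"
proof -
  let ?W = "walks n (Suc (2 * m))"
  let ?B = "(2 * fact (2 * m) / real n) ^ m"
  note int = expectation_walk_prod(1)[where m = m]
  show "integrable P (\<lambda>\<omega>. trace_pow n (Y \<omega>) (2 * m))"
    unfolding trace_pow_def using int by (intro Bochner_Integration.integrable_sum integrable_mult_right) auto
  have "expectation (\<lambda>\<omega>. trace_pow n (Y \<omega>) (2 * m)) = (\<Sum>xs\<in>?W. of_bool (last xs = hd xs) * expectation (\<lambda>\<omega>. walk_prod (Y \<omega>) xs))"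
    unfolding trace_pow_def using int by (subst Bochner_Integration.integral_sum) auto
  also have "\<dots> \<le> (\<Sum>xs\<in>?W. if card (set xs) \<le> Suc m then ?B else 0)"
  proof (rule sum_mono)
    fix xs assume "xs \<in> ?W"
    then have "expectation (\<lambda>\<omega>. walk_prod (Y \<omega>) xs) \<le> (if card (set xs) \<le> Suc m then ?B else 0)"
      by (rule expectation_walk_prod(2))
    then show "of_bool (last xs = hd xs) * expectation (\<lambda>\<omega>. walk_prod (Y \<omega>) xs) \<le> (if card (set xs) \<le> Suc m then ?B else 0)"
      by (auto split: if_splits)
  qed
  also have "\<dots> = real (card {xs \<in> ?W. card (set xs) \<le> Suc m}) * ?B"
    by (simp add: sum.inter_filter[symmetric])
  also have "\<dots> \<le> real (n ^ Suc m * Suc m ^ Suc (2 * m)) * ?B"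
    using n_pos by (intro mult_right_mono of_nat_mono card_walks_few_vertices) auto
  also have "\<dots> = trace_const m * real n"
    using n_pos unfolding trace_const_def by (simp add: power_divide field_simps)
  finally show "expectation (\<lambda>\<omega>. trace_pow n (Y \<omega>) (2 * m)) \<le> trace_const m * real n" .
qed

end

section \<open>Convergence in probability\<close>

text \<open>Convergence in probability as a filter: a property holds eventually iff it holds outside
  events of arbitrarily small probability. No measurability of the property is required.\<close>

definition prob_filter :: "'w measure \<Rightarrow> (nat \<times> 'w) filter" where
  "prob_filter P = Abs_filter (\<lambda>Q. \<forall>\<eta>>0. \<forall>\<^sub>F n in sequentially.
     \<exists>B\<in>sets P. measure P B \<le> \<eta> \<and> (\<forall>\<omega>\<in>space P - B. Q (n, \<omega>)))"

context prob_space
begin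

lemma eventually_prob_filter:
  "eventually Q (prob_filter M) \<longleftrightarrow> (\<forall>\<eta>>0. \<forall>\<^sub>F n in sequentially.
     \<exists>B\<in>sets M. measure M B \<le> \<eta> \<and> (\<forall>\<omega>\<in>space M - B. Q (n, \<omega>)))"
  unfolding prob_filter_def
proof (rule eventually_Abs_filter, rule is_filter.intro, goal_cases)
  case 1
  show ?case by (intro allI impI always_eventually bexI[of _ "{}"]) auto
next
  case (2 Q R)
  show ?case
  proof (intro allI impI)
    fix \<eta> :: real assume "\<eta> > 0"
    then have "\<eta> / 2 > 0" by simp
    then have "\<forall>\<^sub>F n in sequentially. \<exists>B\<in>sets M. measure M B \<le> \<eta> / 2 \<and> (\<forall>\<omega>\<in>space M - B. Q (n, \<omega>))"
      and "\<forall>\<^sub>F n in sequentially. \<exists>B\<in>sets M. measure M B \<le> \<eta> / 2 \<and> (\<forall>\<omega>\<in>space M - B. R (n, \<omega>))"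
      using 2 by blast+
    then show "\<forall>\<^sub>F n in sequentially. \<exists>B\<in>sets M. measure M B \<le> \<eta> \<and> (\<forall>\<omega>\<in>space M - B. Q (n, \<omega>) \<and> R (n, \<omega>))"
    proof eventually_elim
      case (elim n)
      then obtain B C where B: "B \<in> sets M" "measure M B \<le> \<eta> / 2" "\<forall>\<omega>\<in>space M - B. Q (n, \<omega>)"
        and C: "C \<in> sets M" "measure M C \<le> \<eta> / 2" "\<forall>\<omega>\<in>space M - C. R (n, \<omega>)" by blast
      have "measure M (B \<union> C) \<le> \<eta>"
        using measure_Un_le[OF B(1) C(1)] B(2) C(2) by linarith
      then show ?case using B C by (intro bexI[of _ "B \<union> C"]) auto
    qed
  qed
next
  case (3 Q R)
  show ?case
  proof (intro allI impI)
    fix \<eta> :: real assume "\<eta> > 0"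
    with 3(2) have "\<forall>\<^sub>F n in sequentially. \<exists>B\<in>sets M. measure M B \<le> \<eta> \<and> (\<forall>\<omega>\<in>space M - B. Q (n, \<omega>))" by blast
    then show "\<forall>\<^sub>F n in sequentially. \<exists>B\<in>sets M. measure M B \<le> \<eta> \<and> (\<forall>\<omega>\<in>space M - B. R (n, \<omega>))"
      by eventually_elim (use 3(1) in blast)
  qed
qed

lemma filterlim_fst_prob_filter: "filterlim fst sequentially (prob_filter M)"
  unfolding filterlim_iff eventually_prob_filter
proof (intro allI impI)
  fix Q and \<eta> :: real assume "eventually Q sequentially" "\<eta> > 0"
  from this(1) show "\<forall>\<^sub>F n in sequentially. \<exists>B\<in>sets M. measure M B \<le> \<eta> \<and> (\<forall>\<omega>\<in>space M - B. Q (fst (n, \<omega>)))"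
    by eventually_elim (use \<open>\<eta> > 0\<close> in \<open>auto intro!: bexI[of _ "{}"]\<close>)
qed

lemma tendsto_deterministic: "f \<longlonglongrightarrow> l \<Longrightarrow> ((\<lambda>x. f (fst x)) \<longlongrightarrow> l) (prob_filter M)"
  by (rule filterlim_compose[OF _ filterlim_fst_prob_filter])

lemma eventually_fst_prob_filter: "eventually Q sequentially \<Longrightarrow> \<forall>\<^sub>F x in prob_filter M. Q (fst x)"
  using filterlim_fst_prob_filter by (auto simp: filterlim_iff)

text \<open>The gate through which moment bounds enter the filter; from there on limits are combined
  by the usual limit rules.\<close>

lemma tendsto_0_Markov:
  fixes X :: "nat \<times> 'a \<Rightarrow> real"
  assumes X: "\<And>n. n \<ge> 1 \<Longrightarrow> integrable M (\<lambda>\<omega>. X (n, \<omega>))" "\<And>n \<omega>. n \<ge> 1 \<Longrightarrow> 0 \<le> X (n, \<omega>)"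
    and le: "\<And>n. n \<ge> 1 \<Longrightarrow> expectation (\<lambda>\<omega>. X (n, \<omega>)) \<le> r n" and r: "r \<longlonglongrightarrow> 0"
  shows "(X \<longlongrightarrow> 0) (prob_filter M)"
proof (rule tendstoI)
  fix \<epsilon> :: real assume e: "\<epsilon> > 0"
  show "\<forall>\<^sub>F x in prob_filter M. dist (X x) 0 < \<epsilon>"
    unfolding eventually_prob_filter
  proof (intro allI impI)
    fix \<eta> :: real assume "\<eta> > 0"
    then have "\<forall>\<^sub>F n in sequentially. r n < \<epsilon> * \<eta>" using r e by (intro order_tendstoD) auto
    then show "\<forall>\<^sub>F n in sequentially. \<exists>B\<in>sets M. measure M B \<le> \<eta> \<and> (\<forall>\<omega>\<in>space M - B. dist (X (n, \<omega>)) 0 < \<epsilon>)"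
      using eventually_ge_at_top[of 1]
    proof eventually_elim
      case (elim n)
      note int [measurable] = X(1)[OF elim(2)]
      let ?B = "{\<omega> \<in> space M. X (n, \<omega>) \<ge> \<epsilon>}"
      have "measure M ?B \<le> expectation (\<lambda>\<omega>. X (n, \<omega>)) / \<epsilon>"
        using X(2)[OF elim(2)] e by (intro integral_Markov_inequality_measure[OF int, of "{}"]) auto
      also have "\<dots> \<le> \<eta>"
        using le[OF elim(2)] elim(1) e by (simp add: field_simps)
      finally have "measure M ?B \<le> \<eta>" .
      moreover have "?B \<in> sets M" by measurable
      ultimately show ?case using X(2)[OF elim(2)] by (intro bexI[of _ ?B]) auto
    qed
  qed
qed

lemma tendsto_prob_filterD:
  fixes X :: "nat \<times> 'a \<Rightarrow> real"
  assumes X: "(X \<longlongrightarrow> c) (prob_filter M)" and "\<epsilon> > 0"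
  shows "(\<lambda>n. measure M {\<omega> \<in> space M. \<bar>X (n, \<omega>) - c\<bar> > \<epsilon>}) \<longlonglongrightarrow> 0"
proof (rule tendstoI)
  fix \<eta> :: real assume "\<eta> > 0"
  then have e2: "\<eta> / 2 > 0" by simp
  have "\<forall>\<^sub>F x in prob_filter M. dist (X x) c < \<epsilon>" using X \<open>\<epsilon> > 0\<close> by (rule tendstoD)
  then have "\<forall>\<^sub>F n in sequentially. \<exists>B\<in>sets M. measure M B \<le> \<eta> / 2 \<and> (\<forall>\<omega>\<in>space M - B. dist (X (n, \<omega>)) c < \<epsilon>)"
    unfolding eventually_prob_filter using e2 by blast
  then show "\<forall>\<^sub>F n in sequentially. dist (measure M {\<omega> \<in> space M. \<bar>X (n, \<omega>) - c\<bar> > \<epsilon>}) 0 < \<eta>"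
  proof eventually_elim
    case (elim n)
    then obtain B where B: "B \<in> sets M" "measure M B \<le> \<eta> / 2" "\<forall>\<omega>\<in>space M - B. dist (X (n, \<omega>)) c < \<epsilon>" by blast
    \<comment> \<open>Monotonicity asks measurability of the larger event \<open>B\<close>
      only.\<close>
    have "measure M {\<omega> \<in> space M. \<bar>X (n, \<omega>) - c\<bar> > \<epsilon>} \<le> measure M B"
      using B by (intro finite_measure_mono) (force simp: dist_real_def)+
    also have "\<dots> < \<eta>" using B \<open>\<eta> > 0\<close> by simp
    finally show ?case by simp
  qed
qed

end

lemma tendsto_0_of_square:
  fixes f :: "'b \<Rightarrow> real"
  assumes "((\<lambda>x. (f x)\<^sup>2) \<longlongrightarrow> 0) F"
  shows "(f \<longlongrightarrow> 0) F"
proof -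
  have "((\<lambda>x. sqrt ((f x)\<^sup>2)) \<longlongrightarrow> sqrt 0) F" by (intro tendsto_real_sqrt assms)
  then show ?thesis by (simp add: tendsto_rabs_zero_iff)
qed

locale goe_sequence = prob_space P for P :: "'w measure" +
  fixes Z :: "nat \<Rightarrow> 'w \<Rightarrow> nat \<Rightarrow> nat \<Rightarrow> real"
  assumes goe: "\<And>n. n \<ge> 1 \<Longrightarrow> goe P n (Z n)"
begin

abbreviation F :: "(nat \<times> 'w) filter" where "F \<equiv> prob_filter P"
abbreviation Zx :: "nat \<times> 'w \<Rightarrow> nat \<Rightarrow> nat \<Rightarrow> real" where "Zx x \<equiv> Z (fst x) (snd x)"

lemma eventually_ge_1: "\<forall>\<^sub>F x in F. fst x \<ge> 1"
  using eventually_fst_prob_filter[OF eventually_ge_at_top[of 1]] .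

lemma Z_sym: "i < n \<Longrightarrow> j < n \<Longrightarrow> Z n \<omega> i j = Z n \<omega> j i"
  using goe.sym[OF goe[of n]] by (cases n) auto

text \<open>The mean of the trace of the power 2m is of order n, so by Markov the trace is below
  n^(beta m) with high probability once beta m > 2. Taking m-th roots gives the bound, and for all
  \<open>y\<close> on the same event because the trace does not depend on \<open>y\<close>.\<close>

lemma operator_norm_bound:
  assumes "\<beta> > 0"
  shows "\<forall>\<^sub>F x in F. \<forall>y. sqnorm (fst x) (matvec (fst x) (Zx x) y) \<le> real (fst x) powr \<beta> * sqnorm (fst x) y"
proof -
  \<comment> \<open>A power of two because \<open>sqnorm_matvec_power_le\<close> works by
    doubling.\<close>
  obtain r :: nat where r: "2 / \<beta> < 2 ^ r" using real_arch_pow[of 2 "2 / \<beta>"] by auto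
  define m :: nat where "m = 2 ^ r"
  have m: "\<beta> * real m > 2" "m \<ge> 1" using r assms by (auto simp: m_def field_simps)
  \<comment> \<open>The trace dominates the squared norm of the image of the first basis vector,
    which exists since n >= 1.\<close>
  have nonneg: "trace_pow n (Z n \<omega>) (2 * m) \<ge> 0" if "n \<ge> 1" for n \<omega>
  proof -
    let ?u = "\<lambda>i. of_bool (i = (0::nat)) :: real"
    have "sqnorm n ?u = (\<Sum>i<n. if i = 0 then 1 else 0)" unfolding sqnorm_def by (intro sum.cong) auto
    also have "\<dots> = 1" using that by simp
    finally have "sqnorm n ?u = 1" .
    then have "sqnorm n ((matvec n (Z n \<omega>) ^^ m) ?u) \<le> trace_pow n (Z n \<omega>) (2 * m)"
      using sqnorm_matvec_pow_le[where n = n and A = "Z n \<omega>" and m = m and x = ?u, OF Z_sym] by simp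
    then show ?thesis using sqnorm_nonneg order_trans by blast
  qed
  have "((\<lambda>x. trace_pow (fst x) (Zx x) (2 * m) / real (fst x) powr (\<beta> * real m)) \<longlongrightarrow> 0) F"
  proof (rule tendsto_0_Markov[where r = "\<lambda>n. trace_const m * (1 / real n)"])
    fix n :: nat assume n: "n \<ge> 1"
    interpret g: goe P n "Z n" using goe[OF n] .
    show "integrable P (\<lambda>\<omega>. trace_pow (fst (n, \<omega>)) (Zx (n, \<omega>)) (2 * m) / real (fst (n, \<omega>)) powr (\<beta> * real m))"
      using g.expectation_trace_pow(1)[of m] by simp
    show "0 \<le> trace_pow (fst (n, \<omega>)) (Zx (n, \<omega>)) (2 * m) / real (fst (n, \<omega>)) powr (\<beta> * real m)" for \<omega>
      using nonneg[OF n] by simp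
    have "expectation (\<lambda>\<omega>. trace_pow (fst (n, \<omega>)) (Zx (n, \<omega>)) (2 * m) / real (fst (n, \<omega>)) powr (\<beta> * real m))
        = expectation (\<lambda>\<omega>. trace_pow n (Z n \<omega>) (2 * m)) / real n powr (\<beta> * real m)" by simp
    also have "\<dots> \<le> trace_const m * real n / real n powr (\<beta> * real m)"
      by (intro divide_right_mono g.expectation_trace_pow(2)) auto
    also have "\<dots> \<le> trace_const m * real n / real n powr 2"
      using n m by (intro divide_left_mono powr_mono mult_pos_pos) (auto simp: trace_const_def)
    also have "\<dots> = trace_const m * (1 / real n)"
      using n by (simp add: powr_numeral power2_eq_square)
    finally show "expectation (\<lambda>\<omega>. trace_pow (fst (n, \<omega>)) (Zx (n, \<omega>)) (2 * m) / real (fst (n, \<omega>)) powr (\<beta> * real m))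
       \<le> trace_const m * (1 / real n)" .
  next
    show "(\<lambda>n. trace_const m * (1 / real n)) \<longlonglongrightarrow> 0"
      using tendsto_mult_right_zero[OF lim_1_over_n] by blast
  qed
  then have "\<forall>\<^sub>F x in F. trace_pow (fst x) (Zx x) (2 * m) / real (fst x) powr (\<beta> * real m) < 1"
    by (rule order_tendstoD) simp
  with eventually_ge_1 show ?thesis
  proof eventually_elim
    case (elim x)
    let ?n = "fst x"
    have n: "real ?n > 0" using elim by simp
    have T: "trace_pow ?n (Zx x) (2 * m) \<le> (real ?n powr \<beta>) ^ m"
      using elim n by (simp add: powr_realpow[symmetric] powr_powr)
    show ?case
    proof
      fix y
      have "sqnorm ?n (matvec ?n (Zx x) y) ^ m \<le> sqnorm ?n y ^ m * trace_pow ?n (Zx x) (2 * m)"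
        unfolding m_def by (rule sqnorm_matvec_power_le[where n = ?n and A = "Zx x"]) (rule Z_sym)
      also have "\<dots> \<le> sqnorm ?n y ^ m * (real ?n powr \<beta>) ^ m" by (intro mult_left_mono T) simp
      also have "\<dots> = (real ?n powr \<beta> * sqnorm ?n y) ^ m" by (simp add: power_mult_distrib mult.commute)
      finally have "sqnorm ?n (matvec ?n (Zx x) y) ^ m \<le> (real ?n powr \<beta> * sqnorm ?n y) ^ m" .
      then show "sqnorm ?n (matvec ?n (Zx x) y) \<le> real ?n powr \<beta> * sqnorm ?n y"
        using m(2) by (subst (asm) power_mono_iff) auto
    qed
  qed
qed

text \<open>Requiring the bound for every \<open>\<beta> > 0\<close> makes the class stable under multiplication by the matrix,
  whose norm is only controlled up to arbitrarily small powers of \<open>n\<close>.\<close>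

definition small :: "(nat \<times> 'w \<Rightarrow> nat \<Rightarrow> real) \<Rightarrow> bool" where
  "small X \<longleftrightarrow> (\<forall>\<beta>>0. ((\<lambda>x. sqnorm (fst x) (X x) / real (fst x) powr \<beta>) \<longlongrightarrow> 0) F)"

lemma small_0: "(\<And>x i. i < fst x \<Longrightarrow> X x i = 0) \<Longrightarrow> small X"
  unfolding small_def sqnorm_def by simp

lemma small_bound:
  assumes X: "small X" and "\<forall>\<^sub>F x in F. sqnorm (fst x) (Y x) \<le> C * sqnorm (fst x) (X x)"
  shows "small Y"
  unfolding small_def
proof (intro allI impI)
  fix \<beta> :: real assume "\<beta> > 0"
  then have "((\<lambda>x. C * (sqnorm (fst x) (X x) / real (fst x) powr \<beta>)) \<longlongrightarrow> C * 0) F"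
    using X unfolding small_def by (intro tendsto_mult tendsto_const) auto
  then have lim: "((\<lambda>x. C * sqnorm (fst x) (X x) / real (fst x) powr \<beta>) \<longlongrightarrow> 0) F" by simp
  show "((\<lambda>x. sqnorm (fst x) (Y x) / real (fst x) powr \<beta>) \<longlongrightarrow> 0) F"
  proof (rule tendsto_sandwich[OF _ _ tendsto_const lim])
    show "\<forall>\<^sub>F x in F. sqnorm (fst x) (Y x) / real (fst x) powr \<beta> \<le> C * sqnorm (fst x) (X x) / real (fst x) powr \<beta>"
      using assms(2) by eventually_elim (auto intro: divide_right_mono)
  qed simp
qed

lemma small_add:
  assumes "small X" "small Y"
  shows "small (\<lambda>x i. X x i + Y x i)"
  unfolding small_def
proof (intro allI impI)
  fix \<beta> :: real assume "\<beta> > 0"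
  let ?f = "\<lambda>X x. sqnorm (fst x) (X x) / real (fst x) powr \<beta>"
  have "((\<lambda>x. 2 * ?f X x + 2 * ?f Y x) \<longlongrightarrow> 2 * 0 + 2 * 0) F"
    using assms \<open>\<beta> > 0\<close> unfolding small_def by (intro tendsto_intros) auto
  then have lim: "((\<lambda>x. 2 * ?f X x + 2 * ?f Y x) \<longlongrightarrow> 0) F" by simp
  have sq: "(x + y)\<^sup>2 \<le> 2 * x\<^sup>2 + 2 * y\<^sup>2" for x y :: real
    using zero_le_power2[of "x - y"] by (simp add: power2_eq_square algebra_simps)
  have le: "sqnorm n (\<lambda>i. X x i + Y x i) \<le> 2 * sqnorm n (X x) + 2 * sqnorm n (Y x)" for n x
    unfolding sqnorm_def sum_distrib_left sum.distrib[symmetric] by (intro sum_mono sq)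
  show "(?f (\<lambda>x i. X x i + Y x i) \<longlongrightarrow> 0) F"
  proof (rule tendsto_sandwich[OF _ _ tendsto_const lim])
    show "\<forall>\<^sub>F x in F. ?f (\<lambda>x i. X x i + Y x i) x \<le> 2 * ?f X x + 2 * ?f Y x"
    proof (intro always_eventually allI)
      fix x
      have "?f (\<lambda>x i. X x i + Y x i) x \<le> (2 * sqnorm (fst x) (X x) + 2 * sqnorm (fst x) (Y x)) / real (fst x) powr \<beta>"
        by (intro divide_right_mono le) simp
      then show "?f (\<lambda>x i. X x i + Y x i) x \<le> 2 * ?f X x + 2 * ?f Y x" by (simp add: add_divide_distrib)
    qed
  qed simp
qed

lemma small_mult:
  assumes "small X" and "\<And>x i. i < fst x \<Longrightarrow> \<bar>c x i\<bar> \<le> 1"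
  shows "small (\<lambda>x i. c x i * X x i)"
proof (rule small_bound[OF assms(1), of _ 1], intro always_eventually allI)
  fix x
  show "sqnorm (fst x) (\<lambda>i. c x i * X x i) \<le> 1 * sqnorm (fst x) (X x)"
    unfolding sqnorm_def mult_1
  proof (rule sum_mono)
    fix i assume "i \<in> {..<fst x}"
    then have "\<bar>c x i\<bar> * \<bar>X x i\<bar> \<le> 1 * \<bar>X x i\<bar>" using assms(2)[of i x] by (intro mult_right_mono) auto
    then show "(c x i * X x i)\<^sup>2 \<le> (X x i)\<^sup>2" by (simp add: abs_le_square_iff[symmetric] abs_mult)
  qed
qed

text \<open>Half of the exponent pays for the operator norm, the other half is left for
  \<open>X\<close>.\<close>

lemma small_matvec:
  assumes X: "small X"
  shows "small (\<lambda>x. matvec (fst x) (Zx x) (X x))"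
  unfolding small_def
proof (intro allI impI)
  fix \<beta> :: real assume b: "\<beta> > 0"
  then have lim: "((\<lambda>x. sqnorm (fst x) (X x) / real (fst x) powr (\<beta> / 2)) \<longlongrightarrow> 0) F"
    using X unfolding small_def by simp
  have b2: "\<beta> / 2 > 0" using b by simp
  have "\<forall>\<^sub>F x in F. sqnorm (fst x) (matvec (fst x) (Zx x) (X x)) / real (fst x) powr \<beta> \<le> sqnorm (fst x) (X x) / real (fst x) powr (\<beta> / 2)"
    using operator_norm_bound[OF b2] eventually_ge_1
  proof eventually_elim
    case x: (elim x)
    have "sqnorm (fst x) (matvec (fst x) (Zx x) (X x)) / real (fst x) powr \<beta> \<le> (real (fst x) powr (\<beta> / 2) * sqnorm (fst x) (X x)) / real (fst x) powr \<beta>"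
      using x by (intro divide_right_mono) auto
    also have "\<dots> = sqnorm (fst x) (X x) / real (fst x) powr (\<beta> / 2)"
    proof -
      have "real (fst x) powr \<beta> = real (fst x) powr (\<beta> / 2) * real (fst x) powr (\<beta> / 2)"
        by (simp add: powr_add[symmetric])
      moreover have "real (fst x) powr (\<beta> / 2) > 0" using x by simp
      ultimately show ?thesis by simp
    qed
    finally show "sqnorm (fst x) (matvec (fst x) (Zx x) (X x)) / real (fst x) powr \<beta> \<le> sqnorm (fst x) (X x) / real (fst x) powr (\<beta> / 2)" .
  qed
  then show "((\<lambda>x. sqnorm (fst x) (matvec (fst x) (Zx x) (X x)) / real (fst x) powr \<beta>) \<longlongrightarrow> 0) F"
    by (intro tendsto_sandwich[OF _ _ tendsto_const lim]) auto
qed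

end

section \<open>Free expansions\<close>

lemma vinner_commute: "vinner n x y = vinner n y x"
  by (simp add: vinner_def mult.commute)

lemma vinner_add_right: "vinner n x (\<lambda>i. y i + z i) = vinner n x y + vinner n x z"
  by (simp add: vinner_def distrib_left sum.distrib)

lemma vinner_diff_left: "vinner n (\<lambda>i. y i - z i) x = vinner n y x - vinner n z x"
  by (simp add: vinner_def left_diff_distrib sum_subtractf)

lemma vinner_scale_left: "vinner n (\<lambda>i. c * y i) x = c * vinner n y x"
  by (simp add: vinner_def sum_distrib_left mult.assoc)

lemma vinner_scale_right: "vinner n x (\<lambda>i. c * y i) = c * vinner n x y"
  by (simp add: vinner_def sum_distrib_left mult.left_commute)

lemma vinner_diag: "vinner n (\<lambda>i. D i * x i) y = vinner n x (\<lambda>i. D i * y i)"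
  by (simp add: vinner_def mult_ac)

lemma vinner_cong: "(\<And>i. i < n \<Longrightarrow> x i = x' i) \<Longrightarrow> (\<And>i. i < n \<Longrightarrow> y i = y' i) \<Longrightarrow> vinner n x y = vinner n x' y'"
  by (simp add: vinner_def)

lemma matvec_diff: "matvec n A (\<lambda>j. x j - y j) i = matvec n A x i - matvec n A y i"
  by (simp add: matvec_def right_diff_distrib sum_subtractf)

text \<open>The vector \<open>\<ell> D\<^sub>1 \<ell> D\<^sub>2 \<dots> \<ell> D\<^sub>k v\<close>, where \<open>A = \<ell> + \<ell>\<^sup>*\<close> is thought of as a sum of
  creation and annihilation operators on the full Fock space, so that \<open>\<ell>\<^sup>* D \<ell>\<close> is the scalar
  \<open>mean n D\<close>.\<close>

fun free_vec :: "nat \<Rightarrow> (nat \<Rightarrow> nat \<Rightarrow> real) \<Rightarrow> (nat \<Rightarrow> real) list \<Rightarrow> (nat \<Rightarrow> real) \<Rightarrow> nat \<Rightarrow> real" where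
  "free_vec n A [] v i = v i"
| "free_vec n A [D] v i = matvec n A (\<lambda>j. D j * v j) i"
| "free_vec n A (D # D1 # w) v i =
     matvec n A (\<lambda>j. D j * free_vec n A (D1 # w) v j) i - mean n D * (D1 i * free_vec n A w v i)"

lemma matvec_free_vec:
  "matvec n A (\<lambda>j. D j * free_vec n A w v j) i = free_vec n A (D # w) v i +
     (case w of [] \<Rightarrow> 0 | D1 # w1 \<Rightarrow> mean n D * (D1 i * free_vec n A w1 v i))"
  by (cases w) auto

lemma path_vec_Nil: "path_vec n A [] v i = v i"
  by (simp add: path_vec_if)

lemma abs_mean_le: "contraction n D \<Longrightarrow> \<bar>mean n D\<bar> \<le> 1"
proof -
  assume D: "contraction n D"
  have "\<bar>\<Sum>i<n. D i\<bar> \<le> (\<Sum>i<n. 1)"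
    using D by (intro order_trans[OF sum_abs] sum_mono) (auto simp: contraction_def)
  then show ?thesis unfolding mean_def by (cases "n = 0") (auto simp: abs_divide)
qed

definition diag_seq :: "(nat \<Rightarrow> nat \<Rightarrow> real) \<Rightarrow> bool" where
  "diag_seq D \<longleftrightarrow> (\<forall>n. contraction n (D n))"

definition vec_seq :: "(nat \<Rightarrow> nat \<Rightarrow> real) \<Rightarrow> bool" where
  "vec_seq v \<longleftrightarrow> (\<exists>K\<ge>0. \<forall>n. sqnorm n (v n) \<le> K * real n)"

lemma sqnorm_contraction_le:
  assumes "contraction n D"
  shows "sqnorm n (\<lambda>i. D i * v i) \<le> sqnorm n v"
  unfolding sqnorm_def
proof (rule sum_mono)
  fix i assume "i \<in> {..<n}"
  then have "\<bar>D i\<bar> * \<bar>v i\<bar> \<le> 1 * \<bar>v i\<bar>" using assms by (intro mult_right_mono) (auto simp: contraction_def)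
  then show "(D i * v i)\<^sup>2 \<le> (v i)\<^sup>2" by (simp add: abs_le_square_iff[symmetric] abs_mult)
qed

lemma vec_seq_diag: "diag_seq D \<Longrightarrow> vec_seq v \<Longrightarrow> vec_seq (\<lambda>n i. D n i * v n i)"
  unfolding vec_seq_def diag_seq_def using sqnorm_contraction_le order_trans by meson

context goe_sequence
begin

abbreviation fv :: "(nat \<Rightarrow> nat \<Rightarrow> real) list \<Rightarrow> (nat \<Rightarrow> nat \<Rightarrow> real) \<Rightarrow> nat \<times> 'w \<Rightarrow> nat \<Rightarrow> real" where
  "fv Ds v x \<equiv> free_vec (fst x) (Zx x) (map (\<lambda>D. D (fst x)) Ds) (v (fst x))"

abbreviation pv :: "(nat \<Rightarrow> nat \<Rightarrow> real) list \<Rightarrow> (nat \<Rightarrow> nat \<Rightarrow> real) \<Rightarrow> nat \<times> 'w \<Rightarrow> nat \<Rightarrow> real" where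
  "pv Ds v x \<equiv> path_vec (fst x) (Zx x) (map (\<lambda>D. D (fst x)) Ds) (v (fst x))"

text \<open>The mean of the squared norm stays bounded in n, so any positive power of n in the
  denominator sends it to 0.\<close>

lemma small_step_err:
  assumes D: "diag_seq D" "\<forall>D\<in>set w. diag_seq D" and v: "vec_seq v"
  shows "small (\<lambda>x. step_err (fst x) (Zx x) (D (fst x)) (map (\<lambda>D. D (fst x)) w) (v (fst x)))"
  unfolding small_def
proof (intro allI impI)
  fix \<beta> :: real assume b: "\<beta> > 0"
  obtain K where K: "K \<ge> 0" "\<And>n. sqnorm n (v n) \<le> K * real n" using v by (auto simp: vec_seq_def)
  let ?C = "step_const (length w)"
  let ?e = "\<lambda>n \<omega>. step_err n (Z n \<omega>) (D n) (map (\<lambda>D. D n) w) (v n)"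
  have C: "?C \<ge> 0" by (simp add: step_const_def)
  show "((\<lambda>x. sqnorm (fst x) (?e (fst x) (snd x)) / real (fst x) powr \<beta>) \<longlongrightarrow> 0) F"
  proof (rule tendsto_0_Markov[where r = "\<lambda>n. ?C * K * real n powr (- \<beta>)"])
    fix n :: nat assume n: "n \<ge> 1"
    interpret g: goe P n "Z n" using goe[OF n] .
    have Dn: "contraction n (D n)" "\<forall>D\<in>set (map (\<lambda>D. D n) w). contraction n D"
      using D by (auto simp: diag_seq_def)
    note * = g.step_err_moment[OF Dn, of "v n"]
    show "integrable P (\<lambda>\<omega>. sqnorm (fst (n, \<omega>)) (?e (fst (n, \<omega>)) (snd (n, \<omega>))) / real (fst (n, \<omega>)) powr \<beta>)"
      using *(1) unfolding sqnorm_def by simp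
    show "0 \<le> sqnorm (fst (n, \<omega>)) (?e (fst (n, \<omega>)) (snd (n, \<omega>))) / real (fst (n, \<omega>)) powr \<beta>" for \<omega>
      by simp
    have "expectation (\<lambda>\<omega>. sqnorm n (?e n \<omega>)) \<le> ?C * sqnorm n (v n) / real n"
      using *(2) unfolding sqnorm_def by simp
    also have "\<dots> \<le> ?C * (K * real n) / real n"
      using K C by (intro divide_right_mono mult_left_mono) auto
    also have "\<dots> = ?C * K" using n by simp
    finally have "expectation (\<lambda>\<omega>. sqnorm n (?e n \<omega>)) / real n powr \<beta> \<le> ?C * K / real n powr \<beta>"
      by (intro divide_right_mono) auto
    then show "expectation (\<lambda>\<omega>. sqnorm (fst (n, \<omega>)) (?e (fst (n, \<omega>)) (snd (n, \<omega>))) / real (fst (n, \<omega>)) powr \<beta>) \<le> ?C * K * real n powr - \<beta>"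
      by (simp add: powr_minus divide_inverse)
  next
    have "(\<lambda>n. real n powr - \<beta>) \<longlonglongrightarrow> 0"
      using b by (intro tendsto_neg_powr filterlim_real_sequentially) auto
    then show "(\<lambda>n. ?C * K * real n powr (- \<beta>)) \<longlonglongrightarrow> 0"
      by (rule tendsto_mult_right_zero)
  qed
qed

text \<open>The difference obeys the recursion of \<open>free_vec\<close> with
  \<open>step_err\<close> as forcing term, and every operation in that recursion preserves
  smallness. The induction goes back two letters because the annihilation term does; for one letter
  the difference is \<open>step_err\<close> itself.\<close>

lemma small_free_minus_path:
  assumes "\<forall>D\<in>set Ds. diag_seq D" and v: "vec_seq v"
  shows "small (\<lambda>x i. fv Ds v x i - pv Ds v x i)"
  using assms(1)
proof (induction Ds rule: induct_list012)
  case 1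
  show ?case by (rule small_0) (simp add: path_vec_Nil)
next
  case (2 D)
  have "small (\<lambda>x. step_err (fst x) (Zx x) (D (fst x)) (map (\<lambda>D. D (fst x)) []) (v (fst x)))"
    using 2 v by (intro small_step_err) auto
  then show ?case by (simp add: step_err_def[abs_def] path_vec_Nil)
next
  case (3 D D1 w)
  let ?d = "\<lambda>w x i. fv w v x i - pv w v x i"
  have "small (\<lambda>x. matvec (fst x) (Zx x) (\<lambda>j. D (fst x) j * ?d (D1 # w) x j))"
    using 3 by (intro small_matvec small_mult) (auto simp: diag_seq_def contraction_def)
  moreover have "small (\<lambda>x i. (- (mean (fst x) (D (fst x)) * D1 (fst x) i)) * ?d w x i)"
  proof (rule small_mult)
    show "small (?d w)" using 3 by auto
    fix x :: "nat \<times> 'w" and i assume "i < fst x"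
    then have "\<bar>D1 (fst x) i\<bar> \<le> 1" "\<bar>mean (fst x) (D (fst x))\<bar> \<le> 1"
      using 3(3) abs_mean_le by (auto simp: diag_seq_def contraction_def)
    then have "\<bar>mean (fst x) (D (fst x))\<bar> * \<bar>D1 (fst x) i\<bar> \<le> 1 * 1" by (intro mult_mono) auto
    then show "\<bar>- (mean (fst x) (D (fst x)) * D1 (fst x) i)\<bar> \<le> 1" by (simp add: abs_mult)
  qed
  moreover have "small (\<lambda>x. step_err (fst x) (Zx x) (D (fst x)) (map (\<lambda>D. D (fst x)) (D1 # w)) (v (fst x)))"
    using 3 v by (intro small_step_err) auto
  ultimately have "small (\<lambda>x i. matvec (fst x) (Zx x) (\<lambda>j. D (fst x) j * ?d (D1 # w) x j) i
      + (- (mean (fst x) (D (fst x)) * D1 (fst x) i)) * ?d w x i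
      + step_err (fst x) (Zx x) (D (fst x)) (map (\<lambda>D. D (fst x)) (D1 # w)) (v (fst x)) i)"
    by (intro small_add)
  then show ?case
    by (simp add: step_err_def right_diff_distrib matvec_diff algebra_simps)
qed

text \<open>For the path sum the second moment bound applies directly; the rest is small in norm and
  handled by Cauchy-Schwarz.\<close>

lemma vinner_free_vec_tendsto_0:
  assumes D: "\<forall>D\<in>set Ds. diag_seq D" and ne: "Ds \<noteq> []" and u: "vec_seq u" and v: "vec_seq v"
  shows "((\<lambda>x. vinner (fst x) (u (fst x)) (fv Ds v x) / real (fst x)) \<longlongrightarrow> 0) F"
proof -
  obtain K where K: "K \<ge> 0" "\<And>n. sqnorm n (v n) \<le> K * real n" using v by (auto simp: vec_seq_def)
  obtain L where L: "L \<ge> 0" "\<And>n. sqnorm n (u n) \<le> L * real n" using u by (auto simp: vec_seq_def)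
  let ?k = "length Ds"
  let ?C = "real (Suc ?k ^ Suc ?k) * 3 ^ ?k"
  have "((\<lambda>x. (vinner (fst x) (u (fst x)) (pv Ds v x) / real (fst x))\<^sup>2) \<longlongrightarrow> 0) F"
  proof (rule tendsto_0_Markov[where r = "\<lambda>n. ?C * L * K * (1 / real n)"])
    fix n :: nat assume n: "n \<ge> 1"
    interpret g: goe P n "Z n" using goe[OF n] .
    have Dn: "\<forall>D\<in>set (map (\<lambda>D. D n) Ds). contraction n D" "map (\<lambda>D. D n) Ds \<noteq> []"
      using D ne by (auto simp: diag_seq_def)
    note * = g.second_moment_vinner_path_vec[OF Dn, of "u n" "v n"]
    show "integrable P (\<lambda>\<omega>. (vinner (fst (n, \<omega>)) (u (fst (n, \<omega>))) (pv Ds v (n, \<omega>)) / real (fst (n, \<omega>)))\<^sup>2)"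
      using *(1) by (simp add: power_divide)
    have "expectation (\<lambda>\<omega>. (vinner n (u n) (pv Ds v (n, \<omega>)))\<^sup>2) \<le> ?C * sqnorm n (u n) * sqnorm n (v n) / real n"
      using *(2) by (simp add: sqnorm_def)
    also have "\<dots> \<le> ?C * (L * real n) * (K * real n) / real n"
      using K L by (intro divide_right_mono mult_mono) auto
    finally have "expectation (\<lambda>\<omega>. (vinner n (u n) (pv Ds v (n, \<omega>)))\<^sup>2) / (real n)\<^sup>2 \<le> ?C * (L * real n) * (K * real n) / real n / (real n)\<^sup>2"
      by (intro divide_right_mono) auto
    also have "\<dots> = ?C * L * K * (1 / real n)" using n by (simp add: power2_eq_square)
    finally show "expectation (\<lambda>\<omega>. (vinner (fst (n, \<omega>)) (u (fst (n, \<omega>))) (pv Ds v (n, \<omega>)) / real (fst (n, \<omega>)))\<^sup>2) \<le> ?C * L * K * (1 / real n)"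
      by (simp add: power_divide)
  next
    show "(\<lambda>n. ?C * L * K * (1 / real n)) \<longlonglongrightarrow> 0"
      by (rule tendsto_mult_right_zero[OF lim_1_over_n])
  qed simp
  then have p: "((\<lambda>x. vinner (fst x) (u (fst x)) (pv Ds v x) / real (fst x)) \<longlongrightarrow> 0) F"
    by (rule tendsto_0_of_square)
  let ?d = "\<lambda>x i. fv Ds v x i - pv Ds v x i"
  \<comment> \<open>The final use takes the exponent 1; the smaller ones served the
    recursion.\<close>
  have "((\<lambda>x. sqnorm (fst x) (?d x) / real (fst x) powr 1) \<longlongrightarrow> 0) F"
    using small_free_minus_path[OF D v, unfolded small_def, rule_format, of 1] by simp
  then have "((\<lambda>x. sqnorm (fst x) (?d x) / real (fst x)) \<longlongrightarrow> 0) F" by simp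
  then have lim: "((\<lambda>x. L * (sqnorm (fst x) (?d x) / real (fst x))) \<longlongrightarrow> 0) F"
    by (rule tendsto_mult_right_zero)
  have "((\<lambda>x. (vinner (fst x) (u (fst x)) (?d x) / real (fst x))\<^sup>2) \<longlongrightarrow> 0) F"
  proof (rule tendsto_sandwich[OF _ _ tendsto_const lim])
    show "\<forall>\<^sub>F x in F. (vinner (fst x) (u (fst x)) (?d x) / real (fst x))\<^sup>2 \<le> L * (sqnorm (fst x) (?d x) / real (fst x))"
      using eventually_ge_1
    proof eventually_elim
      case (elim x)
      have "(vinner (fst x) (u (fst x)) (?d x))\<^sup>2 \<le> sqnorm (fst x) (u (fst x)) * sqnorm (fst x) (?d x)"
        by (rule vinner_Cauchy_Schwarz)
      also have "\<dots> \<le> L * real (fst x) * sqnorm (fst x) (?d x)" using L by (intro mult_right_mono) auto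
      finally have "(vinner (fst x) (u (fst x)) (?d x))\<^sup>2 / (real (fst x))\<^sup>2 \<le> L * real (fst x) * sqnorm (fst x) (?d x) / (real (fst x))\<^sup>2"
        by (intro divide_right_mono) auto
      then show ?case using elim by (simp add: power_divide power2_eq_square)
    qed
  qed simp
  then have d: "((\<lambda>x. vinner (fst x) (u (fst x)) (?d x) / real (fst x)) \<longlongrightarrow> 0) F"
    by (rule tendsto_0_of_square)
  have "vinner (fst x) (u (fst x)) (fv Ds v x) = vinner (fst x) (u (fst x)) (pv Ds v x) + vinner (fst x) (u (fst x)) (?d x)" for x
    by (subst vinner_add_right[symmetric]) simp
  then show ?thesis
    using tendsto_add[OF p d] by (simp add: add_divide_distrib)
qed

text \<open>The isometry relation \<open>\<ell>\<^sup>* A \<ell> = mean A\<close>. Moving one factor of the matrix across the inner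
  product turns the claim for \<open>D1 # w\<close> into an instance of the claim for \<open>w\<close>.\<close>

lemma vinner_free_vec_free_vec:
  assumes "\<forall>D\<in>set (D # A # D' # w @ w'). diag_seq D" and v: "vec_seq v" "vec_seq v'"
  shows "((\<lambda>x. (vinner (fst x) (fv (D # w) v x) (\<lambda>i. A (fst x) i * fv (D' # w') v' x i)
    - mean (fst x) (A (fst x)) * vinner (fst x) (\<lambda>i. D (fst x) i * fv w v x i) (\<lambda>i. D' (fst x) i * fv w' v' x i)) / real (fst x)) \<longlongrightarrow> 0) F"
  using assms(1)
proof (induction w arbitrary: D A D' w')
  case Nil
  \<comment> \<open>Moving the matrix to the right turns the right factor into a word with the extra
    letter \<open>A\<close> plus the annihilation term, which cancels the subtracted one. A
    deterministic vector against a nonempty word remains.\<close>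
  have eq: "vinner (fst x) (fv [D] v x) (\<lambda>i. A (fst x) i * fv (D' # w') v' x i)
    - mean (fst x) (A (fst x)) * vinner (fst x) (\<lambda>i. D (fst x) i * fv [] v x i) (\<lambda>i. D' (fst x) i * fv w' v' x i)
    = vinner (fst x) (\<lambda>i. D (fst x) i * v (fst x) i) (fv (A # D' # w') v' x)" for x
    by (simp add: vinner_matvec[OF Z_sym, symmetric] matvec_free_vec[abs_def] vinner_add_right vinner_scale_right
        del: free_vec.simps(3) cong: vinner_cong)
  show ?case
    unfolding eq using Nil v by (intro vinner_free_vec_tendsto_0[where u = "\<lambda>n i. D n i * v n i"] vec_seq_diag) auto
next
  case (Cons D1 w)
  \<comment> \<open>The letters pass from left to right: \<open>D\<close>, \<open>A\<close>,
    \<open>D'\<close>, \<open>w'\<close> become \<open>D1\<close>, \<open>D\<close>,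
    \<open>A\<close>, \<open>D' # w'\<close>. The annihilation term on the right cancels the
    subtracted term, and the one inside the left word becomes the term to subtract in the new
    instance.\<close>
  have eq: "vinner (fst x) (fv (D # D1 # w) v x) (\<lambda>i. A (fst x) i * fv (D' # w') v' x i)
    - mean (fst x) (A (fst x)) * vinner (fst x) (\<lambda>i. D (fst x) i * fv (D1 # w) v x i) (\<lambda>i. D' (fst x) i * fv w' v' x i)
    = vinner (fst x) (fv (D1 # w) v x) (\<lambda>i. D (fst x) i * fv (A # D' # w') v' x i)
    - mean (fst x) (D (fst x)) * vinner (fst x) (\<lambda>i. D1 (fst x) i * fv w v x i) (\<lambda>i. A (fst x) i * fv (D' # w') v' x i)" for x
  proof -
    let ?n = "fst x" and ?f = "fv (D' # w') v' x" and ?g = "fv (D1 # w) v x"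
    have "vinner ?n (fv (D # D1 # w) v x) (\<lambda>i. A ?n i * ?f i)
      = vinner ?n (matvec ?n (Zx x) (\<lambda>j. D ?n j * ?g j)) (\<lambda>i. A ?n i * ?f i)
       - mean ?n (D ?n) * vinner ?n (\<lambda>i. D1 ?n i * fv w v x i) (\<lambda>i. A ?n i * ?f i)"
    proof -
      have "fv (D # D1 # w) v x = (\<lambda>i. matvec ?n (Zx x) (\<lambda>j. D ?n j * ?g j) i - mean ?n (D ?n) * (D1 ?n i * fv w v x i))"
        by (simp add: fun_eq_iff)
      then show ?thesis by (simp only: vinner_diff_left vinner_scale_left)
    qed
    also have "vinner ?n (matvec ?n (Zx x) (\<lambda>j. D ?n j * ?g j)) (\<lambda>i. A ?n i * ?f i)
      = vinner ?n (\<lambda>j. D ?n j * ?g j) (matvec ?n (Zx x) (\<lambda>i. A ?n i * ?f i))"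
      by (rule vinner_matvec[symmetric]) (rule Z_sym)
    also have "matvec ?n (Zx x) (\<lambda>i. A ?n i * ?f i) = (\<lambda>i. fv (A # D' # w') v' x i + mean ?n (A ?n) * (D' ?n i * fv w' v' x i))"
      by (auto simp: fun_eq_iff)
    finally show ?thesis
      using vinner_diag[of ?n "D ?n" ?g "fv (A # D' # w') v' x"]
      by (simp add: vinner_add_right vinner_scale_right del: free_vec.simps)
  qed
  show ?case unfolding eq using Cons.prems by (intro Cons.IH) auto
qed

end

section \<open>Vectors created by the matrix\<close>

lemma vinner_add_left: "vinner n (\<lambda>i. y i + z i) x = vinner n y x + vinner n z x"
  by (simp add: vinner_def distrib_right sum.distrib)

lemma matvec_add: "matvec n A (\<lambda>j. x j + y j) i = matvec n A x i + matvec n A y i"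
  by (simp add: matvec_def distrib_left sum.distrib)

lemma matvec_scale: "matvec n A (\<lambda>j. c * x j) i = c * matvec n A x i"
  by (simp add: matvec_def sum_distrib_left mult.left_commute)

lemma matvec_cong: "(\<And>j. j < n \<Longrightarrow> x j = y j) \<Longrightarrow> matvec n A x i = matvec n A y i"
  by (simp add: matvec_def)

context goe_sequence
begin

text \<open>\<open>Rep h u\<close> expresses that \<open>u = \<ell> h\<close>.\<close>

inductive Rep :: "(nat \<times> 'w \<Rightarrow> nat \<Rightarrow> real) \<Rightarrow> (nat \<times> 'w \<Rightarrow> nat \<Rightarrow> real) \<Rightarrow> bool" where
  Rep_base: "diag_seq D \<Longrightarrow> \<forall>D\<in>set w. diag_seq D \<Longrightarrow> vec_seq v \<Longrightarrow>
    Rep (\<lambda>x i. D (fst x) i * fv w v x i) (fv (D # w) v)"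
| Rep_scale: "(c \<longlongrightarrow> l) F \<Longrightarrow> Rep h u \<Longrightarrow> Rep (\<lambda>x i. c x * h x i) (\<lambda>x i. c x * u x i)"
| Rep_add: "Rep h u \<Longrightarrow> Rep h' u' \<Longrightarrow> Rep (\<lambda>x i. h x i + h' x i) (\<lambda>x i. u x i + u' x i)"
| Rep_eq: "Rep h u \<Longrightarrow> (\<And>x i. fst x \<ge> 1 \<Longrightarrow> i < fst x \<Longrightarrow> h' x i = h x i) \<Longrightarrow>
    (\<And>x i. fst x \<ge> 1 \<Longrightarrow> i < fst x \<Longrightarrow> u' x i = u x i) \<Longrightarrow> Rep h' u'"

lemma tendsto_cong_ge_1:
  assumes "(f \<longlongrightarrow> l) F" and "\<And>x. fst x \<ge> 1 \<Longrightarrow> g x = f x"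
  shows "(g \<longlongrightarrow> l) F"
  using assms(1) by (rule Lim_transform_eventually)
    (use eventually_ge_1 assms(2) in \<open>auto elim!: eventually_mono\<close>)

lemma Rep_0: "Rep (\<lambda>x i. 0) (\<lambda>x i. 0)"
proof (rule Rep_eq[OF Rep_base[of "\<lambda>n i. 0" "[]" "\<lambda>n i. 0"]])
  show "diag_seq (\<lambda>n i. 0)" "vec_seq (\<lambda>n i. 0)"
    by (auto simp: diag_seq_def contraction_def vec_seq_def sqnorm_def intro: exI[of _ 0])
qed (auto simp: matvec_def)

lemma Rep_sum: "(\<And>s. s < (t::nat) \<Longrightarrow> Rep (h s) (u s)) \<Longrightarrow> Rep (\<lambda>x i. \<Sum>s<t. h s x i) (\<lambda>x i. \<Sum>s<t. u s x i)"
  by (induction t) (auto intro: Rep_0 Rep_add)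

text \<open>A random coefficient does no harm here: it converges, and it multiplies a quantity that
  tends to 0.\<close>

lemma Rep_vinner:
  assumes "Rep h u" and y: "vec_seq y"
  shows "((\<lambda>x. vinner (fst x) (y (fst x)) (u x) / real (fst x)) \<longlongrightarrow> 0) F"
  using assms(1)
proof induction
  case base: (Rep_base D w v)
  then show ?case using y by (intro vinner_free_vec_tendsto_0) auto
next
  case scale: (Rep_scale c l h u)
  have "((\<lambda>x. c x * (vinner (fst x) (y (fst x)) (u x) / real (fst x))) \<longlongrightarrow> l * 0) F"
    by (intro tendsto_mult scale)
  then show ?case by (simp add: vinner_scale_right)
next
  case add: (Rep_add h u h' u')
  then show ?case using tendsto_add[OF add.IH] by (simp add: vinner_add_right add_divide_distrib)
next
  case cong: (Rep_eq h u h' u')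
  have "vinner (fst x) (y (fst x)) (u' x) = vinner (fst x) (y (fst x)) (u x)" if "fst x \<ge> 1" for x
    using cong.hyps that by (intro vinner_cong) auto
  then show ?case by (intro tendsto_cong_ge_1[OF cong.IH]) auto
qed

text \<open>Linearity in the left argument alone: the right pair \<open>h0\<close>,
  \<open>u0\<close> is arbitrary, and a single word on the left is taken as hypothesis. This allows
  one use per argument in \<open>Rep_quadratic\<close>.\<close>

lemma Rep_quadratic_aux:
  assumes "Rep h u" and A: "diag_seq A"
    and h0: "\<And>D w v. diag_seq D \<Longrightarrow> \<forall>D\<in>set w. diag_seq D \<Longrightarrow> vec_seq v \<Longrightarrow>
      ((\<lambda>x. (vinner (fst x) (fv (D # w) v x) (\<lambda>i. A (fst x) i * u0 x i)
        - mean (fst x) (A (fst x)) * vinner (fst x) (\<lambda>i. D (fst x) i * fv w v x i) (h0 x)) / real (fst x)) \<longlongrightarrow> 0) F"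
  shows "((\<lambda>x. (vinner (fst x) (u x) (\<lambda>i. A (fst x) i * u0 x i)
        - mean (fst x) (A (fst x)) * vinner (fst x) (h x) (h0 x)) / real (fst x)) \<longlongrightarrow> 0) F"
  using assms(1)
proof induction
  case base: (Rep_base D w v)
  then show ?case by (rule h0)
next
  case scale: (Rep_scale c l h u)
  have "((\<lambda>x. c x * ((vinner (fst x) (u x) (\<lambda>i. A (fst x) i * u0 x i)
        - mean (fst x) (A (fst x)) * vinner (fst x) (h x) (h0 x)) / real (fst x))) \<longlongrightarrow> l * 0) F"
    by (intro tendsto_mult scale)
  then show ?case by (simp add: vinner_scale_left algebra_simps)
next
  case add: (Rep_add h u h' u')
  from tendsto_add[OF add.IH] show ?case
    by (simp add: vinner_add_left algebra_simps add_divide_distrib diff_divide_distrib)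
next
  case cong: (Rep_eq h u h' u')
  have "vinner (fst x) (u' x) (\<lambda>i. A (fst x) i * u0 x i) = vinner (fst x) (u x) (\<lambda>i. A (fst x) i * u0 x i)"
    "vinner (fst x) (h' x) (h0 x) = vinner (fst x) (h x) (h0 x)" if "fst x \<ge> 1" for x
    using cong.hyps that by (intro vinner_cong; auto)+
  then show ?case by (intro tendsto_cong_ge_1[OF cong.IH]) auto
qed

text \<open>The auxiliary lemma reduces the left argument to a word; after exchanging the factors it
  reduces the other one too, and two words are covered by
  \<open>vinner_free_vec_free_vec\<close>.\<close>

lemma Rep_quadratic:
  assumes hu: "Rep h u" and hu': "Rep h' u'" and A: "diag_seq A"
  shows "((\<lambda>x. (vinner (fst x) (u x) (\<lambda>i. A (fst x) i * u' x i)
        - mean (fst x) (A (fst x)) * vinner (fst x) (h x) (h' x)) / real (fst x)) \<longlongrightarrow> 0) F"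
proof (rule Rep_quadratic_aux[OF hu A])
  fix D w v assume D: "diag_seq D" "\<forall>D\<in>set w. diag_seq D" "vec_seq v"
  have e1: "vinner (fst x) (fv (D # w) v x) (\<lambda>i. A (fst x) i * u' x i) = vinner (fst x) (u' x) (\<lambda>i. A (fst x) i * fv (D # w) v x i)" for x
    by (simp only: vinner_def mult_ac)
  have e2: "vinner (fst x) (\<lambda>i. D (fst x) i * fv w v x i) (h' x) = vinner (fst x) (h' x) (\<lambda>i. D (fst x) i * fv w v x i)" for x
    by (rule vinner_commute)
  have "((\<lambda>x. (vinner (fst x) (u' x) (\<lambda>i. A (fst x) i * fv (D # w) v x i)
        - mean (fst x) (A (fst x)) * vinner (fst x) (h' x) (\<lambda>i. D (fst x) i * fv w v x i)) / real (fst x)) \<longlongrightarrow> 0) F"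
    using D A by (intro Rep_quadratic_aux[OF hu' A] vinner_free_vec_free_vec) auto
  then show "((\<lambda>x. (vinner (fst x) (fv (D # w) v x) (\<lambda>i. A (fst x) i * u' x i)
        - mean (fst x) (A (fst x)) * vinner (fst x) (\<lambda>i. D (fst x) i * fv w v x i) (h' x)) / real (fst x)) \<longlongrightarrow> 0) F"
    by (simp only: e1 e2)
qed

text \<open>For u created from h, annihilating E u returns mean(E) h. Subtracting that from the full
  product leaves the creation part alone.\<close>

lemma Rep_step:
  assumes "Rep h u" and E: "diag_seq E"
  shows "Rep (\<lambda>x i. E (fst x) i * u x i)
    (\<lambda>x i. matvec (fst x) (Zx x) (\<lambda>j. E (fst x) j * u x j) i - mean (fst x) (E (fst x)) * h x i)"
  using assms(1)
proof induction
  case base: (Rep_base D w v)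
  have "Rep (\<lambda>x i. E (fst x) i * fv (D # w) v x i) (fv (E # D # w) v)"
    using base E by (intro Rep_base) auto
  then show ?case by (rule Rep_eq) auto
next
  case scale: (Rep_scale c l h u)
  show ?case
    by (rule Rep_eq[OF Rep_scale[OF scale(1) scale.IH]])
      (simp_all add: matvec_scale[symmetric] algebra_simps)
next
  case add: (Rep_add h u h' u')
  show ?case
    by (rule Rep_eq[OF Rep_add[OF add.IH]]) (simp_all add: distrib_left matvec_add)
next
  case cong: (Rep_eq h u h' u')
  show ?case
  proof (rule Rep_eq[OF cong.IH])
    fix x :: "nat \<times> 'w" and i assume x: "fst x \<ge> 1" "i < fst x"
    show "E (fst x) i * u' x i = E (fst x) i * u x i" using cong.hyps x by simp
    have "matvec (fst x) (Zx x) (\<lambda>j. E (fst x) j * u' x j) i = matvec (fst x) (Zx x) (\<lambda>j. E (fst x) j * u x j) i"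
      using cong.hyps x by (intro matvec_cong) auto
    then show "matvec (fst x) (Zx x) (\<lambda>j. E (fst x) j * u' x j) i - mean (fst x) (E (fst x)) * h' x i =
      matvec (fst x) (Zx x) (\<lambda>j. E (fst x) j * u x j) i - mean (fst x) (E (fst x)) * h x i"
      using cong.hyps x by simp
  qed
qed

end

section \<open>Last update times, and unfolding of the algorithm and of the recursion for
  rho\<close>

lemma tau_Suc_True: "\<delta> t i \<Longrightarrow> tau \<delta> (Suc t) i = t"
  unfolding tau_def by (rule Max_eqI) auto

lemma tau_Suc_False: "\<not> \<delta> t i \<Longrightarrow> tau \<delta> (Suc t) i = tau \<delta> t i"
  unfolding tau_def by (rule arg_cong[of _ _ Max]) (auto simp: less_Suc_eq)

lemma tau_less: "\<delta> 0 i \<Longrightarrow> tau \<delta> (Suc t) i < Suc t"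
  by (induction t) (metis less_SucI less_Suc_eq tau_Suc_False tau_Suc_True)+

text \<open>The history list is only ever extended at its end, so an estimate can be read off from
  any later stage. Stage \<open>t\<close> already holds estimate \<open>Suc t\<close>, hence
  \<open>t + 2\<close> entries.\<close>

lemma AMP_nth: "s \<le> Suc t \<Longrightarrow> snd (AMP n M \<delta> h0 t) ! s = theta_hat n M \<delta> h0 s"
  and length_AMP: "length (snd (AMP n M \<delta> h0 t)) = Suc (Suc t)"
proof -
  have len: "length (snd (AMP n M \<delta> h0 t)) = Suc (Suc t)" for t
    by (induction t) (auto simp: Let_def split: prod.splits)
  show "length (snd (AMP n M \<delta> h0 t)) = Suc (Suc t)" by (rule len)
  have app: "\<exists>y. snd (AMP n M \<delta> h0 (Suc t)) = snd (AMP n M \<delta> h0 t) @ [y]" for t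
    by (auto simp: Let_def split: prod.splits)
  have mono: "snd (AMP n M \<delta> h0 (t + k)) ! s = snd (AMP n M \<delta> h0 t) ! s" if "s \<le> Suc t" for s t k
  proof (induction k)
    case (Suc k)
    obtain y where "snd (AMP n M \<delta> h0 (Suc (t + k))) = snd (AMP n M \<delta> h0 (t + k)) @ [y]" using app by blast
    then show ?case using Suc that len[of "t + k"] by (simp add: nth_append)
  qed simp
  show "snd (AMP n M \<delta> h0 t) ! s = theta_hat n M \<delta> h0 s" if "s \<le> Suc t"
  proof (cases "s \<le> t")
    case True
    then show ?thesis using mono[of s s "t - s"] by (simp add: theta_hat_def)
  next
    case False
    then have "s = Suc t" using that by simp
    then show ?thesis using mono[of s t 1] by (simp add: theta_hat_def)
  qed
qed

lemma theta_hat_0: "theta_hat n M \<delta> h0 0 = h0"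
  by (simp add: theta_hat_def Let_def)

lemma theta_hat_Suc: "theta_hat n M \<delta> h0 (Suc t) = renorm n (fst (AMP n M \<delta> h0 t))"
proof -
  have "snd (AMP n M \<delta> h0 t) ! Suc t = renorm n (fst (AMP n M \<delta> h0 t))"
    using length_AMP[of n M \<delta> h0 "t - 1"]
    by (cases t) (auto simp: Let_def nth_append split: prod.splits)
  then show ?thesis using AMP_nth[of "Suc t" t n M \<delta> h0] by simp
qed

lemma fst_AMP_0: "fst (AMP n M \<delta> h0 0) = matvec n M h0"
  by (simp add: Let_def)

lemma fst_AMP_Suc: "fst (AMP n M \<delta> h0 (Suc t)) i =
   (if \<delta> (Suc t) i then matvec n M (theta_hat n M \<delta> h0 (Suc t)) i
      - (\<Sum>s<Suc t. real (wts n \<delta> (Suc t) s) * theta_hat n M \<delta> h0 s i)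
         / (sqrt (real n) * vnorm n (fst (AMP n M \<delta> h0 t)))
    else fst (AMP n M \<delta> h0 t) i)"
proof -
  have 1: "snd (AMP n M \<delta> h0 t) ! Suc t = theta_hat n M \<delta> h0 (Suc t)" by (rule AMP_nth) simp
  have 2: "(\<Sum>s<Suc t. real (wts n \<delta> (Suc t) s) * (snd (AMP n M \<delta> h0 t) ! s) i)
      = (\<Sum>s<Suc t. real (wts n \<delta> (Suc t) s) * theta_hat n M \<delta> h0 s i)"
    by (intro sum.cong refl) (simp add: AMP_nth)
  show ?thesis
    unfolding 1[symmetric] 2[symmetric] by (simp add: Let_def split: prod.splits del: sum.lessThan_Suc)
qed

lemma length_rhos: "length (rhos lam r0 p t) = Suc t"
  by (induction t) (auto simp: Let_def)

lemma rhos_nth: "s \<le> t \<Longrightarrow> rhos lam r0 p t ! s = rho lam r0 p s"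
proof (induction t)
  case (Suc t)
  show ?case
  proof (cases "s = Suc t")
    case False
    then have "s \<le> t" using Suc by simp
    then show ?thesis using Suc length_rhos[of lam r0 p t] by (simp add: Let_def nth_append)
  qed (simp add: rho_def)
qed (simp add: rho_def)

lemma rho_0: "rho lam r0 p 0 = r0"
  by (simp add: rho_def)

lemma rho_Suc: "rho lam r0 p (Suc t) = lam * (\<Sum>s<Suc t. rho lam r0 p s * p (Suc t) s)
   / sqrt (\<Sum>s<Suc t. (lam\<^sup>2 * (rho lam r0 p s)\<^sup>2 + 1) * p (Suc t) s)"
proof -
  let ?r = "rhos lam r0 p t"
  have "rho lam r0 p (Suc t) = lam * (\<Sum>s<Suc t. ?r ! s * p (Suc t) s)
   / sqrt (\<Sum>s<Suc t. (lam\<^sup>2 * (?r ! s)\<^sup>2 + 1) * p (Suc t) s)"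
    using length_rhos[of lam r0 p t] by (simp add: rho_def Let_def nth_append del: sum.lessThan_Suc)
  also have "(\<Sum>s<Suc t. ?r ! s * p (Suc t) s) = (\<Sum>s<Suc t. rho lam r0 p s * p (Suc t) s)"
    by (intro sum.cong refl) (simp add: rhos_nth)
  also have "(\<Sum>s<Suc t. (lam\<^sup>2 * (?r ! s)\<^sup>2 + 1) * p (Suc t) s) = (\<Sum>s<Suc t. (lam\<^sup>2 * (rho lam r0 p s)\<^sup>2 + 1) * p (Suc t) s)"
    by (intro sum.cong refl) (simp add: rhos_nth)
  finally show ?thesis .
qed

section \<open>State evolution\<close>

text \<open>The Wasserstein hypotheses are reduced to four scalar limits. The same \<open>p\<close>
  appears for the counts and for the energy of theta on the masked coordinates; this is where
  independence of signal and update pattern is used.\<close>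

locale amp = goe_sequence P Z for P :: "'w measure" and Z :: "nat \<Rightarrow> 'w \<Rightarrow> nat \<Rightarrow> nat \<Rightarrow> real" +
  fixes \<theta> h0 :: "nat \<Rightarrow> nat \<Rightarrow> real" and \<delta> :: "nat \<Rightarrow> nat \<Rightarrow> nat \<Rightarrow> bool"
    and lam r0 :: real and p :: "nat \<Rightarrow> nat \<Rightarrow> real"
  assumes h0_norm: "\<And>n. n \<ge> 1 \<Longrightarrow> vnorm n (h0 n) = sqrt (real n)"
    and \<delta>0: "\<And>n i. n \<ge> 1 \<Longrightarrow> i < n \<Longrightarrow> \<delta> n 0 i"
    and \<theta>_lim: "(\<lambda>n. sqnorm n (\<theta> n) / real n) \<longlonglongrightarrow> 1"
    and \<theta>\<tau>_lim: "\<And>t s. s < Suc t \<Longrightarrow>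
      (\<lambda>n. (\<Sum>i<n. of_bool (tau (\<delta> n) (Suc t) i = s) * (\<theta> n i)\<^sup>2) / real n) \<longlonglongrightarrow> p (Suc t) s"
    and w_lim: "\<And>t s. s < Suc t \<Longrightarrow> (\<lambda>n. real (wts n (\<delta> n) (Suc t) s) / real n) \<longlonglongrightarrow> p (Suc t) s"
    and \<theta>h0_lim: "(\<lambda>n. vinner n (\<theta> n) (h0 n) / real n) \<longlonglongrightarrow> r0"
begin

text \<open>The masks. For fixed positive t they sum to one on each coordinate
  (\<open>sum_D\<close>), and their normalised traces are the Onsager weights divided by n
  (\<open>mean_D\<close>).\<close>

definition D :: "nat \<Rightarrow> nat \<Rightarrow> nat \<Rightarrow> nat \<Rightarrow> real" where
  "D t s n i = of_bool (tau (\<delta> n) t i = s)"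

abbreviation Mx :: "nat \<times> 'w \<Rightarrow> nat \<Rightarrow> nat \<Rightarrow> real" where
  "Mx x \<equiv> (\<lambda>i j. lam / real (fst x) * \<theta> (fst x) i * \<theta> (fst x) j + Zx x i j)"

abbreviation th :: "nat \<Rightarrow> nat \<times> 'w \<Rightarrow> nat \<Rightarrow> real" where
  "th t x \<equiv> theta_hat (fst x) (Mx x) (\<delta> (fst x)) (h0 (fst x)) t"

abbreviation xt :: "nat \<Rightarrow> nat \<times> 'w \<Rightarrow> nat \<Rightarrow> real" where
  "xt t x \<equiv> fst (AMP (fst x) (Mx x) (\<delta> (fst x)) (h0 (fst x)) t)"

definition overlap :: "nat \<Rightarrow> nat \<times> 'w \<Rightarrow> real" where
  "overlap t x = vinner (fst x) (\<theta> (fst x)) (th t x) / real (fst x)"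

definition kap :: "nat \<Rightarrow> nat \<times> 'w \<Rightarrow> real" where
  "kap t x = sqrt (real (fst x)) / vnorm (fst x) (xt t x)"

text \<open>The subtracted Onsager term is \<open>\<ell>\<^sup>*\<close> applied to \<open>th t\<close>, so that \<open>ut t\<close> is \<open>\<ell>\<close> applied to \<open>th t\<close>.\<close>

definition ut :: "nat \<Rightarrow> nat \<times> 'w \<Rightarrow> nat \<Rightarrow> real" where
  "ut t x i = matvec (fst x) (Zx x) (th t x) i -
     (case t of 0 \<Rightarrow> 0 | Suc r \<Rightarrow> kap r x * (\<Sum>s<t. mean (fst x) (D t s (fst x)) * th s x i))"

lemma diag_seq_D: "diag_seq (D t s)"
  by (auto simp: diag_seq_def contraction_def D_def)

lemma mean_D: "mean n (D t s n) = real (wts n (\<delta> n) t s) / real n"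
proof -
  have "(\<Sum>i<n. D t s n i) = real (card ({..<n} \<inter> {i. tau (\<delta> n) t i = s}))"
    unfolding D_def by (subst sum_of_bool_eq) auto
  also have "{..<n} \<inter> {i. tau (\<delta> n) t i = s} = {i. i < n \<and> tau (\<delta> n) t i = s}" by auto
  finally show ?thesis by (simp add: mean_def wts_def)
qed

lemma sum_D:
  assumes "n \<ge> 1" "i < n"
  shows "(\<Sum>s<Suc t. D (Suc t) s n i * f s) = f (tau (\<delta> n) (Suc t) i)"
proof -
  have "tau (\<delta> n) (Suc t) i < Suc t" using \<delta>0[OF assms] by (rule tau_less)
  moreover have "(\<Sum>s<Suc t. D (Suc t) s n i * f s) = (\<Sum>s<Suc t. if s = tau (\<delta> n) (Suc t) i then f s else 0)"
    unfolding D_def by (intro sum.cong refl) auto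
  ultimately show ?thesis by (simp add: sum.delta del: sum.lessThan_Suc)
qed

lemma p_nonneg: "s < Suc t \<Longrightarrow> p (Suc t) s \<ge> 0"
  by (rule tendsto_lowerbound[OF w_lim]) auto

text \<open>Inherited in the limit from the counts, which add up to n because every coordinate is
  updated at time 0.\<close>

lemma p_sum: "(\<Sum>s<Suc t. p (Suc t) s) = 1"
proof (rule LIMSEQ_unique)
  show "(\<lambda>n. \<Sum>s<Suc t. real (wts n (\<delta> n) (Suc t) s) / real n) \<longlonglongrightarrow> (\<Sum>s<Suc t. p (Suc t) s)"
    by (intro tendsto_sum w_lim) simp
  have "(\<Sum>s<Suc t. real (wts n (\<delta> n) (Suc t) s) / real n) = 1" if n: "n \<ge> 1" for n
  proof -
    have "(\<Sum>s<Suc t. real (wts n (\<delta> n) (Suc t) s) / real n) = (\<Sum>s<Suc t. \<Sum>i<n. D (Suc t) s n i * 1) / real n"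
      unfolding mean_D[symmetric] mean_def by (simp add: sum_divide_distrib del: sum.lessThan_Suc)
    also have "(\<Sum>s<Suc t. \<Sum>i<n. D (Suc t) s n i * 1) = (\<Sum>i<n. \<Sum>s<Suc t. D (Suc t) s n i * 1)"
      by (rule sum.swap)
    also have "\<dots> = real n" using sum_D[OF n, of _ t "\<lambda>_. 1"] by (simp del: sum.lessThan_Suc)
    finally show ?thesis using n by simp
  qed
  then show "(\<lambda>n. \<Sum>s<Suc t. real (wts n (\<delta> n) (Suc t) s) / real n) \<longlonglongrightarrow> 1"
    by (intro tendsto_eventually) (auto intro!: eventually_sequentiallyI[of 1] simp del: sum.lessThan_Suc)
qed

lemma vec_seq_\<theta>: "vec_seq \<theta>"
proof -
  have "Bseq (\<lambda>n. sqnorm n (\<theta> n) / real n)"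
    using \<theta>_lim by (intro convergent_imp_Bseq) (rule convergentI)
  then obtain K where K: "K > 0" "\<And>n. norm (sqnorm n (\<theta> n) / real n) \<le> K"
    by (elim BseqE) blast
  have "sqnorm n (\<theta> n) \<le> K * real n" for n
    using K(2)[of n] by (cases "n = 0") (auto simp: sqnorm_def field_simps)
  then show ?thesis using K(1) by (auto simp: vec_seq_def intro!: exI[of _ K])
qed

lemma vec_seq_h0: "vec_seq h0"
  unfolding vec_seq_def
proof (intro exI[of _ 1] conjI allI)
  fix n
  show "sqnorm n (h0 n) \<le> 1 * real n"
  proof (cases "n = 0")
    case False
    then have "sqrt (sqnorm n (h0 n)) = sqrt (real n)" using h0_norm[of n] by (simp add: vnorm_def sqnorm_def)
    then show ?thesis by simp
  qed (simp add: sqnorm_def)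
qed simp

lemma matvec_Mx:
  assumes "fst x \<ge> 1"
  shows "matvec (fst x) (Mx x) y i = lam * (vinner (fst x) (\<theta> (fst x)) y / real (fst x)) * \<theta> (fst x) i + matvec (fst x) (Zx x) y i"
proof -
  have "matvec (fst x) (Mx x) y i = (\<Sum>j<fst x. lam / real (fst x) * \<theta> (fst x) i * (\<theta> (fst x) j * y j) + Zx x i j * y j)"
    unfolding matvec_def by (intro sum.cong refl) (simp add: algebra_simps)
  also have "\<dots> = lam / real (fst x) * \<theta> (fst x) i * vinner (fst x) (\<theta> (fst x)) y + matvec (fst x) (Zx x) y i"
    by (simp only: sum.distrib sum_distrib_left[symmetric] vinner_def matvec_def)
  finally show ?thesis by simp
qed

text \<open>A coordinate stores what its last update produced. The time \<open>tau\<close> is taken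
  at \<open>Suc t\<close> because an update at time \<open>t\<close> itself counts.\<close>

lemma xt_eq:
  assumes x: "fst x \<ge> 1" and i: "i < fst x"
  shows "xt t x i = lam * overlap (tau (\<delta> (fst x)) (Suc t) i) x * \<theta> (fst x) i + ut (tau (\<delta> (fst x)) (Suc t) i) x i"
proof (induction t)
  case 0
  have "tau (\<delta> (fst x)) (Suc 0) i = 0" using \<delta>0[OF x i] by (rule tau_Suc_True)
  then show ?case unfolding fst_AMP_0 matvec_Mx[OF x] by (simp add: overlap_def ut_def theta_hat_0)
next
  case (Suc t)
  show ?case
  proof (cases "\<delta> (fst x) (Suc t) i")
    case True
    \<comment> \<open>The denominator contains sqrt n times the norm of the previous iterate, so
      each weight w turns into \<open>kap t\<close> times w/n, the mean of a mask.\<close>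
    have ons: "(\<Sum>s<Suc t. real (wts (fst x) (\<delta> (fst x)) (Suc t) s) * th s x i) / (sqrt (real (fst x)) * vnorm (fst x) (xt t x))
      = kap t x * (\<Sum>s<Suc t. mean (fst x) (D (Suc t) s (fst x)) * th s x i)"
    proof -
      have n: "sqrt (real (fst x)) * sqrt (real (fst x)) = real (fst x)" "sqrt (real (fst x)) > 0" using x by auto
      then have *: "1 / (sqrt (real (fst x)) * vnorm (fst x) (xt t x)) = kap t x / real (fst x)"
        unfolding kap_def by (metis (no_types, lifting) divide_divide_eq_left divide_self_if less_irrefl mult.commute nonzero_divide_mult_cancel_left)
      have "(\<Sum>s<Suc t. real (wts (fst x) (\<delta> (fst x)) (Suc t) s) * th s x i) / (sqrt (real (fst x)) * vnorm (fst x) (xt t x))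
        = (\<Sum>s<Suc t. real (wts (fst x) (\<delta> (fst x)) (Suc t) s) * th s x i) * (1 / (sqrt (real (fst x)) * vnorm (fst x) (xt t x)))"
        by simp
      also have "\<dots> = kap t x * (\<Sum>s<Suc t. mean (fst x) (D (Suc t) s (fst x)) * th s x i)"
        unfolding * mean_D sum_distrib_left sum_distrib_right by (intro sum.cong refl) simp
      finally show ?thesis .
    qed
    have tau: "tau (\<delta> (fst x)) (Suc (Suc t)) i = Suc t" using True by (rule tau_Suc_True)
    show ?thesis
      unfolding tau fst_AMP_Suc ons matvec_Mx[OF x] using True by (simp add: overlap_def ut_def del: sum.lessThan_Suc)
  next
    case False
    then show ?thesis
      unfolding fst_AMP_Suc tau_Suc_False[of "\<delta> (fst x)", OF False] using Suc by (simp only: if_False)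
  qed
qed

text \<open>Arranged as scalars times masked theta and scalars times masked \<open>ut s\<close>, the
  two shapes on which creation is known: a word of one letter, and \<open>Rep_step\<close>.\<close>

lemma th_Suc:
  assumes x: "fst x \<ge> 1" and i: "i < fst x"
  shows "th (Suc t) x i = (\<Sum>s<Suc t. kap t x * (lam * overlap s x) * (D (Suc t) s (fst x) i * \<theta> (fst x) i)
     + kap t x * (D (Suc t) s (fst x) i * ut s x i))"
proof -
  have "th (Suc t) x i = kap t x * xt t x i" by (simp add: theta_hat_Suc renorm_def kap_def)
  also have "xt t x i = (\<Sum>s<Suc t. D (Suc t) s (fst x) i * (lam * overlap s x * \<theta> (fst x) i + ut s x i))"
    unfolding xt_eq[OF x i] using sum_D[OF x i, of t "\<lambda>s. lam * overlap s x * \<theta> (fst x) i + ut s x i"] by simp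
  finally show ?thesis
    unfolding sum_distrib_left by (simp add: algebra_simps del: sum.lessThan_Suc)
qed

text \<open>Creation is applied to \<open>th_Suc\<close> term by term. The terms subtracted by
  \<open>Rep_step\<close> are \<open>kap t\<close> times mean times \<open>th s\<close>, and they
  add up to precisely the Onsager term inside \<open>ut (Suc t)\<close>.\<close>

lemma Rep_Suc:
  assumes IH: "\<And>s. s \<le> t \<Longrightarrow> Rep (th s) (ut s)" "\<And>s. s \<le> t \<Longrightarrow> (overlap s \<longlongrightarrow> rho lam r0 p s) F"
    and kap: "(kap t \<longlongrightarrow> k) F"
  shows "Rep (th (Suc t)) (ut (Suc t))"
proof (rule Rep_eq)
  let ?c = "\<lambda>s x. kap t x * (lam * overlap s x)"
  let ?n = "fst :: nat \<times> 'w \<Rightarrow> nat"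
  show "Rep (\<lambda>x i. \<Sum>s<Suc t. ?c s x * (D (Suc t) s (?n x) i * fv [] \<theta> x i) + kap t x * (D (Suc t) s (?n x) i * ut s x i))
    (\<lambda>x i. \<Sum>s<Suc t. ?c s x * fv [D (Suc t) s] \<theta> x i +
      kap t x * (matvec (?n x) (Zx x) (\<lambda>j. D (Suc t) s (?n x) j * ut s x j) i - mean (?n x) (D (Suc t) s (?n x)) * th s x i))"
  proof (intro Rep_sum Rep_add)
    fix s assume "s < Suc t"
    then have s: "s \<le> t" by simp
    have "(?c s \<longlongrightarrow> k * (lam * rho lam r0 p s)) F" by (intro tendsto_intros kap IH s)
    then show "Rep (\<lambda>x i. ?c s x * (D (Suc t) s (?n x) i * fv [] \<theta> x i)) (\<lambda>x i. ?c s x * fv [D (Suc t) s] \<theta> x i)"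
      by (intro Rep_scale Rep_base diag_seq_D vec_seq_\<theta>) auto
    show "Rep (\<lambda>x i. kap t x * (D (Suc t) s (?n x) i * ut s x i))
      (\<lambda>x i. kap t x * (matvec (?n x) (Zx x) (\<lambda>j. D (Suc t) s (?n x) j * ut s x j) i - mean (?n x) (D (Suc t) s (?n x)) * th s x i))"
      by (intro Rep_scale[OF kap] Rep_step IH s diag_seq_D)
  qed
  fix x :: "nat \<times> 'w" and i assume x: "fst x \<ge> 1" "i < fst x"
  show "th (Suc t) x i = (\<Sum>s<Suc t. ?c s x * (D (Suc t) s (?n x) i * fv [] \<theta> x i) + kap t x * (D (Suc t) s (?n x) i * ut s x i))"
    using th_Suc[OF x] by simp
  have "matvec (?n x) (Zx x) (th (Suc t) x) i = matvec (?n x) (Zx x) (\<lambda>i. \<Sum>s<Suc t. ?c s x * (D (Suc t) s (fst x) i * \<theta> (fst x) i)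
     + kap t x * (D (Suc t) s (fst x) i * ut s x i)) i"
    using th_Suc[OF x(1)] by (rule matvec_cong)
  also have "\<dots> = (\<Sum>s<Suc t. matvec (?n x) (Zx x) (\<lambda>i. ?c s x * (D (Suc t) s (fst x) i * \<theta> (fst x) i)
     + kap t x * (D (Suc t) s (fst x) i * ut s x i)) i)"
    unfolding matvec_def sum_distrib_left by (rule sum.swap)
  also have "\<dots> = (\<Sum>s<Suc t. ?c s x * matvec (?n x) (Zx x) (\<lambda>i. D (Suc t) s (fst x) i * \<theta> (fst x) i) i
     + kap t x * matvec (?n x) (Zx x) (\<lambda>i. D (Suc t) s (fst x) i * ut s x i) i)"
    unfolding matvec_add matvec_scale ..
  finally show "ut (Suc t) x i = (\<Sum>s<Suc t. ?c s x * fv [D (Suc t) s] \<theta> x i +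
      kap t x * (matvec (?n x) (Zx x) (\<lambda>j. D (Suc t) s (?n x) j * ut s x j) i - mean (?n x) (D (Suc t) s (?n x)) * th s x i))"
    unfolding ut_def[of "Suc t"] nat.case sum_distrib_left
    by (simp add: right_diff_distrib sum.distrib sum_subtractf add_diff_eq del: sum.lessThan_Suc)
qed

text \<open>Splitting the coordinates by their last update time expands the overlap and the squared
  norm of the iterate into \<open>?T\<close>, \<open>?I\<close>, \<open>?Q\<close>: energy of theta
  on a mask, cross term, and energy of the created part on a mask. The limit of the normalised
  squared norm is \<open>c\<close>.\<close>

lemma limits_Suc:
  assumes rep: "\<And>s. s \<le> t \<Longrightarrow> Rep (th s) (ut s)" and ov: "\<And>s. s \<le> t \<Longrightarrow> (overlap s \<longlongrightarrow> rho lam r0 p s) F"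
    and nrm: "\<And>s. s \<le> t \<Longrightarrow> ((\<lambda>x. sqnorm (fst x) (th s x) / real (fst x)) \<longlongrightarrow> 1) F"
  defines "c \<equiv> \<Sum>s<Suc t. (lam\<^sup>2 * (rho lam r0 p s)\<^sup>2 + 1) * p (Suc t) s"
  shows "c > 0" and "(kap t \<longlongrightarrow> 1 / sqrt c) F" and "(overlap (Suc t) \<longlongrightarrow> rho lam r0 p (Suc t)) F"
    and "((\<lambda>x. sqnorm (fst x) (th (Suc t) x) / real (fst x)) \<longlongrightarrow> 1) F"
proof -
  let ?T = "\<lambda>s x. (\<Sum>i<fst x. D (Suc t) s (fst x) i * (\<theta> (fst x) i)\<^sup>2) / real (fst x)"
  let ?I = "\<lambda>s x. vinner (fst x) (\<lambda>i. D (Suc t) s (fst x) i * \<theta> (fst x) i) (ut s x) / real (fst x)"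
  let ?Q = "\<lambda>s x. vinner (fst x) (ut s x) (\<lambda>i. D (Suc t) s (fst x) i * ut s x i) / real (fst x)"
  have T: "(?T s \<longlongrightarrow> p (Suc t) s) F" if "s < Suc t" for s
    using tendsto_deterministic[OF \<theta>\<tau>_lim[OF that]] by (simp add: D_def)
  have I: "(?I s \<longlongrightarrow> 0) F" if "s < Suc t" for s
    using that by (intro Rep_vinner[OF rep, where y = "\<lambda>n i. D (Suc t) s n i * \<theta> n i"] vec_seq_diag diag_seq_D vec_seq_\<theta>) auto
  \<comment> \<open>The quadratic form is asymptotically the mean of the mask times the squared norm
    of \<open>th s\<close>, which is normalised to n.\<close>
  have Q: "(?Q s \<longlongrightarrow> p (Suc t) s) F" if s: "s < Suc t" for s
  proof -
    have m: "((\<lambda>x. mean (fst x) (D (Suc t) s (fst x))) \<longlongrightarrow> p (Suc t) s) F"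
      unfolding mean_D by (rule tendsto_deterministic[OF w_lim[OF s]])
    have r: "Rep (th s) (ut s)" using s by (intro rep) simp
    have "((\<lambda>x. (vinner (fst x) (ut s x) (\<lambda>i. D (Suc t) s (fst x) i * ut s x i)
        - mean (fst x) (D (Suc t) s (fst x)) * vinner (fst x) (th s x) (th s x)) / real (fst x)
        + mean (fst x) (D (Suc t) s (fst x)) * (sqnorm (fst x) (th s x) / real (fst x))) \<longlongrightarrow> 0 + p (Suc t) s * 1) F"
      using s by (intro tendsto_add tendsto_mult m nrm Rep_quadratic[OF r r diag_seq_D]) auto
    then show ?thesis by (simp add: sqnorm_eq_vinner diff_divide_distrib)
  qed
  \<comment> \<open>As the \<open>p (Suc t) s\<close> sum to 1, the created part contributes exactly
    1. Hence \<open>c\<close> stays away from 0 and the normalisation converges, whatever the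
    overlaps are.\<close>
  have "c = (\<Sum>s<Suc t. lam\<^sup>2 * (rho lam r0 p s)\<^sup>2 * p (Suc t) s) + 1"
    unfolding c_def using p_sum[of t] by (simp only: distrib_right sum.distrib mult_1)
  moreover have "0 \<le> (\<Sum>s<Suc t. lam\<^sup>2 * (rho lam r0 p s)\<^sup>2 * p (Suc t) s)"
    by (intro sum_nonneg mult_nonneg_nonneg p_nonneg) auto
  ultimately show c: "c > 0" by linarith

  let ?X1 = "\<lambda>x. vinner (fst x) (\<theta> (fst x)) (xt t x) / real (fst x)"
  let ?X2 = "\<lambda>x. sqnorm (fst x) (xt t x) / real (fst x)"
  have "((\<lambda>x. \<Sum>s<Suc t. lam * overlap s x * ?T s x + ?I s x) \<longlongrightarrow> (\<Sum>s<Suc t. lam * rho lam r0 p s * p (Suc t) s + 0)) F"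
    by (intro tendsto_intros T I ov) auto
  then have X1: "(?X1 \<longlongrightarrow> lam * (\<Sum>s<Suc t. rho lam r0 p s * p (Suc t) s)) F"
  proof (rule tendsto_cong_ge_1[THEN tendsto_eq_rhs])
    fix x :: "nat \<times> 'w" assume x: "fst x \<ge> 1"
    have "vinner (fst x) (\<theta> (fst x)) (xt t x) = (\<Sum>i<fst x. \<Sum>s<Suc t. D (Suc t) s (fst x) i * (\<theta> (fst x) i * (lam * overlap s x * \<theta> (fst x) i + ut s x i)))"
      unfolding vinner_def
    proof (intro sum.cong refl)
      fix i assume "i \<in> {..<fst x}"
      then have i: "i < fst x" by simp
      show "\<theta> (fst x) i * xt t x i = (\<Sum>s<Suc t. D (Suc t) s (fst x) i * (\<theta> (fst x) i * (lam * overlap s x * \<theta> (fst x) i + ut s x i)))"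
        unfolding sum_D[OF x i] xt_eq[OF x i] ..
    qed
    also have "\<dots> = (\<Sum>s<Suc t. \<Sum>i<fst x. D (Suc t) s (fst x) i * (\<theta> (fst x) i * (lam * overlap s x * \<theta> (fst x) i + ut s x i)))"
      by (rule sum.swap)
    also have "\<dots> = (\<Sum>s<Suc t. lam * overlap s x * (\<Sum>i<fst x. D (Suc t) s (fst x) i * (\<theta> (fst x) i)\<^sup>2) + vinner (fst x) (\<lambda>i. D (Suc t) s (fst x) i * \<theta> (fst x) i) (ut s x))"
      unfolding vinner_def sum_distrib_left sum.distrib[symmetric]
      by (intro sum.cong refl) (simp add: algebra_simps power2_eq_square)
    finally have eq: "vinner (fst x) (\<theta> (fst x)) (xt t x) = \<dots>" .
    show "?X1 x = (\<Sum>s<Suc t. lam * overlap s x * ?T s x + ?I s x)"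
      unfolding eq sum_divide_distrib[of _ "{..<Suc t}"]
      by (intro sum.cong refl) (simp add: add_divide_distrib)
  qed (simp add: sum_distrib_left mult.assoc del: sum.lessThan_Suc)
  have "((\<lambda>x. \<Sum>s<Suc t. (lam * overlap s x)\<^sup>2 * ?T s x + 2 * (lam * overlap s x) * ?I s x + ?Q s x)
     \<longlongrightarrow> (\<Sum>s<Suc t. (lam * rho lam r0 p s)\<^sup>2 * p (Suc t) s + 2 * (lam * rho lam r0 p s) * 0 + p (Suc t) s)) F"
    by (intro tendsto_intros T I Q ov) auto
  then have X2: "(?X2 \<longlongrightarrow> c) F"
  proof (rule tendsto_cong_ge_1[THEN tendsto_eq_rhs])
    fix x :: "nat \<times> 'w" assume x: "fst x \<ge> 1"
    have "sqnorm (fst x) (xt t x) = (\<Sum>i<fst x. \<Sum>s<Suc t. D (Suc t) s (fst x) i * (lam * overlap s x * \<theta> (fst x) i + ut s x i)\<^sup>2)"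
      unfolding sqnorm_def
    proof (intro sum.cong refl)
      fix i assume "i \<in> {..<fst x}"
      then have i: "i < fst x" by simp
      show "(xt t x i)\<^sup>2 = (\<Sum>s<Suc t. D (Suc t) s (fst x) i * (lam * overlap s x * \<theta> (fst x) i + ut s x i)\<^sup>2)"
        unfolding sum_D[OF x i] xt_eq[OF x i] ..
    qed
    also have "\<dots> = (\<Sum>s<Suc t. \<Sum>i<fst x. D (Suc t) s (fst x) i * (lam * overlap s x * \<theta> (fst x) i + ut s x i)\<^sup>2)"
      by (rule sum.swap)
    also have "\<dots> = (\<Sum>s<Suc t. (lam * overlap s x)\<^sup>2 * (\<Sum>i<fst x. D (Suc t) s (fst x) i * (\<theta> (fst x) i)\<^sup>2)
        + 2 * (lam * overlap s x) * vinner (fst x) (\<lambda>i. D (Suc t) s (fst x) i * \<theta> (fst x) i) (ut s x)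
        + vinner (fst x) (ut s x) (\<lambda>i. D (Suc t) s (fst x) i * ut s x i))"
      unfolding vinner_def sum_distrib_left sum.distrib[symmetric]
      by (intro sum.cong refl) (simp add: algebra_simps power2_eq_square)
    finally have eq: "sqnorm (fst x) (xt t x) = \<dots>" .
    show "?X2 x = (\<Sum>s<Suc t. (lam * overlap s x)\<^sup>2 * ?T s x + 2 * (lam * overlap s x) * ?I s x + ?Q s x)"
      unfolding eq sum_divide_distrib[of _ "{..<Suc t}"]
      by (intro sum.cong refl) (simp add: add_divide_distrib)
  qed (simp add: c_def power_mult_distrib distrib_right del: sum.lessThan_Suc)

  have kap_eq: "kap t x = 1 / sqrt (?X2 x)" if "fst x \<ge> 1" for x
    unfolding kap_def vnorm_def sqnorm_def[symmetric] by (simp add: real_sqrt_divide)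
  have "((\<lambda>x. 1 / sqrt (?X2 x)) \<longlongrightarrow> 1 / sqrt c) F"
    using c by (intro tendsto_intros X2) auto
  then show kap: "(kap t \<longlongrightarrow> 1 / sqrt c) F" by (rule tendsto_cong_ge_1) (rule kap_eq)
  have th: "th (Suc t) x = (\<lambda>i. kap t x * xt t x i)" for x
    by (simp add: theta_hat_Suc renorm_def kap_def fun_eq_iff)
  have "overlap (Suc t) = (\<lambda>x. kap t x * ?X1 x)"
    unfolding overlap_def[abs_def] th vinner_scale_right by simp
  moreover have "((\<lambda>x. kap t x * ?X1 x) \<longlongrightarrow> 1 / sqrt c * (lam * (\<Sum>s<Suc t. rho lam r0 p s * p (Suc t) s))) F"
    by (intro tendsto_mult kap X1)
  moreover have "1 / sqrt c * (lam * (\<Sum>s<Suc t. rho lam r0 p s * p (Suc t) s)) = rho lam r0 p (Suc t)"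
    unfolding rho_Suc c_def by (simp del: sum.lessThan_Suc)
  ultimately show "(overlap (Suc t) \<longlongrightarrow> rho lam r0 p (Suc t)) F" by (simp only: )
  have "sqnorm (fst x) (th (Suc t) x) / real (fst x) = (kap t x)\<^sup>2 * ?X2 x" for x
    unfolding th sqnorm_def power_mult_distrib sum_distrib_left[symmetric] by simp
  moreover have "((\<lambda>x. (kap t x)\<^sup>2 * ?X2 x) \<longlongrightarrow> (1 / sqrt c)\<^sup>2 * c) F"
    by (intro tendsto_intros kap X2)
  moreover have "(1 / sqrt c)\<^sup>2 * c = 1" using c by (simp add: power_divide)
  ultimately show "((\<lambda>x. sqnorm (fst x) (th (Suc t) x) / real (fst x)) \<longlongrightarrow> 1) F" by (simp only: )
qed

text \<open>The three claims need each other: the norms enter the limit of \<open>kap\<close>, that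
  limit makes the coefficients of the next estimate admissible in \<open>Rep\<close>, and
  \<open>Rep\<close> yields the next overlap and norm. At time 0 the initial vector is an empty word
  behind the identity mask.\<close>

lemma state_evolution:
  "Rep (th t) (ut t) \<and> (overlap t \<longlongrightarrow> rho lam r0 p t) F \<and> ((\<lambda>x. sqnorm (fst x) (th t x) / real (fst x)) \<longlongrightarrow> 1) F"
proof (induction t rule: less_induct)
  case (less t)
  show ?case
  proof (cases t)
    case 0
    have "Rep (th 0) (ut 0)"
    proof (rule Rep_eq[OF Rep_base[of "\<lambda>n i. 1" "[]" h0]])
      show "diag_seq (\<lambda>n i. 1)" by (simp add: diag_seq_def contraction_def)
    qed (auto simp: theta_hat_0 ut_def vec_seq_h0)
    moreover have "(overlap 0 \<longlongrightarrow> rho lam r0 p 0) F"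
      using tendsto_deterministic[OF \<theta>h0_lim] by (simp add: overlap_def[abs_def] theta_hat_0 rho_0)
    moreover have "((\<lambda>x. sqnorm (fst x) (th 0 x) / real (fst x)) \<longlongrightarrow> 1) F"
    proof (rule tendsto_cong_ge_1[OF tendsto_const])
      fix x :: "nat \<times> 'w" assume x: "fst x \<ge> 1"
      then have "sqrt (sqnorm (fst x) (h0 (fst x))) = sqrt (real (fst x))"
        using h0_norm[of "fst x"] by (simp add: vnorm_def sqnorm_def)
      then show "sqnorm (fst x) (th 0 x) / real (fst x) = 1" using x by (simp add: theta_hat_0)
    qed
    ultimately show ?thesis using 0 by simp
  next
    case (Suc r)
    then have IH: "Rep (th s) (ut s)" "(overlap s \<longlongrightarrow> rho lam r0 p s) F"
      "((\<lambda>x. sqnorm (fst x) (th s x) / real (fst x)) \<longlongrightarrow> 1) F" if "s \<le> r" for s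
      using less.IH[of s] that by auto
    show ?thesis
      unfolding Suc using limits_Suc[OF IH] Rep_Suc[OF IH(1,2)] by blast
  qed
qed

end

section \<open>Consequences of Wasserstein convergence\<close>

lemma measurable_coordinates [measurable]:
  "(\<lambda>z. fst (fst z)) \<in> borel_measurable (Xsp t)"
  "(\<lambda>z. snd (fst z)) \<in> borel_measurable (Xsp t)"
  and measurable_string: "snd \<in> measurable (Xsp t) (PiM {..t} (\<lambda>_. count_space UNIV))"
  unfolding Xsp_def borel_prod[symmetric] by measurable

lemma measurable_bit: "s \<le> t \<Longrightarrow> (\<lambda>z. of_bool (snd z s) :: real) \<in> borel_measurable (Xsp t)"
proof -
  assume "s \<le> t"
  then have "(\<lambda>b. b s) \<in> measurable (PiM {..t} (\<lambda>_. count_space UNIV)) (count_space (UNIV::bool set))"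
    by (intro measurable_component_singleton) auto
  from measurable_compose[OF measurable_string this, THEN measurable_compose, of "of_bool :: bool \<Rightarrow> real" borel]
  show ?thesis by simp
qed

lemma measurable_cost: "(\<lambda>z. cost t (fst z) (snd z)) \<in> borel_measurable (Xsp t \<Otimes>\<^sub>M Xsp t)"
proof -
  have bit: "(\<lambda>z. of_bool (snd (fst z) s) :: real) \<in> borel_measurable (Xsp t \<Otimes>\<^sub>M Xsp t)"
    "(\<lambda>z. of_bool (snd (snd z) s) :: real) \<in> borel_measurable (Xsp t \<Otimes>\<^sub>M Xsp t)" if "s \<le> t" for s
    using measurable_compose[OF measurable_fst measurable_bit[OF that]]
      measurable_compose[OF measurable_snd measurable_bit[OF that]] by auto
  show ?thesis
    unfolding cost_def
    by (intro borel_measurable_add borel_measurable_power borel_measurable_diff borel_measurable_sum bit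
        measurable_compose[OF measurable_fst measurable_coordinates(1)] measurable_compose[OF measurable_snd measurable_coordinates(1)]
        measurable_compose[OF measurable_fst measurable_coordinates(2)] measurable_compose[OF measurable_snd measurable_coordinates(2)]) auto
qed

lemma cost_nonneg: "0 \<le> cost t z z'"
  unfolding cost_def by (intro add_nonneg_nonneg sum_nonneg) auto

lemma space_Xsp: "space (Xsp t) = UNIV \<times> ({..t} \<rightarrow>\<^sub>E UNIV)"
  by (simp add: Xsp_def space_pair_measure space_PiM)

lemma sets_emp: "sets (emp n t \<theta> h0 \<delta>) = sets (Xsp t)"
  by (simp add: emp_def)

lemma emp_point_measurable:
  "(\<lambda>i. ((\<theta> i, h0 i), restrict (\<lambda>s. \<delta> s i) {..t})) \<in> measurable (measure_pmf q) (Xsp t)"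
  by (rule measurableI) (auto simp: space_Xsp)

lemma integral_emp:
  assumes f: "f \<in> borel_measurable (Xsp t)" and n: "n \<ge> 1"
  shows "integral\<^sup>L (emp n t \<theta> h0 \<delta>) f = (\<Sum>i<n. f ((\<theta> i, h0 i), restrict (\<lambda>s. \<delta> s i) {..t})) / real n"
    and "integrable (emp n t \<theta> h0 \<delta>) f"
proof -
  have fin: "finite (set_pmf (pmf_of_set {..<n}))" "{..<n} \<noteq> {}" using n by (auto simp: lessThan_empty_iff)
  show "integral\<^sup>L (emp n t \<theta> h0 \<delta>) f = (\<Sum>i<n. f ((\<theta> i, h0 i), restrict (\<lambda>s. \<delta> s i) {..t})) / real n"
    unfolding emp_def using fin
    by (subst integral_distr[OF emp_point_measurable f]) (simp add: integral_pmf_of_set)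
  show "integrable (emp n t \<theta> h0 \<delta>) f"
    unfolding emp_def using fin
    by (subst integrable_distr_eq[OF emp_point_measurable f]) (rule integrable_measure_pmf_finite)
qed

text \<open>Integrate the assumed inequality against a nearly optimal coupling: the cost is small by
  convergence, and \<open>g\<close> depends on the limiting point only, so its integral does not
  change with n. This admits functions of quadratic growth.\<close>

lemma W2_empirical_limit:
  fixes f :: "(real \<times> real) \<times> (nat \<Rightarrow> bool) \<Rightarrow> real"
  assumes W2: "(\<lambda>n. W2sq (cost t) (emp n t (\<theta> n) (h0 n) (\<delta> n)) L) \<longlonglongrightarrow> 0"
    and L: "sets L = sets (Xsp t)"
    and f: "f \<in> borel_measurable (Xsp t)" "integrable L f"
    and bound: "\<And>e. e > 0 \<Longrightarrow> \<exists>C\<ge>0. \<exists>g. integrable L g \<and> (\<integral>z. g z \<partial>L) \<le> e \<and>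
       (\<forall>z z'. \<bar>f z - f z'\<bar> \<le> C * cost t z z' + g z')"
  shows "(\<lambda>n. (\<Sum>i<n. f ((\<theta> n i, h0 n i), restrict (\<lambda>s. \<delta> n s i) {..t})) / real n) \<longlonglongrightarrow> (\<integral>z. f z \<partial>L)"
proof (rule tendstoI)
  fix e :: real assume e: "e > 0"
  obtain C g where C: "C \<ge> 0" and g: "integrable L g" "(\<integral>z. g z \<partial>L) \<le> e / 3"
    and le: "\<And>z z'. \<bar>f z - f z'\<bar> \<le> C * cost t z z' + g z'"
    using bound[of "e / 3"] e by auto
  \<comment> \<open>Chosen so that C times the cost is at most e/3; C + 1 keeps the quotient defined
    for C = 0.\<close>
  let ?r = "e / (3 * (C + 1))"
  have r: "?r > 0" using e C by simp
  then have "\<forall>\<^sub>F n in sequentially. W2sq (cost t) (emp n t (\<theta> n) (h0 n) (\<delta> n)) L < ennreal ?r"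
    using W2 by (intro order_tendstoD) auto
  then show "\<forall>\<^sub>F n in sequentially. dist ((\<Sum>i<n. f ((\<theta> n i, h0 n i), restrict (\<lambda>s. \<delta> n s i) {..t})) / real n) (\<integral>z. f z \<partial>L) < e"
    using eventually_ge_at_top[of 1]
  proof eventually_elim
    case (elim n)
    let ?E = "emp n t (\<theta> n) (h0 n) (\<delta> n)"
    obtain \<pi> where \<pi>: "\<pi> \<in> couplings ?E L" and small: "(\<integral>\<^sup>+ z. ennreal (cost t (fst z) (snd z)) \<partial>\<pi>) < ennreal ?r"
      using elim(1) unfolding W2sq_def INF_less_iff by blast
    have sets: "sets \<pi> = sets (?E \<Otimes>\<^sub>M L)" and prob: "prob_space \<pi>"
      and d1: "distr \<pi> ?E fst = ?E" and d2: "distr \<pi> L snd = L"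
      using \<pi> by (auto simp: couplings_def)
    have sets': "sets \<pi> = sets (Xsp t \<Otimes>\<^sub>M Xsp t)"
      unfolding sets by (intro sets_pair_measure_cong sets_emp L)
    have m1: "fst \<in> measurable \<pi> ?E" and m2: "snd \<in> measurable \<pi> L"
      using sets by (auto cong: measurable_cong_sets)
    have fE: "f \<in> borel_measurable ?E" and fL: "f \<in> borel_measurable L"
      using f(1) by (auto simp: measurable_cong_sets[OF sets_emp refl] measurable_cong_sets[OF L refl])
    have gL: "g \<in> borel_measurable L" using g by auto
    have i1: "integrable \<pi> (\<lambda>z. f (fst z))"
      using integral_emp(2)[OF f(1) elim(2), of "\<theta> n" "h0 n" "\<delta> n"] integrable_distr_eq[OF m1 fE] d1 by simp
    have i2: "integrable \<pi> (\<lambda>z. f (snd z))"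
      using f(2) integrable_distr_eq[OF m2 fL] d2 by simp
    have i3: "integrable \<pi> (\<lambda>z. g (snd z))"
      using g(1) integrable_distr_eq[OF m2 gL] d2 by simp
    have e1: "(\<integral>z. f z \<partial>?E) = (\<integral>z. f (fst z) \<partial>\<pi>)" using integral_distr[OF m1 fE] d1 by simp
    have e2: "(\<integral>z. f z \<partial>L) = (\<integral>z. f (snd z) \<partial>\<pi>)" using integral_distr[OF m2 fL] d2 by simp
    have e3: "(\<integral>z. g z \<partial>L) = (\<integral>z. g (snd z) \<partial>\<pi>)" using integral_distr[OF m2 gL] d2 by simp
    have mc: "(\<lambda>z. cost t (fst z) (snd z)) \<in> borel_measurable \<pi>"
      using measurable_cost by (simp add: measurable_cong_sets[OF sets' refl])
    have ic: "integrable \<pi> (\<lambda>z. cost t (fst z) (snd z))"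
    proof (rule integrableI_nonneg[OF mc])
      show "AE z in \<pi>. 0 \<le> cost t (fst z) (snd z)" by (simp add: cost_nonneg)
      show "(\<integral>\<^sup>+ z. ennreal (cost t (fst z) (snd z)) \<partial>\<pi>) < \<infinity>"
        using small by (rule less_trans) simp
    qed
    have cr: "(\<integral>z. cost t (fst z) (snd z) \<partial>\<pi>) \<le> ?r"
    proof -
      have "ennreal (\<integral>z. cost t (fst z) (snd z) \<partial>\<pi>) = (\<integral>\<^sup>+ z. ennreal (cost t (fst z) (snd z)) \<partial>\<pi>)"
        by (rule nn_integral_eq_integral[symmetric, OF ic]) (simp add: cost_nonneg)
      then have "ennreal (\<integral>z. cost t (fst z) (snd z) \<partial>\<pi>) < ennreal ?r" using small by simp
      moreover have "0 \<le> (\<integral>z. cost t (fst z) (snd z) \<partial>\<pi>)" by (simp add: cost_nonneg)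
      ultimately show ?thesis by (simp add: ennreal_less_iff)
    qed
    have "dist (\<integral>z. f z \<partial>?E) (\<integral>z. f z \<partial>L) = \<bar>\<integral>z. f (fst z) - f (snd z) \<partial>\<pi>\<bar>"
      unfolding e1 e2 dist_real_def using i1 i2 by simp
    also have "\<dots> \<le> (\<integral>z. \<bar>f (fst z) - f (snd z)\<bar> \<partial>\<pi>)" by (rule integral_abs_bound)
    also have "\<dots> \<le> (\<integral>z. C * cost t (fst z) (snd z) + g (snd z) \<partial>\<pi>)"
      using i1 i2 i3 ic le by (intro integral_mono) auto
    also have "\<dots> = C * (\<integral>z. cost t (fst z) (snd z) \<partial>\<pi>) + (\<integral>z. g z \<partial>L)"
      unfolding e3 using i3 ic by simp
    also have "\<dots> \<le> C * ?r + e / 3"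
      using cr C g(2) by (intro add_mono mult_left_mono) auto
    also have "\<dots> < e"
    proof -
      have "C * ?r \<le> e / 3" using C e by (simp add: field_simps)
      then show ?thesis using e by linarith
    qed
    finally show ?case using integral_emp(1)[OF f(1) elim(2), of "\<theta> n" "h0 n" "\<delta> n"] by simp
  qed
qed

lemma uniform_tail:
  assumes "integrable M (f :: 'a \<Rightarrow> real)" and f: "\<And>x. 0 \<le> f x" and "e > 0"
  shows "\<exists>K\<ge>0. (\<integral>x. f x * of_bool (f x > K) \<partial>M) \<le> e"
proof -
  have [measurable]: "f \<in> borel_measurable M" using assms(1) by auto
  have "(\<lambda>k. \<integral>x. f x * of_bool (f x > real k) \<partial>M) \<longlonglongrightarrow> (\<integral>x. 0 \<partial>M)"
  proof (rule integral_dominated_convergence[where w = f])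
    show "AE x in M. (\<lambda>k. f x * of_bool (f x > real k)) \<longlonglongrightarrow> 0"
    proof (intro AE_I2 tendsto_eventually)
      fix x
      obtain k0 :: nat where "f x < real k0" using reals_Archimedean2 by blast
      then show "\<forall>\<^sub>F k in sequentially. f x * of_bool (f x > real k) = 0"
        by (intro eventually_sequentiallyI[of k0]) auto
    qed
    show "AE x in M. norm (f x * of_bool (f x > real k)) \<le> f x" for k
      using f by (intro AE_I2) auto
  qed (use assms in auto)
  then have "\<forall>\<^sub>F k in sequentially. (\<integral>x. f x * of_bool (f x > real k) \<partial>M) < e"
    using \<open>e > 0\<close> by (intro order_tendstoD) auto
  then obtain k :: nat where "(\<integral>x. f x * of_bool (f x > real k) \<partial>M) < e"
    by (meson eventually_happens sequentially_bot)
  then show ?thesis by (intro exI[of _ "real k"]) auto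
qed


section \<open>Integrals against the product limit law\<close>

locale limit_law =
  fixes \<mu> :: "(real \<times> real) measure" and \<nu> :: "(nat \<Rightarrow> bool) measure"
  assumes \<mu>_prob: "prob_space \<mu>" and \<mu>_sets: "sets \<mu> = sets borel"
    and \<nu>_prob: "prob_space \<nu>"
    and \<nu>_sets: "sets \<nu> = sets (PiM (UNIV :: nat set) (\<lambda>_. count_space (UNIV :: bool set)))"
begin

definition \<nu>_upto :: "nat \<Rightarrow> (nat \<Rightarrow> bool) measure" where
  "\<nu>_upto t = distr \<nu> (PiM {..t} (\<lambda>_. count_space UNIV)) (\<lambda>\<omega>. restrict \<omega> {..t})"

lemma measurable_restrict_\<nu>: "(\<lambda>\<omega>. restrict \<omega> {..t}) \<in> measurable \<nu> (PiM {..t} (\<lambda>_. count_space UNIV))"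
  unfolding measurable_cong_sets[OF \<nu>_sets refl] by (rule measurable_restrict_subset) simp

lemma lim_meas_eq: "lim_meas t \<mu> \<nu> = \<mu> \<Otimes>\<^sub>M \<nu>_upto t"
  by (simp add: lim_meas_def \<nu>_upto_def)

lemma sets_lim_meas: "sets (lim_meas t \<mu> \<nu>) = sets (Xsp t)"
  unfolding lim_meas_eq Xsp_def by (intro sets_pair_measure_cong \<mu>_sets) (simp add: \<nu>_upto_def)

text \<open>Fubini on the product measure: the update pattern enters only through the probability of
  an event.\<close>

lemma integral_lim_meas:
  fixes G :: "real \<times> real \<Rightarrow> real"
  assumes G: "integrable \<mu> G" and B: "Measurable.pred (PiM {..t} (\<lambda>_. count_space UNIV)) B"
  shows "integrable (lim_meas t \<mu> \<nu>) (\<lambda>z. G (fst z) * of_bool (B (snd z)))"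
    and "(\<integral>z. G (fst z) * of_bool (B (snd z)) \<partial>lim_meas t \<mu> \<nu>)
      = (\<integral>y. G y \<partial>\<mu>) * measure \<nu> {\<omega> \<in> space \<nu>. B (restrict \<omega> {..t})}"
proof -
  interpret m: prob_space \<mu> by (rule \<mu>_prob)
  interpret v: prob_space \<nu> by (rule \<nu>_prob)
  interpret w: prob_space "\<nu>_upto t"
    unfolding \<nu>_upto_def by (rule v.prob_space_distr[OF measurable_restrict_\<nu>])
  interpret pp: pair_prob_space \<mu> "\<nu>_upto t" ..
  have B' [measurable]: "Measurable.pred (\<nu>_upto t) B" using B by (simp add: \<nu>_upto_def)
  have bm: "(\<lambda>b. of_bool (B b) :: real) \<in> borel_measurable (\<nu>_upto t)" by measurable
  have gm [measurable]: "G \<in> borel_measurable \<mu>" using G by auto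
  have 1: "integrable (\<mu> \<Otimes>\<^sub>M \<nu>_upto t) (\<lambda>z. G (fst z))"
    using integrable_distr_eq[of fst "\<mu> \<Otimes>\<^sub>M \<nu>_upto t" \<mu> G] G w.distr_pair_fst[of \<mu>] by simp
  have 2: "integrable (\<mu> \<Otimes>\<^sub>M \<nu>_upto t) (\<lambda>z. G (fst z) * of_bool (B (snd z)))"
    by (rule Bochner_Integration.integrable_bound[OF 1]) auto
  then show "integrable (lim_meas t \<mu> \<nu>) (\<lambda>z. G (fst z) * of_bool (B (snd z)))" unfolding lim_meas_eq .
  have "(\<integral>z. G (fst z) * of_bool (B (snd z)) \<partial>lim_meas t \<mu> \<nu>) = (\<integral>x. \<integral>b. G x * of_bool (B b) \<partial>\<nu>_upto t \<partial>\<mu>)"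
    unfolding lim_meas_eq using pp.integral_fst'[OF 2] by simp
  also have "\<dots> = (\<integral>x. G x * (\<integral>b. of_bool (B b) \<partial>\<nu>_upto t) \<partial>\<mu>)" by simp
  also have "\<dots> = (\<integral>x. G x \<partial>\<mu>) * (\<integral>b. of_bool (B b) \<partial>\<nu>_upto t)" by simp
  also have "(\<integral>b. of_bool (B b) \<partial>\<nu>_upto t) = (\<integral>\<omega>. of_bool (B (restrict \<omega> {..t})) \<partial>\<nu> :: real)"
    unfolding \<nu>_upto_def by (rule integral_distr[OF measurable_restrict_\<nu>]) (use B in measurable)
  also have "\<dots> = (\<integral>\<omega>. indicator {\<omega> \<in> space \<nu>. B (restrict \<omega> {..t})} \<omega> \<partial>\<nu>)"
    by (intro Bochner_Integration.integral_cong) (auto simp: indicator_def)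
  also have "\<dots> = measure \<nu> {\<omega> \<in> space \<nu>. B (restrict \<omega> {..t})}"
  proof -
    have "{\<omega> \<in> space \<nu>. B (restrict \<omega> {..t})} \<inter> space \<nu> = {\<omega> \<in> space \<nu>. B (restrict \<omega> {..t})}" by auto
    then show ?thesis by simp
  qed
  finally show "(\<integral>z. G (fst z) * of_bool (B (snd z)) \<partial>lim_meas t \<mu> \<nu>)
      = (\<integral>y. G y \<partial>\<mu>) * measure \<nu> {\<omega> \<in> space \<nu>. B (restrict \<omega> {..t})}" .
qed

lemma integral_lim_meas_fst:
  fixes G :: "real \<times> real \<Rightarrow> real"
  assumes G: "integrable \<mu> G"
  shows "integrable (lim_meas t \<mu> \<nu>) (\<lambda>z. G (fst z))" and "(\<integral>z. G (fst z) \<partial>lim_meas t \<mu> \<nu>) = (\<integral>y. G y \<partial>\<mu>)"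
proof -
  have "measure \<nu> {\<omega> \<in> space \<nu>. True} = 1" using prob_space.prob_space[OF \<nu>_prob] by simp
  then show "integrable (lim_meas t \<mu> \<nu>) (\<lambda>z. G (fst z))" "(\<integral>z. G (fst z) \<partial>lim_meas t \<mu> \<nu>) = (\<integral>y. G y \<partial>\<mu>)"
    using integral_lim_meas[OF G, where t = t and B = "\<lambda>_. True"] by auto
qed

end

section \<open>Inequalities for the quadratic cost\<close>

lemma abs_diff_squares_le:
  fixes u v :: real
  assumes "\<eta> > 0"
  shows "\<bar>u\<^sup>2 - v\<^sup>2\<bar> \<le> (1 + 1 / \<eta>) * (u - v)\<^sup>2 + \<eta> * v\<^sup>2"
proof -
  let ?d = "\<bar>u - v\<bar>"
  \<comment> \<open>Young's inequality. The large weight falls on the difference, which the cost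
    controls, and the small one on the square of \<open>v\<close>, which has bounded
    integral.\<close>
  have "2 * ?d * \<bar>v\<bar> \<le> ?d\<^sup>2 / \<eta> + \<eta> * v\<^sup>2"
  proof -
    have "0 \<le> (?d / sqrt \<eta> - sqrt \<eta> * \<bar>v\<bar>)\<^sup>2" by simp
    also have "\<dots> = ?d\<^sup>2 / \<eta> + \<eta> * v\<^sup>2 - 2 * ?d * \<bar>v\<bar>"
      using assms by (simp add: power2_diff power_divide power_mult_distrib)
    finally show ?thesis by simp
  qed
  moreover have "\<bar>u\<^sup>2 - v\<^sup>2\<bar> \<le> ?d\<^sup>2 + 2 * ?d * \<bar>v\<bar>"
  proof -
    have "u\<^sup>2 - v\<^sup>2 = (u - v) * ((u - v) + 2 * v)" by (simp add: power2_eq_square algebra_simps)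
    then have "\<bar>u\<^sup>2 - v\<^sup>2\<bar> = ?d * \<bar>(u - v) + 2 * v\<bar>" by (simp add: abs_mult)
    also have "\<dots> \<le> ?d * (?d + 2 * \<bar>v\<bar>)" by (intro mult_left_mono) auto
    finally show ?thesis by (simp add: algebra_simps power2_eq_square)
  qed
  ultimately show ?thesis by (simp add: distrib_right)
qed

lemma abs_diff_products_le:
  fixes u h v k :: real
  assumes "\<eta> > 0"
  shows "\<bar>u * h - v * k\<bar> \<le> (1 + 1 / \<eta>) * ((u - v)\<^sup>2 + (h - k)\<^sup>2) + \<eta> * (v\<^sup>2 + k\<^sup>2)"
proof -
  have young: "\<bar>a * b\<bar> \<le> a\<^sup>2 / \<eta> + \<eta> * b\<^sup>2" for a b :: real
  proof -
    have "0 \<le> (\<bar>a\<bar> / sqrt \<eta> - sqrt \<eta> * \<bar>b\<bar>)\<^sup>2" by simp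
    also have "\<dots> = a\<^sup>2 / \<eta> + \<eta> * b\<^sup>2 - 2 * \<bar>a * b\<bar>"
      using assms by (simp add: power2_diff power_divide power_mult_distrib abs_mult)
    finally show ?thesis by simp
  qed
  have "\<bar>(u - v) * (h - k)\<bar> \<le> (u - v)\<^sup>2 + (h - k)\<^sup>2"
  proof -
    have "2 * \<bar>a * b\<bar> \<le> a\<^sup>2 + b\<^sup>2" for a b :: real
      using zero_le_power2[of "\<bar>a\<bar> - \<bar>b\<bar>"] by (simp add: power2_diff abs_mult)
    from this[of "u - v" "h - k"] show ?thesis by linarith
  qed
  moreover have "\<bar>(u - v) * k\<bar> \<le> (u - v)\<^sup>2 / \<eta> + \<eta> * k\<^sup>2" "\<bar>(h - k) * v\<bar> \<le> (h - k)\<^sup>2 / \<eta> + \<eta> * v\<^sup>2"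
    by (rule young)+
  moreover have "u * h - v * k = (u - v) * (h - k) + (u - v) * k + (h - k) * v" by (simp add: algebra_simps)
  ultimately have "\<bar>u * h - v * k\<bar> \<le> (u - v)\<^sup>2 + (h - k)\<^sup>2 + ((u - v)\<^sup>2 / \<eta> + \<eta> * k\<^sup>2) + ((h - k)\<^sup>2 / \<eta> + \<eta> * v\<^sup>2)"
    by linarith
  then show ?thesis by (simp add: algebra_simps add_divide_distrib)
qed

lemma cost_ge:
  "(fst (fst z) - fst (fst z'))\<^sup>2 + (snd (fst z) - snd (fst z'))\<^sup>2 \<le> cost t z z'"
  unfolding cost_def by (simp add: sum_nonneg)

lemma cost_ge_of_string_neq:
  assumes "r \<le> t" and "snd z r \<noteq> snd z' r"
  shows "(fst (fst z) - fst (fst z'))\<^sup>2 + 1 \<le> cost t z z'"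
proof -
  let ?f = "\<lambda>s. (of_bool (snd z s) - of_bool (snd z' s) :: real)\<^sup>2"
  have "1 = ?f r" using assms(2) by auto
  also have "\<dots> \<le> (\<Sum>s\<le>t. ?f s)" using assms(1) by (intro member_le_sum) auto
  finally show ?thesis
    unfolding cost_def using zero_le_power2[of "snd (fst z) - snd (fst z')"] by linarith
qed

context limit_law
begin

context
  fixes \<theta> h0 :: "nat \<Rightarrow> nat \<Rightarrow> real" and \<delta> :: "nat \<Rightarrow> nat \<Rightarrow> nat \<Rightarrow> bool" and t :: nat
  assumes W2: "(\<lambda>n. W2sq (cost t) (emp n t (\<theta> n) (h0 n) (\<delta> n)) (lim_meas t \<mu> \<nu>)) \<longlonglongrightarrow> 0"
begin

text \<open>The indicator changes only if some bit up to \<open>t\<close> differs, which costs at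
  least 1, so C = 1 and g = 0 serve for every \<open>e\<close>.\<close>

lemma frequency_limit:
  assumes B: "Measurable.pred (PiM {..t} (\<lambda>_. count_space UNIV)) B"
    and dep: "\<And>b b'. (\<forall>r\<le>t. b r = b' r) \<Longrightarrow> B b = B b'"
  shows "(\<lambda>n. (\<Sum>i<n. of_bool (B (\<lambda>s. \<delta> n s i))) / real n) \<longlonglongrightarrow> measure \<nu> {\<omega> \<in> space \<nu>. B \<omega>}"
proof -
  let ?f = "\<lambda>z :: (real \<times> real) \<times> (nat \<Rightarrow> bool). of_bool (B (snd z)) :: real"
  interpret m: prob_space \<mu> by (rule \<mu>_prob)
  have one: "integrable \<mu> (\<lambda>_. 1 :: real)" "(\<integral>y. 1 \<partial>\<mu>) = (1::real)"
    by (auto simp: m.prob_space)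
  have "(\<lambda>n. (\<Sum>i<n. ?f ((\<theta> n i, h0 n i), restrict (\<lambda>s. \<delta> n s i) {..t})) / real n) \<longlonglongrightarrow> (\<integral>z. ?f z \<partial>lim_meas t \<mu> \<nu>)"
  proof (rule W2_empirical_limit[OF W2 sets_lim_meas])
    show "?f \<in> borel_measurable (Xsp t)"
      using measurable_compose[OF measurable_string B] by measurable
    show "integrable (lim_meas t \<mu> \<nu>) ?f" using integral_lim_meas(1)[OF one(1) B] by simp
    fix e :: real assume "e > 0"
    have "\<bar>?f z - ?f z'\<bar> \<le> 1 * cost t z z' + 0" for z z'
    proof (cases "\<forall>r\<le>t. snd z r = snd z' r")
      case True
      then have "B (snd z) = B (snd z')" by (rule dep)
      then show ?thesis by (simp add: cost_nonneg)
    next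
      case False
      then obtain r where "r \<le> t" "snd z r \<noteq> snd z' r" by blast
      from cost_ge_of_string_neq[OF this] have "1 \<le> cost t z z'"
        using zero_le_power2[of "fst (fst z) - fst (fst z')"] by linarith
      then show ?thesis by auto
    qed
    then show "\<exists>C\<ge>0. \<exists>g. integrable (lim_meas t \<mu> \<nu>) g \<and> (\<integral>z. g z \<partial>lim_meas t \<mu> \<nu>) \<le> e \<and>
       (\<forall>z z'. \<bar>?f z - ?f z'\<bar> \<le> C * cost t z z' + g z')"
      using \<open>e > 0\<close> by (intro exI[of _ 1] conjI exI[of _ "\<lambda>_. 0"]) auto
  qed
  moreover have "B (restrict b {..t}) = B b" for b by (rule dep) simp
  moreover have "(\<integral>z. ?f z \<partial>lim_meas t \<mu> \<nu>) = measure \<nu> {\<omega> \<in> space \<nu>. B (restrict \<omega> {..t})}"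
    using integral_lim_meas(2)[OF one(1) B] one(2) by simp
  ultimately show ?thesis by simp
qed

text \<open>On equal strings Young's inequality suffices. On different strings the indicator may
  cost a full v^2, which is unbounded; cut at \<open>K\<close>, the bounded part is paid for by the
  unit cost of a differing bit and the rest by the tail.\<close>

lemma square_limit:
  assumes B: "Measurable.pred (PiM {..t} (\<lambda>_. count_space UNIV)) B"
    and dep: "\<And>b b'. (\<forall>r\<le>t. b r = b' r) \<Longrightarrow> B b = B b'"
    and int: "integrable \<mu> (\<lambda>z. (fst z)\<^sup>2)" and mom: "(\<integral>z. (fst z)\<^sup>2 \<partial>\<mu>) = 1"
  shows "(\<lambda>n. (\<Sum>i<n. of_bool (B (\<lambda>s. \<delta> n s i)) * (\<theta> n i)\<^sup>2) / real n) \<longlonglongrightarrow> measure \<nu> {\<omega> \<in> space \<nu>. B \<omega>}"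
proof -
  let ?f = "\<lambda>z :: (real \<times> real) \<times> (nat \<Rightarrow> bool). (fst (fst z))\<^sup>2 * of_bool (B (snd z)) :: real"
  let ?L = "lim_meas t \<mu> \<nu>"
  have "(\<lambda>n. (\<Sum>i<n. ?f ((\<theta> n i, h0 n i), restrict (\<lambda>s. \<delta> n s i) {..t})) / real n) \<longlonglongrightarrow> (\<integral>z. ?f z \<partial>?L)"
  proof (rule W2_empirical_limit[OF W2 sets_lim_meas])
    show "?f \<in> borel_measurable (Xsp t)"
      using measurable_compose[OF measurable_string B] by measurable
    show "integrable ?L ?f" using integral_lim_meas(1)[OF int B] by simp
    fix e :: real assume e: "e > 0"
    then obtain K where K: "K \<ge> 0" "(\<integral>y. (fst y)\<^sup>2 * of_bool ((fst y)\<^sup>2 > K) \<partial>\<mu>) \<le> e / 2"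
      using uniform_tail[OF int, of "e / 2"] by auto
    \<comment> \<open>The Young term has integral e/2 by the unit second moment, and the tail at
      most e/2 by the choice of \<open>K\<close>.\<close>
    let ?h = "\<lambda>y :: real \<times> real. e / 2 * (fst y)\<^sup>2 + (fst y)\<^sup>2 * of_bool ((fst y)\<^sup>2 > K)"
    have int2: "integrable \<mu> (\<lambda>y. (fst y)\<^sup>2 * of_bool ((fst y)\<^sup>2 > K))"
    proof (rule Bochner_Integration.integrable_bound[OF int])
      have [measurable]: "(\<lambda>y. (fst y)\<^sup>2) \<in> borel_measurable \<mu>" using int by auto
      show "(\<lambda>y. (fst y)\<^sup>2 * of_bool ((fst y)\<^sup>2 > K)) \<in> borel_measurable \<mu>" by measurable
    qed auto
    have h: "integrable \<mu> ?h" "(\<integral>y. ?h y \<partial>\<mu>) \<le> e" using int int2 K(2) mom by auto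
    have "\<bar>?f z - ?f z'\<bar> \<le> (1 + 1 / (e / 2) + K) * cost t z z' + ?h (fst z')" for z z'
    proof -
      let ?u = "fst (fst z)" and ?v = "fst (fst z')"
      let ?c = "1 + 1 / (e / 2)"
      have sq: "\<bar>?u\<^sup>2 - ?v\<^sup>2\<bar> \<le> ?c * (?u - ?v)\<^sup>2 + e / 2 * ?v\<^sup>2"
        using e by (intro abs_diff_squares_le) auto
      have c: "?c \<ge> 0" using e by simp
      have uv: "(?u - ?v)\<^sup>2 \<le> cost t z z'" using cost_ge[of z z' t] zero_le_power2[of "snd (fst z) - snd (fst z')"] by linarith
      show ?thesis
      proof (cases "\<forall>r\<le>t. snd z r = snd z' r")
        case True
        then have "B (snd z) = B (snd z')" by (rule dep)
        then have "\<bar>?f z - ?f z'\<bar> \<le> \<bar>?u\<^sup>2 - ?v\<^sup>2\<bar>" by (cases "B (snd z)") auto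
        also note sq
        also have "?c * (?u - ?v)\<^sup>2 \<le> ?c * cost t z z'" using uv c by (rule mult_left_mono)
        also have "\<dots> \<le> (?c + K) * cost t z z'" using K(1) cost_nonneg by (intro mult_right_mono) auto
        finally have "\<bar>?f z - ?f z'\<bar> \<le> (?c + K) * cost t z z' + e / 2 * ?v\<^sup>2" by simp
        moreover have "0 \<le> ?v\<^sup>2 * of_bool (?v\<^sup>2 > K)" by simp
        ultimately show ?thesis by linarith
      next
        case False
        then obtain r where "r \<le> t" "snd z r \<noteq> snd z' r" by blast
        then have c1: "(?u - ?v)\<^sup>2 + 1 \<le> cost t z z'" by (rule cost_ge_of_string_neq)
        have "\<bar>?f z - ?f z'\<bar> \<le> \<bar>?u\<^sup>2 - ?v\<^sup>2\<bar> + ?v\<^sup>2" by (cases "B (snd z)"; cases "B (snd z')") auto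
        moreover have "?v\<^sup>2 \<le> K + ?v\<^sup>2 * of_bool (?v\<^sup>2 > K)" using K(1) by auto
        moreover have "?c * (?u - ?v)\<^sup>2 \<le> ?c * cost t z z'" using uv c by (rule mult_left_mono)
        moreover have "K * 1 \<le> K * cost t z z'"
          using c1 K(1) zero_le_power2[of "?u - ?v"] by (intro mult_left_mono) linarith+
        ultimately show ?thesis using sq unfolding distrib_right[of ?c K] by linarith
      qed
    qed
    moreover have "1 + 1 / (e / 2) + K \<ge> 0" using e K(1) by simp
    moreover have "integrable ?L (\<lambda>z. ?h (fst z))" "(\<integral>z. ?h (fst z) \<partial>?L) \<le> e"
      using integral_lim_meas_fst[OF h(1), of t] h(2) by auto
    ultimately show "\<exists>C\<ge>0. \<exists>g. integrable ?L g \<and> (\<integral>z. g z \<partial>?L) \<le> e \<and> (\<forall>z z'. \<bar>?f z - ?f z'\<bar> \<le> C * cost t z z' + g z')"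
      by blast
  qed
  moreover have "B (restrict b {..t}) = B b" for b by (rule dep) simp
  moreover have "(\<integral>z. ?f z \<partial>?L) = measure \<nu> {\<omega> \<in> space \<nu>. B (restrict \<omega> {..t})}"
    using integral_lim_meas(2)[OF int B] mom by simp
  ultimately show ?thesis by (simp add: mult.commute)
qed

lemma product_limit:
  assumes int: "integrable \<mu> (\<lambda>z. (fst z)\<^sup>2)" "(\<integral>z. (fst z)\<^sup>2 \<partial>\<mu>) = 1"
    "integrable \<mu> (\<lambda>z. (snd z)\<^sup>2)" "(\<integral>z. (snd z)\<^sup>2 \<partial>\<mu>) = 1"
  shows "(\<lambda>n. vinner n (\<theta> n) (h0 n) / real n) \<longlonglongrightarrow> (\<integral>z. fst z * snd z \<partial>\<mu>)"
proof -
  let ?f = "\<lambda>z :: (real \<times> real) \<times> (nat \<Rightarrow> bool). fst (fst z) * snd (fst z)"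
  let ?L = "lim_meas t \<mu> \<nu>"
  have meas: "(\<lambda>z. fst z * snd z) \<in> borel_measurable \<mu>"
    unfolding measurable_cong_sets[OF \<mu>_sets refl] borel_prod[symmetric] by measurable
  have prod: "integrable \<mu> (\<lambda>z. fst z * snd z)"
  proof (rule Bochner_Integration.integrable_bound[OF Bochner_Integration.integrable_add[OF int(1,3)] meas], rule AE_I2)
    fix z :: "real \<times> real"
    have "0 \<le> (\<bar>fst z\<bar> - \<bar>snd z\<bar>)\<^sup>2" by simp
    then have "2 * \<bar>fst z * snd z\<bar> \<le> (fst z)\<^sup>2 + (snd z)\<^sup>2" by (simp add: power2_diff abs_mult)
    then show "norm (fst z * snd z) \<le> norm ((fst z)\<^sup>2 + (snd z)\<^sup>2)" by simp
  qed
  have "(\<lambda>n. (\<Sum>i<n. ?f ((\<theta> n i, h0 n i), restrict (\<lambda>s. \<delta> n s i) {..t})) / real n) \<longlonglongrightarrow> (\<integral>z. ?f z \<partial>?L)"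
  proof (rule W2_empirical_limit[OF W2 sets_lim_meas])
    show "?f \<in> borel_measurable (Xsp t)" by measurable
    show "integrable ?L ?f" using integral_lim_meas_fst(1)[OF prod] by simp
    fix e :: real assume e: "e > 0"
    \<comment> \<open>Both second moments equal 1, so the integral is exactly
      \<open>e\<close>.\<close>
    let ?h = "\<lambda>y :: real \<times> real. e / 2 * ((fst y)\<^sup>2 + (snd y)\<^sup>2)"
    have h: "integrable \<mu> ?h" "(\<integral>y. ?h y \<partial>\<mu>) \<le> e" using int e by auto
    have "\<bar>?f z - ?f z'\<bar> \<le> (1 + 1 / (e / 2)) * cost t z z' + ?h (fst z')" for z z'
    proof -
      have "\<bar>?f z - ?f z'\<bar> \<le> (1 + 1 / (e / 2)) * ((fst (fst z) - fst (fst z'))\<^sup>2 + (snd (fst z) - snd (fst z'))\<^sup>2) + ?h (fst z')"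
        using e by (intro abs_diff_products_le) auto
      also have "\<dots> \<le> (1 + 1 / (e / 2)) * cost t z z' + ?h (fst z')"
        using e by (intro add_right_mono mult_left_mono cost_ge) auto
      finally show ?thesis .
    qed
    moreover have "1 + 1 / (e / 2) \<ge> 0" using e by simp
    moreover have "integrable ?L (\<lambda>z. ?h (fst z))" "(\<integral>z. ?h (fst z) \<partial>?L) \<le> e"
      using integral_lim_meas_fst[OF h(1), of t] h(2) by auto
    ultimately show "\<exists>C\<ge>0. \<exists>g. integrable ?L g \<and> (\<integral>z. g z \<partial>?L) \<le> e \<and> (\<forall>z z'. \<bar>?f z - ?f z'\<bar> \<le> C * cost t z z' + g z')"
      by blast
  qed
  moreover have "(\<integral>z. ?f z \<partial>?L) = (\<integral>z. fst z * snd z \<partial>\<mu>)" by (rule integral_lim_meas_fst(2)[OF prod])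
  ultimately show ?thesis by (simp add: vinner_def)
qed

end
end

section \<open>The overlap of the estimates\<close>

lemma tau_eq_iff:
  assumes "\<delta> 0 i" and "s < Suc t"
  shows "tau \<delta> (Suc t) i = s \<longleftrightarrow> \<delta> s i \<and> (\<forall>r. s < r \<and> r < Suc t \<longrightarrow> \<not> \<delta> r i)"
proof -
  have "tau \<delta> (Suc t) i = s \<longleftrightarrow> s \<in> {s. s < Suc t \<and> \<delta> s i} \<and> (\<forall>r\<in>{s. s < Suc t \<and> \<delta> s i}. r \<le> s)"
    unfolding tau_def using assms(1) by (intro Max_eq_iff) auto
  then show ?thesis using assms(2) by (auto simp: not_less[symmetric])
qed

theorem theorem4:
  fixes P :: "'w measure"
    and Z :: "nat \<Rightarrow> 'w \<Rightarrow> nat \<Rightarrow> nat \<Rightarrow> real"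
    and \<theta> :: "nat \<Rightarrow> nat \<Rightarrow> real"
    and h0 :: "nat \<Rightarrow> nat \<Rightarrow> real"
    and \<delta> :: "nat \<Rightarrow> nat \<Rightarrow> nat \<Rightarrow> bool"
    and \<mu> :: "(real \<times> real) measure"
    and \<nu> :: "(nat \<Rightarrow> bool) measure"
    and lam :: real
    and t :: nat
  assumes lam: "lam \<ge> 0"
    and P: "prob_space P"
    and Z_sym: "\<And>n \<omega> i j. i < n \<Longrightarrow> j < n \<Longrightarrow> Z n \<omega> i j = Z n \<omega> j i"
    and Z_indep: "\<And>n. n \<ge> 1 \<Longrightarrow>
          prob_space.indep_vars P (\<lambda>_. borel) (\<lambda>(i, j) \<omega>. Z n \<omega> i j) {(i, j). i \<le> j \<and> j < n}"
    and Z_off: "\<And>n i j. n \<ge> 1 \<Longrightarrow> i < j \<Longrightarrow> j < n \<Longrightarrow>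
          distributed P lborel (\<lambda>\<omega>. Z n \<omega> i j) (normal_density 0 (sqrt (1 / real n)))"
    and Z_diag: "\<And>n i. n \<ge> 1 \<Longrightarrow> i < n \<Longrightarrow>
          distributed P lborel (\<lambda>\<omega>. Z n \<omega> i i) (normal_density 0 (sqrt (2 / real n)))"
    and h0_norm: "\<And>n. n \<ge> 1 \<Longrightarrow> vnorm n (h0 n) = sqrt (real n)"
    and \<delta>0: "\<And>n i. n \<ge> 1 \<Longrightarrow> i < n \<Longrightarrow> \<delta> n 0 i"
    and \<mu>_prob: "prob_space \<mu>" and \<mu>_sets: "sets \<mu> = sets borel"
    and \<mu>_int1: "integrable \<mu> (\<lambda>z. (fst z)\<^sup>2)" and \<mu>_mom1: "(\<integral>z. (fst z)\<^sup>2 \<partial>\<mu>) = 1"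
    and \<mu>_int2: "integrable \<mu> (\<lambda>z. (snd z)\<^sup>2)" and \<mu>_mom2: "(\<integral>z. (snd z)\<^sup>2 \<partial>\<mu>) = 1"
    and \<nu>_prob: "prob_space \<nu>"
    and \<nu>_sets: "sets \<nu> = sets (PiM (UNIV :: nat set) (\<lambda>_. count_space (UNIV :: bool set)))"
    and W2conv: "\<And>s. (\<lambda>n. W2sq (cost s) (emp n s (\<theta> n) (h0 n) (\<delta> n)) (lim_meas s \<mu> \<nu>))
                       \<longlonglongrightarrow> 0"
    and t: "t \<ge> 1"
  shows "\<forall>\<epsilon>>0. (\<lambda>n. measure P {\<omega> \<in> space P.
            \<bar>vinner n (\<theta> n)
                 (theta_hat n (\<lambda>i j. lam / real n * \<theta> n i * \<theta> n j + Z n \<omega> i j) (\<delta> n) (h0 n) t) / real n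
             - rho lam (\<integral>z. fst z * snd z \<partial>\<mu>) (pt \<nu>) t\<bar> > \<epsilon>}) \<longlonglongrightarrow> 0"
proof (intro allI impI)
  fix \<epsilon> :: real assume \<epsilon>: "\<epsilon> > 0"
  interpret prob_space P by (rule P)
  interpret limit_law \<mu> \<nu>
    by (rule limit_law.intro[OF \<mu>_prob \<mu>_sets \<nu>_prob \<nu>_sets])
  have goe: "goe P n (Z n)" if "n \<ge> 1" for n
    using that Z_sym Z_indep Z_off Z_diag by unfold_locales auto
  \<comment> \<open>The value of \<open>tau\<close> at time \<open>Suc t\<close> is decided by the
    bits 0 to t, so Wasserstein convergence at level \<open>t\<close> supplies the limits at time
    \<open>Suc t\<close>.\<close>
  let ?B = "\<lambda>t s b. b s \<and> (\<forall>r. s < r \<and> r < Suc t \<longrightarrow> \<not> b r)"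
  have B: "Measurable.pred (PiM {..t} (\<lambda>_. count_space UNIV)) (?B t s)" if s: "s < Suc t" for t s :: nat
  proof -
    have bit: "Measurable.pred (PiM {..t} (\<lambda>_. count_space UNIV)) (\<lambda>b. b r)" if "r \<le> t" for r
      using that by (intro measurable_component_singleton) auto
    have eq: "?B t s = (\<lambda>b. b s \<and> (\<forall>r\<in>{s<..t}. \<not> b r))" by (auto simp: fun_eq_iff less_Suc_eq_le)
    show ?thesis
      unfolding eq using s by (intro pred_intros_logic pred_intros_finite bit) auto
  qed
  have dep: "?B t s b = ?B t s b'" if "s < Suc t" "\<forall>r\<le>t. b r = b' r" for t s and b b' :: "nat \<Rightarrow> bool"
    using that by (auto simp: less_Suc_eq_le)
  have tau: "(tau (\<delta> n) (Suc t) i = s) = ?B t s (\<lambda>s. \<delta> n s i)" if "s < Suc t" "i < n" for n i t s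
    using that \<delta>0[of n i] by (intro tau_eq_iff) auto
  interpret amp P Z \<theta> h0 \<delta> lam "\<integral>z. fst z * snd z \<partial>\<mu>" "pt \<nu>"
  proof (intro amp.intro goe_sequence.intro goe_sequence_axioms.intro amp_axioms.intro P)
    show "goe P n (Z n)" if "n \<ge> 1" for n by (rule goe[OF that])
    show "vnorm n (h0 n) = sqrt (real n)" if "n \<ge> 1" for n by (rule h0_norm[OF that])
    show "\<delta> n 0 i" if "n \<ge> 1" "i < n" for n i by (rule \<delta>0[OF that])
    have "measure \<nu> {\<omega> \<in> space \<nu>. True} = 1" using prob_space.prob_space[OF \<nu>_prob] by simp
    \<comment> \<open>The trivial event leaves the whole squared norm of theta.\<close>
    then show "(\<lambda>n. sqnorm n (\<theta> n) / real n) \<longlonglongrightarrow> 1"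
      using square_limit[OF W2conv, where B = "\<lambda>_. True"] \<mu>_int1 \<mu>_mom1 by (simp add: sqnorm_def)
    show "(\<lambda>n. vinner n (\<theta> n) (h0 n) / real n) \<longlonglongrightarrow> (\<integral>z. fst z * snd z \<partial>\<mu>)"
      by (rule product_limit[OF W2conv \<mu>_int1 \<mu>_mom1 \<mu>_int2 \<mu>_mom2])
    fix t s :: nat assume s: "s < Suc t"
    have "(\<lambda>n. (\<Sum>i<n. of_bool (?B t s (\<lambda>s. \<delta> n s i)) * (\<theta> n i)\<^sup>2) / real n) \<longlonglongrightarrow> measure \<nu> {\<omega> \<in> space \<nu>. ?B t s \<omega>}"
      by (rule square_limit[OF W2conv B[OF s] dep[OF s] \<mu>_int1 \<mu>_mom1])
    moreover have "(\<Sum>i<n. of_bool (?B t s (\<lambda>s. \<delta> n s i)) * (\<theta> n i)\<^sup>2) = (\<Sum>i<n. of_bool (tau (\<delta> n) (Suc t) i = s) * (\<theta> n i)\<^sup>2)" for n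
      using tau[OF s] by (intro sum.cong refl) simp
    ultimately show "(\<lambda>n. (\<Sum>i<n. of_bool (tau (\<delta> n) (Suc t) i = s) * (\<theta> n i)\<^sup>2) / real n) \<longlonglongrightarrow> pt \<nu> (Suc t) s"
      by (simp add: pt_def)
    have "(\<lambda>n. (\<Sum>i<n. of_bool (?B t s (\<lambda>s. \<delta> n s i))) / real n) \<longlonglongrightarrow> measure \<nu> {\<omega> \<in> space \<nu>. ?B t s \<omega>}"
      by (rule frequency_limit[OF W2conv B[OF s] dep[OF s]])
    moreover have "(\<Sum>i<n. of_bool (?B t s (\<lambda>s. \<delta> n s i))) = real (wts n (\<delta> n) (Suc t) s)" for n
    proof -
      have "(\<Sum>i<n. of_bool (?B t s (\<lambda>s. \<delta> n s i))) = (\<Sum>i<n. of_bool (tau (\<delta> n) (Suc t) i = s) :: real)"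
        using tau[OF s] by (intro sum.cong refl) simp
      also have "\<dots> = real (card ({..<n} \<inter> {i. tau (\<delta> n) (Suc t) i = s}))" by (subst sum_of_bool_eq) auto
      also have "{..<n} \<inter> {i. tau (\<delta> n) (Suc t) i = s} = {i. i < n \<and> tau (\<delta> n) (Suc t) i = s}" by auto
      finally show ?thesis by (simp add: wts_def)
    qed
    ultimately show "(\<lambda>n. real (wts n (\<delta> n) (Suc t) s) / real n) \<longlonglongrightarrow> pt \<nu> (Suc t) s"
      by (simp add: pt_def)
  qed
  from tendsto_prob_filterD[OF state_evolution[THEN conjunct2, THEN conjunct1] \<epsilon>, of t]
  show "(\<lambda>n. measure P {\<omega> \<in> space P.
            \<bar>vinner n (\<theta> n)
                 (theta_hat n (\<lambda>i j. lam / real n * \<theta> n i * \<theta> n j + Z n \<omega> i j) (\<delta> n) (h0 n) t) / real n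
             - rho lam (\<integral>z. fst z * snd z \<partial>\<mu>) (pt \<nu>) t\<bar> > \<epsilon>}) \<longlonglongrightarrow> 0"
    by (simp only: overlap_def fst_conv snd_conv)
qed

end
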